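(* There exists a universal constant $C>0$ such that the following holds. Let $n,d$ be integers with $1\le d\le n-1$, let $E\subseteq\mathbb{R}^n$ be a linear subspace of dimension $d$, and let $\mathcal{K}=P_E B_1^n$ and $\mathcal{T}=P_E S_n$. Then $$L_{\mathcal{K}}\le C\sqrt{n/d}\qquad\text{and}\qquad L_{\mathcal{T}}\le C\sqrt{n/d}.$$
   Context: $P_E$ denotes the orthogonal projection onto $E$. $B_1^n=\{x\in\mathbb{R}^n:\sum_i|x_i|\le1\}$ is the unit ball of $\ell_1^n$. $S_n$ is an $n$-dimensional regular simplex in $\mathbb{R}^n$ with center of mass at the origin. A convex body $K$ (compact convex set with non-empty interior) in a $d$-dimensional Euclidean space is isotropic if $\mathrm{Vol}_d(K)=1$, its barycenter is at the origin, and there is $L_K>0$ with $\int_K\langle x,\theta\rangle^2\,dx=L_K^2$ for every unit vector $\theta$. Every convex body $K$ has an isotropic image $K_1$ under an invertible affine map, and its isotropy constant is $L_K:=L_{K_1}$ (well defined). The isotropy constants of $\mathcal{K}$ and $\mathcal{T}$ are taken regarding them as convex bodies in the $d$-dimensional Euclidean space $E$. *)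

theory Defs
  imports "HOL-Analysis.Analysis"
begin

text \<open>
  The constant in the theorem is uniform in the dimension, so the dimension cannot be a type. All
  spaces \<open>\<real>\<^sup>n\<close> are therefore realised inside one inner product space, the finitely supported real
  sequences with the \<open>\<ell>\<^sub>2\<close> inner product. Norm, topology, subspace, dimension and
  convexity are those of the library.
\<close>

typedef fseq = "{f :: nat \<Rightarrow> real. finite {i. f i \<noteq> 0}}"
  morphisms coord Abs_fseq
  by (rule exI[of _ "\<lambda>_. 0"]) simp

setup_lifting type_definition_fseq

lemma finite_support [simp]: "finite {i. coord x i \<noteq> 0}"
  using coord by auto

instantiation fseq :: real_vector
begin

lift_definition zero_fseq :: fseq is "\<lambda>_. 0" by simp

lift_definition plus_fseq :: "fseq \<Rightarrow> fseq \<Rightarrow> fseq" is "\<lambda>f g i. f i + g i"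
  subgoal for f g by (rule finite_subset[of _ "{i. f i \<noteq> 0} \<union> {i. g i \<noteq> 0}"]) auto
  done

lift_definition uminus_fseq :: "fseq \<Rightarrow> fseq" is "\<lambda>f i. - f i" by simp

lift_definition minus_fseq :: "fseq \<Rightarrow> fseq \<Rightarrow> fseq" is "\<lambda>f g i. f i - g i"
  subgoal for f g by (rule finite_subset[of _ "{i. f i \<noteq> 0} \<union> {i. g i \<noteq> 0}"]) auto
  done

lift_definition scaleR_fseq :: "real \<Rightarrow> fseq \<Rightarrow> fseq" is "\<lambda>r f i. r * f i"
  subgoal for r f by (rule finite_subset[of _ "{i. f i \<noteq> 0}"]) auto
  done

instance
  by standard (transfer; simp add: algebra_simps)+

end

lemma coord_simps [simp]:
  "coord 0 i = 0"
  "coord (x + y) i = coord x i + coord y i"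
  "coord (- x) i = - coord x i"
  "coord (x - y) i = coord x i - coord y i"
  "coord (r *\<^sub>R x) i = r * coord x i"
  by (transfer, simp)+

instantiation fseq :: real_inner
begin

definition inner_fseq :: "fseq \<Rightarrow> fseq \<Rightarrow> real"
  where "inner_fseq x y = (\<Sum>i\<in>{i. coord x i \<noteq> 0}. coord x i * coord y i)"

definition norm_fseq :: "fseq \<Rightarrow> real"
  where "norm_fseq x = sqrt (inner x x)"

definition sgn_fseq :: "fseq \<Rightarrow> fseq"
  where "sgn_fseq x = x /\<^sub>R norm x"

definition dist_fseq :: "fseq \<Rightarrow> fseq \<Rightarrow> real"
  where "dist_fseq x y = norm (x - y)"

definition uniformity_fseq :: "(fseq \<times> fseq) filter"
  where "uniformity_fseq = (INF e\<in>{0<..}. principal {(x, y). dist x y < e})"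

definition open_fseq :: "fseq set \<Rightarrow> bool"
  where "open_fseq U = (\<forall>x\<in>U. \<forall>\<^sub>F (x', y) in uniformity. x' = x \<longrightarrow> y \<in> U)"

lemma inner_fseq_superset:
  assumes "finite A" "{i. coord x i \<noteq> 0} \<subseteq> A"
  shows "inner x y = (\<Sum>i\<in>A. coord x i * coord y i)"
  unfolding inner_fseq_def using assms by (intro sum.mono_neutral_left) auto

instance
proof
  fix x y z :: fseq and r :: real
  let ?S = "\<lambda>x. {i. coord x i \<noteq> 0}"
  let ?A = "?S x \<union> ?S y"
  have A: "finite ?A" by simp
  show "inner x y = inner y x"
    using inner_fseq_superset[OF A, of x y] inner_fseq_superset[OF A, of y x]
    by (simp add: mult.commute)
  have "?S (x + y) \<subseteq> ?A" by auto
  then show "inner (x + y) z = inner x z + inner y z"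
    using inner_fseq_superset[OF A, of x z] inner_fseq_superset[OF A, of y z]
      inner_fseq_superset[OF A, of "x + y" z]
    by (simp add: sum.distrib distrib_right)
  have "?S (r *\<^sub>R x) \<subseteq> ?S x" by auto
  then show "inner (r *\<^sub>R x) y = r * inner x y"
    using inner_fseq_superset[of "?S x" "r *\<^sub>R x" y] inner_fseq_superset[of "?S x" x y]
    by (simp add: sum_distrib_left mult.assoc)
  show "0 \<le> inner x x"
    unfolding inner_fseq_def by (intro sum_nonneg) simp
  show "inner x x = 0 \<longleftrightarrow> x = 0"
  proof
    assume "inner x x = 0"
    then have "\<forall>i\<in>?S x. coord x i * coord x i = 0"
      unfolding inner_fseq_def by (subst (asm) sum_nonneg_eq_0_iff) auto
    then have "coord x = coord 0" by (intro ext) auto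
    then show "x = 0" by (simp add: coord_inject)
  qed (simp add: inner_fseq_def)
qed (simp_all add: norm_fseq_def sgn_fseq_def dist_fseq_def uniformity_fseq_def open_fseq_def)

end

definition Rn :: "nat \<Rightarrow> fseq set"
  where "Rn n = {x. \<forall>i\<ge>n. coord x i = 0}"

definition B1 :: "nat \<Rightarrow> fseq set"
  where "B1 n = {x \<in> Rn n. (\<Sum>i<n. \<bar>coord x i\<bar>) \<le> 1}"

definition orth_proj :: "'a::real_inner set \<Rightarrow> 'a \<Rightarrow> 'a"
  where "orth_proj E x = (THE y. y \<in> E \<and> (\<forall>e\<in>E. orthogonal (x - y) e))"

text \<open>Below, \<open>E\<close> is always a finite-dimensional subspace, regarded as a Euclidean space.\<close>

definition orthonormal_basis :: "'a::real_inner set \<Rightarrow> (nat \<Rightarrow> 'a) \<Rightarrow> bool"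
  where "orthonormal_basis E b \<longleftrightarrow>
    (\<forall>i<dim E. \<forall>j<dim E. b i \<bullet> b j = (if i = j then 1 else 0)) \<and> span (b ` {..<dim E}) = E"

text \<open>
  \<open>dim E\<close>-dimensional Lebesgue measure on \<open>E\<close>, as a Borel measure on the ambient space concentrated
  on \<open>E\<close>: the image of \<open>dim E\<close>-fold product Lebesgue measure under the isometry
  given by an orthonormal basis. By rotation invariance the choice of the basis is immaterial.
\<close>
definition vol :: "'a::real_inner set \<Rightarrow> 'a measure"
  where "vol E = (let b = (SOME b. orthonormal_basis E b) in
    distr (\<Pi>\<^sub>M i\<in>{..<dim E}. lborel) borel (\<lambda>c. \<Sum>i<dim E. c i *\<^sub>R b i))"

text \<open>The map in the previous definition is measurable, as \<^const>\<open>distr\<close> requires.\<close>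
lemma measurable_vol_map:
  fixes b :: "nat \<Rightarrow> 'a::real_inner"
  shows "(\<lambda>c. \<Sum>i<d. c i *\<^sub>R b i) \<in> borel_measurable (\<Pi>\<^sub>M i\<in>{..<d}. lborel)"
proof -
  let ?f = "\<lambda>c :: nat \<Rightarrow> real. \<Sum>i<d. c i *\<^sub>R b i"
  let ?g = "\<lambda>c :: nat \<Rightarrow> real. \<lambda>i. if i < d then c i else 0"
  have "continuous_on UNIV ?f"
    by (intro continuous_intros continuous_on_product_coordinates)
  then have f: "?f \<in> borel_measurable borel"
    by (rule borel_measurable_continuous_onI)
  have "?g \<in> measurable (\<Pi>\<^sub>M i\<in>{..<d}. lborel) (\<Pi>\<^sub>M i\<in>UNIV. borel)"
  proof (rule measurable_PiM_single')
    fix i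
    show "(\<lambda>c. if i < d then c i else 0) \<in> borel_measurable (\<Pi>\<^sub>M i\<in>{..<d}. lborel)"
    proof (cases "i < d")
      case True
      then have "(\<lambda>c. c i) \<in> measurable (\<Pi>\<^sub>M i\<in>{..<d}. lborel) lborel"
        by (intro measurable_component_singleton) simp
      with True show ?thesis by simp
    qed simp
  qed (auto simp: space_PiM)
  then have "?g \<in> measurable (\<Pi>\<^sub>M i\<in>{..<d}. lborel) (borel :: (nat \<Rightarrow> real) measure)"
    by (subst (asm) measurable_cong_sets[OF refl sets_PiM_equal_borel])
  from measurable_compose[OF this f] show ?thesis by simp
qed

definition convex_body_in :: "'a::real_inner set \<Rightarrow> 'a set \<Rightarrow> bool"
  where "convex_body_in E K \<longleftrightarrow>
    K \<subseteq> E \<and> compact K \<and> convex K \<and> (top_of_set E) interior_of K \<noteq> {}"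

text \<open>
  \<open>c\<close> is the barycenter \<open>(1 / Vol K) \<integral>\<^sub>K x dx\<close> of \<open>K\<close>. The vector integral is taken weakly, that is,
  against every linear functional on \<open>E\<close>, since the Bochner integral of the library needs a complete
  space.
\<close>
definition is_barycenter :: "'a::real_inner set \<Rightarrow> 'a set \<Rightarrow> 'a \<Rightarrow> bool"
  where "is_barycenter E K c \<longleftrightarrow>
    c \<in> E \<and> (\<forall>\<theta>\<in>E. c \<bullet> \<theta> = (LINT x:K|vol E. x \<bullet> \<theta>) / measure (vol E) K)"

definition isotropic :: "'a::real_inner set \<Rightarrow> 'a set \<Rightarrow> real \<Rightarrow> bool"
  where "isotropic E K L \<longleftrightarrow>
    convex_body_in E K \<and> measure (vol E) K = 1 \<and> is_barycenter E K 0 \<and>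
    L > 0 \<and> (\<forall>\<theta>\<in>E. norm \<theta> = 1 \<longrightarrow> (LINT x:K|vol E. (x \<bullet> \<theta>)\<^sup>2) = L\<^sup>2)"

text \<open>
  Only the restriction of the linear map to \<open>E\<close> matters; every linear automorphism of \<open>E\<close>
  extends to a linear map of the ambient space.
\<close>
definition affine_images :: "'a::real_inner set \<Rightarrow> 'a set \<Rightarrow> 'a set set"
  where "affine_images E K =
    {(\<lambda>x. A x + v) ` K | A v. linear A \<and> bij_betw A E E \<and> v \<in> E}"

definition isotropy_const :: "'a::real_inner set \<Rightarrow> 'a set \<Rightarrow> real"
  where "isotropy_const E K = (THE L. \<exists>K1 \<in> affine_images E K. isotropic E K1 L)"

text \<open>
  An \<open>n\<close>-dimensional regular simplex in \<open>\<real>\<^sup>n\<close>, of arbitrary edge length, with center of mass at the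
  origin.
\<close>
definition centered_regular_simplex :: "nat \<Rightarrow> fseq set \<Rightarrow> bool"
  where "centered_regular_simplex n S \<longleftrightarrow>
    (\<exists>V a. V \<subseteq> Rn n \<and> finite V \<and> card V = n + 1 \<and> a > 0 \<and>
       (\<forall>v\<in>V. \<forall>w\<in>V. v \<noteq> w \<longrightarrow> dist v w = a) \<and> S = convex hull V) \<and>
    is_barycenter (Rn n) S 0"

end

theory Submission
  imports Defs
begin

text \<open>
  If \<open>K\<close> is a convex body in \<open>E\<close> and \<open>d = dim E\<close>, then
  \<open>d L\<^sub>K\<^sup>2 |K|\<^bsup>2/d\<^esup> \<le> |K|\<^bsup>-1\<^esup> \<integral>\<^sub>K |x - p|\<^sup>2 dx\<close> for every \<open>p\<close>, so it suffices to bound the second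
  moment of the projected polytope from above and its volume from below.

  Let \<open>w\<^sub>j\<close> be the vertices of \<open>B\<^sub>1\<^sup>n\<close> or of the simplex, centred at the origin. They form a tight
  frame of vectors of equal norm with nonpositive mutual inner products.
  The last property gives \<open>|x|\<^sup>2 \<le> R\<^sup>2 \<Sum>\<^sub>j s\<^sub>j(x)\<^sup>2\<close> whenever \<open>x\<close> is the projection of
  \<open>\<Sum>\<^sub>j s\<^sub>j(x) w\<^sub>j\<close>. If \<open>s\<^sub>j\<close> are the barycentric coordinates of a triangulation,
  then \<open>{s\<^sub>j > \<tau>}\<close> is the image of \<open>{s\<^sub>j > 0}\<close> under a homothety of ratio \<open>1 - \<tau>\<close>, which forces
  \<open>\<integral> s\<^sub>j\<^sup>2 \<le> C/d \<integral> s\<^sub>j\<close>; hence the mean of \<open>|x|\<^sup>2\<close> is at most \<open>C R\<^sup>2/d\<close>. The tight frame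
  property shows that \<open>K - K\<close> contains a ball of radius \<open>R/\<surd>n\<close>, hence \<open>|K|\<^bsup>1/d\<^esup> \<ge> c R/\<surd>(nd)\<close> by the
  Rogers-Shephard inequality.
\<close>

section \<open>Invariance of product Lebesgue measure\<close>

text \<open>Determinants are avoided. A linear automorphism of \<open>E\<close> enters only through
  the constant by which it multiplies volume, which exists because translation-invariant measures on
  \<open>E\<close> are proportional; the inequality between determinant and Hilbert-Schmidt norm
  comes from comparing the second moments of a ball and an ellipsoid.

  The moment inequality has a second use: applied in both directions to two isotropic images of one
  body, it shows that their constants agree, so that the definite description in
  \<open>isotropy_const\<close> denotes a number.

  The bound of |x|^2 by the squared coefficients holds only for combinations of the given vertices,
  so a triangulation with additional vertices would not do; and its coordinates must be Borel
  functions to be integrated.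

  Origin of the constant: the mean of |x - g|^2 is at most 4 R^2 / d, and the d-th root of the
  volume is at least \<rho> = R / (2 sqrt(n d)). The quotient of 4 R^2 / d by d \<rho>^2 is 16 n /
  d, the square of 4 sqrt(n / d).\<close>

definition lincomb :: "nat \<Rightarrow> (nat \<Rightarrow> 'a::real_vector) \<Rightarrow> (nat \<Rightarrow> real) \<Rightarrow> 'a"
  where "lincomb k b c = (\<Sum>i<k. c i *\<^sub>R b i)"

abbreviation leb :: "nat \<Rightarrow> (nat \<Rightarrow> real) measure"
  where "leb k \<equiv> \<Pi>\<^sub>M i\<in>{..<k}. lborel"

lemma sigma_finite_leb: "sigma_finite_measure (leb k)"
proof -
  interpret product_sigma_finite "\<lambda>_::nat. lborel :: real measure"
    by standard (rule lborel.sigma_finite_countable)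
  show ?thesis by (rule sigma_finite) simp
qed

lemma pair_sigma_finite_leb: "pair_sigma_finite (leb k) (leb l)"
  by (intro pair_sigma_finite.intro sigma_finite_leb)

lemma lincomb_add: "lincomb k b (\<lambda>i. c i + a i) = lincomb k b c + lincomb k b a"
  by (simp add: lincomb_def scaleR_add_left sum.distrib)

lemma lincomb_restrict: "lincomb k b (\<lambda>i\<in>{..<k}. c i) = lincomb k b c"
  by (simp add: lincomb_def)

lemma measurable_lincomb:
  fixes b :: "nat \<Rightarrow> 'a::real_inner"
  assumes "\<And>i. i < k \<Longrightarrow> f i \<in> borel_measurable X"
  shows "(\<lambda>x. lincomb k b (\<lambda>i. f i x)) \<in> borel_measurable X"
proof -
  have "(\<lambda>x. \<lambda>i\<in>{..<k}. f i x) \<in> measurable X (leb k)"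
    using assms by (intro measurable_restrict) auto
  from measurable_compose[OF this measurable_vol_map[of b k]]
  show ?thesis by (simp add: lincomb_def)
qed

lemma measurable_component_leb: "i < k \<Longrightarrow> (\<lambda>c. c i) \<in> borel_measurable (leb k)"
  using measurable_component_singleton[of i "{..<k}" "\<lambda>_. lborel :: real measure"] by simp

lemma measurable_lincomb_leb:
  fixes b :: "nat \<Rightarrow> 'a::real_inner"
  shows "lincomb k b \<in> borel_measurable (leb k)"
  using measurable_lincomb[of k "\<lambda>i c. c i" "leb k" b] measurable_component_leb by simp

lemma span_eq_lincomb: "span (b ` {..<k}) = range (lincomb k b)"
proof
  show "range (lincomb k b) \<subseteq> span (b ` {..<k})"
    by (auto simp: lincomb_def intro!: span_sum span_scale intro: span_base)
  have "subspace (range (lincomb k b))"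
  proof (rule subspaceI)
    show "0 \<in> range (lincomb k b)"
      by (rule range_eqI[of _ _ "\<lambda>_. 0"]) (simp add: lincomb_def)
    fix x y assume "x \<in> range (lincomb k b)" "y \<in> range (lincomb k b)"
    then obtain c a where "x = lincomb k b c" "y = lincomb k b a" by auto
    then have "x + y = lincomb k b (\<lambda>i. c i + a i)" by (simp add: lincomb_add)
    then show "x + y \<in> range (lincomb k b)" by simp
  next
    fix r x assume "x \<in> range (lincomb k b)"
    then obtain c where "x = lincomb k b c" by auto
    then have "r *\<^sub>R x = lincomb k b (\<lambda>i. r * c i)"
      by (simp add: lincomb_def scaleR_sum_right)
    then show "r *\<^sub>R x \<in> range (lincomb k b)" by simp
  qed
  moreover have "b ` {..<k} \<subseteq> range (lincomb k b)"
  proof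
    fix x assume "x \<in> b ` {..<k}"
    then obtain i where i: "i < k" "x = b i" by auto
    have "x = lincomb k b (\<lambda>j. if j = i then 1 else 0)"
      using i by (simp add: lincomb_def if_distrib[of "\<lambda>z. z *\<^sub>R _"] cong: if_cong)
    then show "x \<in> range (lincomb k b)" by simp
  qed
  ultimately show "span (b ` {..<k}) \<subseteq> range (lincomb k b)"
    by (rule span_minimal[rotated])
qed

lemma distr_leb_translate:
  "distr (leb k) (leb k) (\<lambda>c. \<lambda>i\<in>{..<k}. c i + a i) = leb k"
proof -
  interpret product_sigma_finite "\<lambda>_::nat. lborel :: real measure"
    by standard (rule lborel.sigma_finite_countable)
  have m: "(\<lambda>c. \<lambda>i\<in>{..<k}. c i + a i) \<in> measurable (leb k) (leb k)"
    by (intro measurable_restrict) (use measurable_component_leb in auto)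
  show ?thesis
  proof (rule PiM_eqI)
    fix A :: "nat \<Rightarrow> real set" assume A: "\<And>i. i \<in> {..<k} \<Longrightarrow> A i \<in> sets lborel"
    have A': "(\<lambda>x. x + a i) -` A i \<in> sets borel" if "i < k" for i
    proof -
      have "(\<lambda>x. x + a i) \<in> borel_measurable borel" by simp
      from measurable_sets[OF this, of "A i"] A that show ?thesis by simp
    qed
    have "emeasure (distr (leb k) (leb k) (\<lambda>c. \<lambda>i\<in>{..<k}. c i + a i)) (Pi\<^sub>E {..<k} A)
        = emeasure (leb k) ((\<lambda>c. \<lambda>i\<in>{..<k}. c i + a i) -` (Pi\<^sub>E {..<k} A) \<inter> space (leb k))"
      using A by (intro emeasure_distr m sets_PiM_I_finite) auto
    also have "(\<lambda>c. \<lambda>i\<in>{..<k}. c i + a i) -` (Pi\<^sub>E {..<k} A) \<inter> space (leb k)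
        = Pi\<^sub>E {..<k} (\<lambda>i. (\<lambda>x. x + a i) -` A i)"
      by (auto simp: space_PiM PiE_iff)
    also have "emeasure (leb k) \<dots> = (\<Prod>i<k. emeasure lborel ((\<lambda>x. x + a i) -` A i))"
      using A' by (intro emeasure_PiM) auto
    also have "\<dots> = (\<Prod>i<k. emeasure lborel (A i))"
    proof (intro prod.cong refl)
      fix i assume i: "i \<in> {..<k}"
      have "emeasure lborel (A i) = emeasure (distr lborel borel ((+) (a i))) (A i)"
        by (simp add: lborel_distr_plus)
      also have "\<dots> = emeasure lborel ((\<lambda>x. x + a i) -` A i)"
        using A i by (subst emeasure_distr) (simp_all add: vimage_def add.commute)
      finally show "emeasure lborel ((\<lambda>x. x + a i) -` A i) = emeasure lborel (A i)" by simp
    qed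
    finally show "emeasure (distr (leb k) (leb k) (\<lambda>c. \<lambda>i\<in>{..<k}. c i + a i)) (Pi\<^sub>E {..<k} A)
        = (\<Prod>i<k. emeasure lborel (A i))" .
  qed auto
qed

text \<open>A translation by a vector of the span is a translation of the coefficients. It is
  applied both to an orthonormal basis and to its image under a linear map.\<close>

lemma nn_integral_lincomb_translate:
  fixes b :: "nat \<Rightarrow> 'a::real_inner"
  assumes e: "e \<in> span (b ` {..<k})" and h: "h \<in> borel_measurable borel"
  shows "(\<integral>\<^sup>+c. h (lincomb k b c + e) \<partial>leb k) = (\<integral>\<^sup>+c. h (lincomb k b c) \<partial>leb k)"
proof -
  obtain a where a: "e = lincomb k b a" using e by (auto simp: span_eq_lincomb)
  have m: "(\<lambda>c. \<lambda>i\<in>{..<k}. c i + a i) \<in> measurable (leb k) (leb k)"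
    by (intro measurable_restrict) (use measurable_component_leb in auto)
  have h': "(\<lambda>c. h (lincomb k b c)) \<in> borel_measurable (leb k)"
    by (rule measurable_compose[OF measurable_lincomb_leb h])
  have "(\<integral>\<^sup>+c. h (lincomb k b c) \<partial>leb k)
      = (\<integral>\<^sup>+c. h (lincomb k b c) \<partial>distr (leb k) (leb k) (\<lambda>c. \<lambda>i\<in>{..<k}. c i + a i))"
    by (simp add: distr_leb_translate)
  also have "\<dots> = (\<integral>\<^sup>+c. h (lincomb k b c + e) \<partial>leb k)"
    by (subst nn_integral_distr[OF m]) (use h' in \<open>simp_all add: lincomb_restrict lincomb_add a\<close>)
  finally show ?thesis by simp
qed

section \<open>Proportionality of translation-invariant measures on a span\<close>

lemma sum_lessThan_double:
  fixes f :: "nat \<Rightarrow> 'a::comm_monoid_add"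
  shows "(\<Sum>i<2 * n. f i) = (\<Sum>i<n. f i + f (i + n))"
proof -
  have "(\<Sum>i<2 * n. f i) = (\<Sum>i=0..<n. f i) + (\<Sum>i=n..<n + n. f i)"
    by (simp only: mult_2 atLeast0LessThan[symmetric]) (simp add: sum.atLeastLessThan_concat)
  also have "(\<Sum>i=n..<n + n. f i) = (\<Sum>i=0..<n. f (i + n))"
    using sum.shift_bounds_nat_ivl[of f 0 n n] by simp
  finally show ?thesis by (simp add: sum.distrib atLeast0LessThan)
qed

text \<open>The ambient space may be nonseparable, where a sum of two Borel maps need not be Borel.
  The sum is therefore read as a single combination of the \<open>2 * k\<close> vectors
  \<open>b\<close> and \<open>g\<close>, a continuous image of finitely many real coefficients. The
  scalars \<open>r\<close> and \<open>t\<close> cover sums, differences and, when one is 0,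
  functions of one variable.\<close>

lemma measurable_lincomb_pair:
  fixes b g :: "nat \<Rightarrow> 'a::real_inner"
  assumes [measurable]: "S \<in> sets borel"
  shows "(\<lambda>(x, y). indicator S (r *\<^sub>R lincomb k b x + t *\<^sub>R lincomb k g y) :: ennreal)
     \<in> borel_measurable (leb k \<Otimes>\<^sub>M leb k)"
proof -
  let ?c = "\<lambda>i p. if i < k then r * (fst p :: nat \<Rightarrow> real) i else t * (snd p :: nat \<Rightarrow> real) (i - k)"
  let ?b = "\<lambda>i. if i < k then b i else g (i - k)"
  have "(\<lambda>p. lincomb (2 * k) ?b (\<lambda>i. ?c i p)) \<in> borel_measurable (leb k \<Otimes>\<^sub>M leb k)"
  proof (rule measurable_lincomb)
    fix i assume i: "i < 2 * k"
    show "?c i \<in> borel_measurable (leb k \<Otimes>\<^sub>M leb k)"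
    proof (cases "i < k")
      case True
      then show ?thesis
        using measurable_compose[OF measurable_fst measurable_component_leb[OF True], of "leb k"]
        by simp
    next
      case False
      then have "i - k < k" using i by simp
      from measurable_compose[OF measurable_snd measurable_component_leb[OF this], of "leb k"]
      show ?thesis using False by simp
    qed
  qed
  moreover have "lincomb (2 * k) ?b (\<lambda>i. ?c i p)
      = r *\<^sub>R lincomb k b (fst p) + t *\<^sub>R lincomb k g (snd p)" for p
  proof -
    have "lincomb (2 * k) ?b (\<lambda>i. ?c i p) = (\<Sum>i<k. ?c i p *\<^sub>R ?b i) +
        (\<Sum>i<k. ?c (i + k) p *\<^sub>R ?b (i + k))"
      unfolding lincomb_def sum_lessThan_double sum.distrib ..
    also have "\<dots> = (\<Sum>i<k. r *\<^sub>R fst p i *\<^sub>R b i) + (\<Sum>i<k. t *\<^sub>R snd p i *\<^sub>R g i)"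
      by (intro arg_cong2[of _ _ _ _ plus] sum.cong) simp_all
    finally show ?thesis by (simp add: lincomb_def scaleR_sum_right)
  qed
  ultimately have "(\<lambda>p. r *\<^sub>R lincomb k b (fst p) + t *\<^sub>R lincomb k g (snd p))
      \<in> borel_measurable (leb k \<Otimes>\<^sub>M leb k)" by simp
  from measurable_compose[OF this borel_measurable_indicator[OF assms]]
  show ?thesis by (simp add: case_prod_beta')
qed

text \<open>The classical uniqueness argument for Haar measure. Shear the first variable by the
  second, exchange the integrals, shear the second by the first and exchange again; each shear is a
  translation and changes nothing. With \<open>T\<close> fixed, the measures induced by
  \<open>b\<close> and \<open>g\<close> become proportional as functions of
  \<open>S\<close>.\<close>

lemma nn_integral_lincomb_swap:
  fixes b g :: "nat \<Rightarrow> 'a::real_inner"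
  assumes "span (b ` {..<k}) = span (g ` {..<k})"
    and [measurable]: "S \<in> sets borel" "T \<in> sets borel"
  shows "(\<integral>\<^sup>+x. indicator S (lincomb k b x) \<partial>leb k) * (\<integral>\<^sup>+y. indicator T (lincomb k g y) \<partial>leb k)
     = (\<integral>\<^sup>+y. indicator S (lincomb k g y) \<partial>leb k) * (\<integral>\<^sup>+x. indicator T (- lincomb k b x) \<partial>leb k)"
proof -
  interpret pair_sigma_finite "leb k" "leb k" by (rule pair_sigma_finite_leb)
  let ?f = "lincomb k b" and ?g = "lincomb k g"
  have [measurable]: "?f \<in> borel_measurable (leb k)" "?g \<in> borel_measurable (leb k)"
    by (rule measurable_lincomb_leb)+
  have fs: "?f x \<in> span (g ` {..<k})" "?g x \<in> span (b ` {..<k})" for x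
    using span_eq_lincomb[of b k] span_eq_lincomb[of g k] assms(1) by auto
  have m1: "(\<lambda>(x, y). indicator S (?f x + ?g y) * indicator T (?g y) :: ennreal)
      \<in> borel_measurable (leb k \<Otimes>\<^sub>M leb k)"
    using measurable_lincomb_pair[of S 1 k b 1 g] measurable_lincomb_pair[of T 0 k b 1 g]
    by (simp add: case_prod_beta')
  have m2: "(\<lambda>(x, y). indicator S (?g y) * indicator T (?g y - ?f x) :: ennreal)
      \<in> borel_measurable (leb k \<Otimes>\<^sub>M leb k)"
    using measurable_lincomb_pair[of S 0 k b 1 g] measurable_lincomb_pair[of T "-1" k b 1 g]
    by (simp add: case_prod_beta')
  have "(\<integral>\<^sup>+x. indicator S (?f x) \<partial>leb k) * (\<integral>\<^sup>+y. indicator T (?g y) \<partial>leb k)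
      = (\<integral>\<^sup>+y. (\<integral>\<^sup>+x. indicator S (?f x) \<partial>leb k) * indicator T (?g y) \<partial>leb k)"
    by (subst nn_integral_cmult) auto
  also have "\<dots> = (\<integral>\<^sup>+y. (\<integral>\<^sup>+x. indicator S (?f x + ?g y) \<partial>leb k) * indicator T (?g y) \<partial>leb k)"
    by (subst nn_integral_lincomb_translate) (auto simp: fs)
  also have "\<dots> = (\<integral>\<^sup>+y. (\<integral>\<^sup>+x. indicator S (?f x + ?g y) * indicator T (?g y) \<partial>leb k) \<partial>leb k)"
  proof (rule nn_integral_cong)
    fix y
    have "(\<lambda>x. ?f x + ?g y) \<in> borel_measurable (leb k)"
    proof -
      obtain a where "?g y = ?f a" using fs(2)[of y] by (auto simp: span_eq_lincomb)
      moreover have "(\<lambda>x. lincomb k b (\<lambda>i. x i + a i)) \<in> borel_measurable (leb k)"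
        by (rule measurable_lincomb) (use measurable_component_leb in auto)
      ultimately show ?thesis by (simp add: lincomb_add)
    qed
    then show "(\<integral>\<^sup>+x. indicator S (?f x + ?g y) \<partial>leb k) * indicator T (?g y) =
        (\<integral>\<^sup>+x. indicator S (?f x + ?g y) * indicator T (?g y) \<partial>leb k)"
      by (subst nn_integral_multc) auto
  qed
  also have "\<dots> = (\<integral>\<^sup>+x. (\<integral>\<^sup>+y. indicator S (?f x + ?g y) * indicator T (?g y) \<partial>leb k) \<partial>leb k)"
    by (rule Fubini'[OF m1])
  also have "\<dots> = (\<integral>\<^sup>+x. (\<integral>\<^sup>+y. indicator S (?g y) * indicator T (?g y - ?f x) \<partial>leb k) \<partial>leb k)"
  proof (rule nn_integral_cong)
    fix x
    have "(\<lambda>z. indicator S z * indicator T (z - ?f x) :: ennreal) \<in> borel_measurable borel"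
    proof (intro borel_measurable_times_ennreal borel_measurable_indicator assms)
      have "(\<lambda>z. z - ?f x) \<in> borel_measurable borel"
        by (intro borel_measurable_continuous_onI continuous_intros)
      from measurable_compose[OF this borel_measurable_indicator[OF assms(3)]]
      show "(\<lambda>z. indicator T (z - ?f x) :: ennreal) \<in> borel_measurable borel" .
    qed
    from nn_integral_lincomb_translate[OF fs(1) this, of x]
    show "(\<integral>\<^sup>+y. indicator S (?f x + ?g y) * indicator T (?g y) \<partial>leb k) =
        (\<integral>\<^sup>+y. indicator S (?g y) * indicator T (?g y - ?f x) \<partial>leb k)"
      by (simp add: add.commute)
  qed
  also have "\<dots> = (\<integral>\<^sup>+y. (\<integral>\<^sup>+x. indicator S (?g y) * indicator T (?g y - ?f x) \<partial>leb k) \<partial>leb k)"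
    by (rule Fubini'[OF m2, symmetric])
  also have "\<dots> = (\<integral>\<^sup>+y. indicator S (?g y) * (\<integral>\<^sup>+x. indicator T (- ?f x) \<partial>leb k) \<partial>leb k)"
  proof (rule nn_integral_cong)
    fix y
    have h: "(\<lambda>z. indicator T (- z) :: ennreal) \<in> borel_measurable borel"
    proof -
      have "(\<lambda>z::'a. - z) \<in> borel_measurable borel"
        by (intro borel_measurable_continuous_onI continuous_intros)
      from measurable_compose[OF this borel_measurable_indicator[OF assms(3)]]
      show ?thesis .
    qed
    have "- ?g y \<in> span (b ` {..<k})" using fs(2) by (rule span_neg)
    from nn_integral_lincomb_translate[OF this h]
    have *: "(\<integral>\<^sup>+x. indicator T (?g y - ?f x) \<partial>leb k) = (\<integral>\<^sup>+x. indicator T (- ?f x) \<partial>leb k)"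
      by simp
    have "(\<integral>\<^sup>+x. indicator S (?g y) * indicator T (?g y - ?f x) \<partial>leb k)
       = indicator S (?g y) * (\<integral>\<^sup>+x. indicator T (?g y - ?f x) \<partial>leb k)"
      by (cases "?g y \<in> S") auto
    with * show "(\<integral>\<^sup>+x. indicator S (?g y) * indicator T (?g y - ?f x) \<partial>leb k)
       = indicator S (?g y) * (\<integral>\<^sup>+x. indicator T (- ?f x) \<partial>leb k)" by simp
  qed
  also have "\<dots> = (\<integral>\<^sup>+y. indicator S (?g y) \<partial>leb k) * (\<integral>\<^sup>+x. indicator T (- ?f x) \<partial>leb k)"
    by (rule nn_integral_multc) auto
  finally show ?thesis .
qed

section \<open>Orthonormal families\<close>

lemma orthonormal_family_independent:
  fixes q :: "'a::real_vector \<Rightarrow> 'a \<Rightarrow> real"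
  assumes lin: "\<And>z. linear (\<lambda>x. q x z)"
    and ortho: "\<And>i j. i < k \<Longrightarrow> j < k \<Longrightarrow> q (b i) (b j) = (if i = j then 1 else 0)"
  shows "independent (b ` {..<k})" "card (b ` {..<k}) = k"
proof -
  have inj: "inj_on b {..<k}"
  proof (rule inj_onI)
    fix i j assume ij: "i \<in> {..<k}" "j \<in> {..<k}" "b i = b j"
    then have "q (b i) (b j) = 1" using ortho[of j j] by simp
    then show "i = j" using ortho[of i j] ij by (simp split: if_splits)
  qed
  then show "card (b ` {..<k}) = k" by (simp add: card_image)
  show "independent (b ` {..<k})"
  proof (rule independent_if_scalars_zero)
    fix f x assume s: "(\<Sum>x\<in>b ` {..<k}. f x *\<^sub>R x) = 0" and "x \<in> b ` {..<k}"
    then obtain j where j: "j < k" "x = b j" by auto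
    have "0 = q (\<Sum>i<k. f (b i) *\<^sub>R b i) (b j)"
      using s linear_0[OF lin] by (simp add: sum.reindex[OF inj])
    also have "\<dots> = (\<Sum>i<k. f (b i) * q (b i) (b j))"
      by (simp add: linear_sum[OF lin] linear_scale[OF lin])
    also have "\<dots> = (\<Sum>i<k. if i = j then f (b i) else 0)"
      by (rule sum.cong) (use ortho j in auto)
    also have "\<dots> = f x" using j by simp
    finally show "f x = 0" by simp
  qed simp
qed

lemma orthonormal_family_extend:
  fixes q :: "'a::real_vector \<Rightarrow> 'a \<Rightarrow> real"
  assumes E: "subspace E"
    and sym: "\<And>x y. q x y = q y x"
    and lin: "\<And>z. linear (\<lambda>x. q x z)"
    and pos: "\<And>x. x \<in> E \<Longrightarrow> x \<noteq> 0 \<Longrightarrow> q x x > 0"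
    and b: "\<And>i. i < k \<Longrightarrow> b i \<in> E"
    and ortho: "\<And>i j. i < k \<Longrightarrow> j < k \<Longrightarrow> q (b i) (b j) = (if i = j then 1 else 0)"
    and ne: "span (b ` {..<k}) \<noteq> E"
  shows "\<exists>b'. (\<forall>i<Suc k. b' i \<in> E) \<and>
    (\<forall>i<Suc k. \<forall>j<Suc k. q (b' i) (b' j) = (if i = j then 1 else 0))"
proof -
  have "span (b ` {..<k}) \<subseteq> E" using b E by (intro span_minimal) auto
  with ne obtain x where x: "x \<in> E" "x \<notin> span (b ` {..<k})" by blast
  define y where "y = x - (\<Sum>i<k. q x (b i) *\<^sub>R b i)"
  have "y \<noteq> 0"
  proof
    assume "y = 0"
    then have "x = (\<Sum>i<k. q x (b i) *\<^sub>R b i)" by (simp add: y_def)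
    also have "\<dots> \<in> span (b ` {..<k})" by (intro span_sum span_scale span_base) auto
    finally show False using x by simp
  qed
  have yE: "y \<in> E" unfolding y_def using x b E
    by (intro subspace_diff subspace_sum subspace_scale) auto
  have yb: "q y (b j) = 0" if "j < k" for j
  proof -
    have "q y (b j) = q x (b j) - (\<Sum>i<k. q x (b i) * q (b i) (b j))"
      by (simp add: y_def linear_diff[OF lin] linear_sum[OF lin] linear_scale[OF lin])
    also have "(\<Sum>i<k. q x (b i) * q (b i) (b j)) = (\<Sum>i<k. if i = j then q x (b i) else 0)"
      by (rule sum.cong) (use ortho that in auto)
    also have "\<dots> = q x (b j)" using that by simp
    finally show ?thesis by simp
  qed
  define s where "s = sqrt (q y y)"
  have s: "s > 0" "s * s = q y y" using pos[OF yE \<open>y \<noteq> 0\<close>] by (auto simp: s_def)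
  define z where "z = (1 / s) *\<^sub>R y"
  have zb: "q z u = q y u / s" for u by (simp add: z_def linear_scale[OF lin])
  have zz: "q z z = 1"
  proof -
    have "q z z = q z y / s" by (simp add: zb sym[of y z])
    also have "\<dots> = q y y / (s * s)" by (simp add: zb)
    also have "\<dots> = 1" using s pos[OF yE \<open>y \<noteq> 0\<close>] by simp
    finally show ?thesis .
  qed
  have zE: "z \<in> E" unfolding z_def by (intro subspace_scale E yE)
  let ?b = "\<lambda>i. if i = k then z else b i"
  have "?b i \<in> E" if "i < Suc k" for i
    using that zE b[of i] by (cases "i = k") auto
  moreover have "q (?b i) (?b j) = (if i = j then 1 else 0)" if ij: "i < Suc k" "j < Suc k" for i j
  proof (cases "i = k \<or> j = k")
    case True
    have "q z (b l) = 0" "q (b l) z = 0" if "l < k" for l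
      using yb[OF that] zb[of "b l"] sym[of "b l" z] by auto
    then show ?thesis using True zz ij by (cases "i = k"; cases "j = k") auto
  next
    case False
    then show ?thesis using ortho[of i j] ij by simp
  qed
  ultimately show ?thesis by (intro exI[of _ ?b]) blast
qed

text \<open>The form \<open>q\<close> is abstract because it is used twice: as the inner product, to
  produce orthonormal bases, and as the covariance form of a convex body, to produce isotropic
  position. The finite set \<open>T\<close> keeps bases finite inside an ambient space of possibly
  infinite dimension.\<close>

lemma gram_schmidt:
  fixes q :: "'a::real_vector \<Rightarrow> 'a \<Rightarrow> real"
  assumes E: "subspace E" and T: "finite T" "E \<subseteq> span T"
    and sym: "\<And>x y. q x y = q y x"
    and lin: "\<And>z. linear (\<lambda>x. q x z)"
    and pos: "\<And>x. x \<in> E \<Longrightarrow> x \<noteq> 0 \<Longrightarrow> q x x > 0"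
  shows "\<exists>b. (\<forall>i<dim E. \<forall>j<dim E. q (b i) (b j) = (if i = j then 1 else 0)) \<and>
    span (b ` {..<dim E}) = E"
proof -
  let ?ortho = "\<lambda>k b. (\<forall>i<k. b i \<in> E) \<and>
    (\<forall>i<k. \<forall>j<k. q (b i) (b j) = (if i = j then 1 else 0))"
  \<comment> \<open>Orthonormal families are independent, so extending them must stop at
    \<open>dim E\<close> members, and a family that cannot be extended spans.\<close>
  have bound: "k \<le> dim E" if "?ortho k b" for k b
  proof -
    obtain B where B: "B \<subseteq> E" "independent B" "E \<subseteq> span B" "card B = dim E"
      using basis_exists[of E] by blast
    have "finite B" using independent_span_bound[OF T(1) B(2)] B(1) T(2) by auto
    moreover have "independent (b ` {..<k})" "card (b ` {..<k}) = k"
      using orthonormal_family_independent[of q k b, OF lin] that by blast+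
    moreover have "b ` {..<k} \<subseteq> span B" using that B by auto
    ultimately show ?thesis using independent_span_bound[of B "b ` {..<k}"] B by auto
  qed
  have "\<exists>b. ?ortho k b" if "k \<le> dim E" for k
    using that
  proof (induction k)
    case (Suc k)
    then obtain b where b: "?ortho k b" by auto
    have "span (b ` {..<k}) \<noteq> E"
    proof
      assume "span (b ` {..<k}) = E"
      then have "dim E \<le> card (b ` {..<k})" by (intro dim_le_card) auto
      also have "\<dots> \<le> k" using card_image_le[of "{..<k}" b] by simp
      finally show False using Suc by simp
    qed
    then show ?case using orthonormal_family_extend[OF E sym lin pos, of k b] b by blast
  qed simp
  then obtain b where b: "?ortho (dim E) b" by blast
  have "span (b ` {..<dim E}) = E"
  proof (rule ccontr)
    assume "span (b ` {..<dim E}) \<noteq> E"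
    then obtain b' where "?ortho (Suc (dim E)) b'"
      using orthonormal_family_extend[OF E sym lin pos, of "dim E" b] b by blast
    from bound[OF this] show False by simp
  qed
  with b show ?thesis by blast
qed

lemma integral_lincomb_translate:
  fixes b :: "nat \<Rightarrow> 'a::real_inner" and h :: "'a \<Rightarrow> real"
  assumes e: "e \<in> span (b ` {..<k})" and h: "h \<in> borel_measurable borel"
  shows "(\<integral>c. h (lincomb k b c + e) \<partial>leb k) = (\<integral>c. h (lincomb k b c) \<partial>leb k)"
proof -
  obtain a where a: "e = lincomb k b a" using e by (auto simp: span_eq_lincomb)
  have m: "(\<lambda>c. \<lambda>i\<in>{..<k}. c i + a i) \<in> measurable (leb k) (leb k)"
    by (intro measurable_restrict) (use measurable_component_leb in auto)
  have h': "(\<lambda>c. h (lincomb k b c)) \<in> borel_measurable (leb k)"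
    by (rule measurable_compose[OF measurable_lincomb_leb h])
  have "(\<integral>c. h (lincomb k b c) \<partial>leb k)
      = (\<integral>c. h (lincomb k b c) \<partial>distr (leb k) (leb k) (\<lambda>c. \<lambda>i\<in>{..<k}. c i + a i))"
    by (simp add: distr_leb_translate)
  also have "\<dots> = (\<integral>c. h (lincomb k b c + e) \<partial>leb k)"
    by (subst integral_distr[OF m]) (use h' in \<open>simp_all add: lincomb_restrict lincomb_add a\<close>)
  finally show ?thesis by simp
qed

section \<open>Lebesgue measure on a subspace\<close>

text \<open>\<open>b\<close> is pinned to the basis chosen inside \<open>vol\<close>, so that
  \<open>vol E\<close> unfolds to an image of product measure under \<open>lincomb d b\<close>; the
  second assumption says that the choice succeeded.\<close>

locale euclid =
  fixes E :: "'a::real_inner set" and b :: "nat \<Rightarrow> 'a"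
  assumes b_def: "b = (SOME b. orthonormal_basis E b)"
    and onb: "orthonormal_basis E b"
begin

abbreviation "d \<equiv> dim E"

definition P :: "'a \<Rightarrow> 'a"
  where "P x = (\<Sum>i<d. (x \<bullet> b i) *\<^sub>R b i)"

lemma inner_b: "i < d \<Longrightarrow> j < d \<Longrightarrow> b i \<bullet> b j = (if i = j then 1 else 0)"
  using onb by (auto simp: orthonormal_basis_def)

lemma span_b: "span (b ` {..<d}) = E"
  using onb by (auto simp: orthonormal_basis_def)

lemma subspace_E: "subspace E"
  using span_b subspace_span by metis

lemma b_in_E: "i < d \<Longrightarrow> b i \<in> E"
  using span_b span_base[of "b i" "b ` {..<d}"] by auto

lemma norm_b: "i < d \<Longrightarrow> norm (b i) = 1"
  using inner_b[of i i] by (simp add: norm_eq_sqrt_inner)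

lemma lincomb_in_E: "lincomb d b c \<in> E"
  using span_b span_eq_lincomb[of b d] by auto

lemma inner_lincomb: "i < d \<Longrightarrow> lincomb d b c \<bullet> b i = c i"
proof -
  assume i: "i < d"
  have "lincomb d b c \<bullet> b i = (\<Sum>j<d. c j * (b j \<bullet> b i))"
    by (simp add: lincomb_def inner_sum_left)
  also have "\<dots> = (\<Sum>j<d. if j = i then c j else 0)"
    by (rule sum.cong) (use inner_b i in auto)
  finally show ?thesis using i by simp
qed

lemma P_eq_lincomb: "P x = lincomb d b (\<lambda>i. x \<bullet> b i)"
  by (simp add: P_def lincomb_def)

lemma P_in_E: "P x \<in> E"
  by (simp add: P_eq_lincomb lincomb_in_E)

lemma P_id: "x \<in> E \<Longrightarrow> P x = x"
proof -
  assume "x \<in> E"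
  then obtain c where c: "x = lincomb d b c" using span_b span_eq_lincomb[of b d] by auto
  then show "P x = x"
    using inner_lincomb by (auto simp: P_eq_lincomb lincomb_def intro!: sum.cong)
qed

lemma linear_P: "linear P"
  by (rule linearI) (simp_all add: P_def inner_add_left scaleR_add_left sum.distrib
      scaleR_sum_right)

lemma continuous_on_P [continuous_intros]:
  "continuous_on S f \<Longrightarrow> continuous_on S (\<lambda>x. P (f x))"
  unfolding P_def by (intro continuous_intros)

lemma inner_P_b: "i < d \<Longrightarrow> P x \<bullet> b i = x \<bullet> b i"
  by (simp add: P_eq_lincomb inner_lincomb)

lemma inner_P: "e \<in> E \<Longrightarrow> P x \<bullet> e = x \<bullet> e"
proof -
  assume "e \<in> E"
  then obtain c where c: "e = lincomb d b c" using span_b span_eq_lincomb[of b d] by auto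
  show ?thesis unfolding c by (simp add: lincomb_def inner_sum_right inner_P_b)
qed

lemma parseval: "x \<in> E \<Longrightarrow> x \<bullet> y = (\<Sum>i<d. (x \<bullet> b i) * (y \<bullet> b i))"
proof -
  assume "x \<in> E"
  then have "x \<bullet> y = P x \<bullet> y" by (simp add: P_id)
  also have "\<dots> = (\<Sum>i<d. (x \<bullet> b i) * (b i \<bullet> y))" by (simp add: P_def inner_sum_left)
  finally show ?thesis by (simp add: inner_commute)
qed

lemma parseval_norm: "x \<in> E \<Longrightarrow> (norm x)\<^sup>2 = (\<Sum>i<d. (x \<bullet> b i)\<^sup>2)"
  using parseval[of x x] by (simp add: power2_norm_eq_inner) (simp add: power2_eq_square)

lemma norm_P_le: "norm (P x) \<le> norm x"
proof -
  have "(norm (P x))\<^sup>2 = P x \<bullet> x"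
    by (simp add: power2_norm_eq_inner inner_P[OF P_in_E] inner_commute)
  also have "\<dots> \<le> norm (P x) * norm x" by (rule norm_cauchy_schwarz)
  finally show ?thesis
    by (cases "norm (P x) = 0") (auto simp: power2_eq_square)
qed

lemma orth_proj_eq_P: "orth_proj E x = P x"
  unfolding orth_proj_def
proof (rule the_equality)
  show "P x \<in> E \<and> (\<forall>e\<in>E. orthogonal (x - P x) e)"
    by (auto simp: P_in_E orthogonal_def inner_diff_left inner_P)
  fix y assume y: "y \<in> E \<and> (\<forall>e\<in>E. orthogonal (x - y) e)"
  then have "x \<bullet> b i = y \<bullet> b i" if "i < d" for i
    using b_in_E[OF that] by (auto simp: orthogonal_def inner_diff_left)
  then have "P x = P y" by (simp add: P_def)
  then show "y = P x" using y P_id by simp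
qed

lemma closed_E: "closed E"
proof -
  have "x \<in> E \<longleftrightarrow> P x = x" for x using P_in_E[of x] P_id[of x] by metis
  then have "E = {x. P x = x}" by blast
  also have "closed \<dots>" by (intro closed_Collect_eq continuous_intros)
  finally show ?thesis .
qed

lemma vol_eq: "vol E = distr (leb d) borel (lincomb d b)"
  unfolding vol_def Let_def b_def[symmetric] by (simp add: lincomb_def[abs_def])

lemma sets_vol [simp, measurable_cong]: "sets (vol E) = sets borel"
  by (simp add: vol_eq)

lemma space_vol [simp]: "space (vol E) = UNIV"
  by (simp add: vol_eq)

lemma integral_vol:
  fixes g :: "'a \<Rightarrow> real"
  assumes "g \<in> borel_measurable borel"
  shows "(\<integral>x. g x \<partial>vol E) = (\<integral>c. g (lincomb d b c) \<partial>leb d)"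
  unfolding vol_eq by (rule integral_distr[OF measurable_lincomb_leb assms])

lemma integral_vol_cong:
  fixes g h :: "'a \<Rightarrow> real"
  assumes "g \<in> borel_measurable borel" "h \<in> borel_measurable borel" "\<And>x. x \<in> E \<Longrightarrow> g x = h x"
  shows "(\<integral>x. g x \<partial>vol E) = (\<integral>x. h x \<partial>vol E)"
  unfolding integral_vol[OF assms(1)] integral_vol[OF assms(2)]
  by (intro Bochner_Integration.integral_cong refl assms(3) lincomb_in_E)

lemma emeasure_vol:
  assumes "S \<in> sets borel"
  shows "emeasure (vol E) S = (\<integral>\<^sup>+c. indicator S (lincomb d b c) \<partial>leb d)"
proof -
  have "emeasure (vol E) S = (\<integral>\<^sup>+x. indicator S x \<partial>vol E)" using assms by simp
  also have "\<dots> = (\<integral>\<^sup>+c. indicator S (lincomb d b c) \<partial>leb d)"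
    unfolding vol_eq using assms by (subst nn_integral_distr[OF measurable_lincomb_leb]) auto
  finally show ?thesis .
qed

lemma AE_vol_E: "AE x in vol E. x \<in> E"
  unfolding vol_eq using closed_E
  by (subst AE_distr_iff[OF measurable_lincomb_leb]) (auto simp: lincomb_in_E)

text \<open>A cylinder: directions orthogonal to \<open>E\<close> are left free, since
  \<open>vol E\<close> does not charge the complement of \<open>E\<close>. Its known volume
  calibrates all proportionality constants.\<close>

definition cube :: "real \<Rightarrow> 'a set"
  where "cube r = {x. \<forall>i<d. \<bar>x \<bullet> b i\<bar> \<le> r}"

lemma closed_cube: "closed (cube r)"
proof -
  have "cube r = (\<Inter>i\<in>{..<d}. {x. \<bar>x \<bullet> b i\<bar> \<le> r})" by (auto simp: cube_def)
  also have "closed \<dots>" by (intro closed_INT ballI closed_Collect_le continuous_intros)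
  finally show ?thesis .
qed

lemma cube_borel [measurable]: "cube r \<in> sets borel"
  using closed_cube by simp

lemma uminus_mem_cube: "- x \<in> cube r \<longleftrightarrow> x \<in> cube r"
  by (simp add: cube_def)

lemma emeasure_cube: "r \<ge> 0 \<Longrightarrow> emeasure (vol E) (cube r) = ennreal ((2 * r) ^ d)"
proof -
  assume r: "r \<ge> 0"
  interpret product_sigma_finite "\<lambda>_::nat. lborel :: real measure"
    by standard (rule lborel.sigma_finite_countable)
  have "emeasure (vol E) (cube r) = emeasure (leb d) (lincomb d b -` cube r \<inter> space (leb d))"
    unfolding vol_eq by (rule emeasure_distr[OF measurable_lincomb_leb cube_borel])
  also have "lincomb d b -` cube r \<inter> space (leb d) = Pi\<^sub>E {..<d} (\<lambda>_. {-r..r})"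
  proof -
    have "{-r..r} = {x. \<bar>x\<bar> \<le> r}" by auto
    then show ?thesis by (auto simp only: cube_def space_PiM PiE_iff vimage_def Int_iff
      mem_Collect_eq space_lborel space_borel inner_lincomb lessThan_iff)
  qed
  also have "emeasure (leb d) \<dots> = (\<Prod>i<d. emeasure lborel {-r..r})"
    by (intro emeasure_PiM) auto
  also have "\<dots> = (\<Prod>i<d. ennreal (2 * r))" using r by (subst emeasure_lborel_Icc) simp_all
  also have "\<dots> = ennreal ((2 * r) ^ d)" using r by (subst prod_constant) (simp add: ennreal_power)
  finally show ?thesis .
qed

lemma measure_cube: "r \<ge> 0 \<Longrightarrow> measure (vol E) (cube r) = (2 * r) ^ d"
  by (simp add: measure_def emeasure_cube)

lemma bounded_subset_cube: "bounded S \<Longrightarrow> \<exists>r\<ge>0. S \<subseteq> cube r"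
proof -
  assume "bounded S"
  then obtain r where r: "\<And>x. x \<in> S \<Longrightarrow> norm x \<le> r" by (auto simp: bounded_iff)
  have "S \<subseteq> cube \<bar>r\<bar>"
  proof
    fix x assume x: "x \<in> S"
    have "\<bar>x \<bullet> b i\<bar> \<le> \<bar>r\<bar>" if "i < d" for i
      using Cauchy_Schwarz_ineq2[of x "b i"] r[OF x] norm_b[OF that] by simp
    then show "x \<in> cube \<bar>r\<bar>" by (simp add: cube_def)
  qed
  then show ?thesis by (intro exI[of _ "\<bar>r\<bar>"]) simp
qed

lemma emeasure_subset_cube_finite: "S \<subseteq> cube r \<Longrightarrow> emeasure (vol E) S < \<infinity>"
proof -
  assume "S \<subseteq> cube r"
  moreover have "cube r \<subseteq> cube \<bar>r\<bar>" by (auto simp: cube_def)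
  ultimately have "emeasure (vol E) S \<le> emeasure (vol E) (cube \<bar>r\<bar>)"
    by (intro emeasure_mono) auto
  then show ?thesis by (simp add: emeasure_cube le_less_trans)
qed

lemma emeasure_compact_finite: "compact S \<Longrightarrow> emeasure (vol E) S < \<infinity>"
  using bounded_subset_cube compact_imp_bounded emeasure_subset_cube_finite by metis

text \<open>Choosing preimages of the basis vectors only and extending linearly yields a
  \<open>B\<close> that is linear and continuous on the whole ambient space, while it inverts
  \<open>A\<close> on \<open>E\<close>.\<close>

lemma inverse_on_E:
  assumes A: "linear A" "bij_betw A E E"
  obtains B where "linear B" "continuous_on UNIV B" "bij_betw B E E"
    "\<And>x. x \<in> E \<Longrightarrow> B (A x) = x" "\<And>x. x \<in> E \<Longrightarrow> A (B x) = x"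
proof -
  define B where "B x = (\<Sum>i<d. (x \<bullet> b i) *\<^sub>R inv_into E A (b i))" for x
  have img: "A ` E = E" and inj: "inj_on A E" using A(2) by (auto simp: bij_betw_def)
  have Ainv: "A (inv_into E A (b i)) = b i" "inv_into E A (b i) \<in> E" if "i < d" for i
    using that b_in_E img f_inv_into_f[of "b i" A E] inv_into_into[of "b i" A E] by auto
  have lin: "linear B"
    by (rule linearI) (simp_all add: B_def inner_add_left scaleR_add_left sum.distrib
      scaleR_sum_right)
  have BE: "B x \<in> E" for x
    unfolding B_def using Ainv by (intro subspace_sum subspace_scale subspace_E) auto
  have AB: "A (B x) = x" if "x \<in> E" for x
  proof -
    have "A (B x) = P x"
      using Ainv by (simp add: B_def P_def linear_sum[OF A(1)] linear_scale[OF A(1)])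
    then show ?thesis using P_id[OF that] by simp
  qed
  have BA: "B (A x) = x" if "x \<in> E" for x
  proof (rule inj_onD[OF inj])
    show "A (B (A x)) = A x" using AB img that by auto
  qed (use that BE in auto)
  have "bij_betw B E E"
    by (rule bij_betw_byWitness[of _ A]) (use AB BA BE img in auto)
  moreover have "continuous_on UNIV B" unfolding B_def by (intro continuous_intros)
  ultimately show ?thesis using that lin BA AB by blast
qed

text \<open>A linear map of an infinite-dimensional space can be discontinuous. After
  \<open>P\<close> only the finitely many vectors \<open>A (b i)\<close> matter; for this reason
  integrands below contain \<open>A (P x)\<close> in place of \<open>A x\<close>.\<close>

lemma continuous_on_linear_P:
  fixes A :: "'a \<Rightarrow> 'a"
  assumes "linear A"
  shows "continuous_on S (\<lambda>x. A (P x))"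
proof -
  have eq: "(\<lambda>x. A (P x)) = (\<lambda>x. \<Sum>i<d. (x \<bullet> b i) *\<^sub>R A (b i))"
    by (rule ext) (simp add: P_def linear_sum[OF assms] linear_scale[OF assms])
  show ?thesis unfolding eq by (intro continuous_intros)
qed

text \<open>The image of the measure under \<open>A\<close> is again translation invariant on
  \<open>E\<close>, and \<open>nn_integral_lincomb_swap\<close> with the symmetric cube as second
  set makes it a multiple of \<open>vol E\<close>. Here \<open>k\<close> is the reciprocal of the
  absolute determinant.\<close>

lemma vol_linear:
  assumes A: "linear A" "bij_betw A E E"
  obtains k where "k > 0"
    "distr (leb d) borel (lincomb d (\<lambda>i. A (b i))) = density (vol E) (\<lambda>_. ennreal k)"
proof -
  let ?g = "\<lambda>i. A (b i)"
  have lc: "lincomb d ?g c = A (lincomb d b c)" for c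
    by (simp add: lincomb_def linear_sum[OF A(1)] linear_scale[OF A(1)])
  have img: "A ` E = E" using A(2) by (auto simp: bij_betw_def)
  have sp: "span (?g ` {..<d}) = span (b ` {..<d})"
  proof -
    have "span (?g ` {..<d}) = span (A ` (b ` {..<d}))" by (simp add: image_image)
    also have "\<dots> = A ` E" by (simp add: linear_span_image[OF A(1)] span_b)
    finally show ?thesis by (simp add: img span_b)
  qed
  let ?N = "\<lambda>S. \<integral>\<^sup>+x. indicator S (lincomb d ?g x) \<partial>leb d :: ennreal"
  have key: "?N S * emeasure (vol E) (cube 1) = emeasure (vol E) S * ?N (cube 1)"
    if "S \<in> sets borel" for S
  proof -
    have "indicator (cube 1) (- x) = (indicator (cube 1) x :: ennreal)" for x
      by (simp add: indicator_def uminus_mem_cube)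
    then show ?thesis
      using nn_integral_lincomb_swap[OF sp that cube_borel[of 1]] that
      by (simp add: emeasure_vol)
  qed
  have c1: "emeasure (vol E) (cube 1) = ennreal (2 ^ d)" using emeasure_cube[of 1] by simp
  obtain B where B: "linear B" "continuous_on UNIV B" "\<And>x. x \<in> E \<Longrightarrow> B (A x) = x"
    using inverse_on_E[OF A] by metis
  \<comment> \<open>The image measure of \<open>?T\<close> is the volume of the cube. Put into the
    exchange identity, this gives a finite nonzero product, so that \<open>?N (cube 1)\<close> is
    neither 0 nor infinite.\<close>
  let ?T = "B -` cube 1"
  have T: "?T \<in> sets borel"
    using continuous_closed_vimage[OF closed_cube, of B 1] B(2)
    by (simp add: continuous_on_eq_continuous_at)
  have "?N ?T = emeasure (vol E) (cube 1)"
    unfolding emeasure_vol[OF cube_borel] using B(3)[OF lincomb_in_E]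
    by (auto simp: lc indicator_def intro!: nn_integral_cong)
  with key[OF T] c1 have pr: "emeasure (vol E) ?T * ?N (cube 1) = ennreal (2 ^ d * 2 ^ d)"
    by (simp add: ennreal_mult)
  have fin: "?N (cube 1) \<noteq> 0" "?N (cube 1) \<noteq> \<infinity>"
    using pr by (auto simp: ennreal_mult_eq_top_iff ennreal_top_mult ennreal_mult_top
        split: if_splits)
  define k where "k = enn2real (?N (cube 1)) / 2 ^ d"
  have kN: "?N (cube 1) = ennreal (k * 2 ^ d)" using fin(2) by (simp add: k_def ennreal_enn2real less_top)
  have k: "k > 0" using fin by (simp add: k_def enn2real_positive_iff less_top zero_less_iff_neq_zero)
  have "distr (leb d) borel (lincomb d ?g) = density (vol E) (\<lambda>_. ennreal k)"
  proof (rule measure_eqI)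
    fix S assume "S \<in> sets (distr (leb d) borel (lincomb d ?g))"
    then have S: "S \<in> sets borel" by simp
    have "emeasure (distr (leb d) borel (lincomb d ?g)) S =
        (\<integral>\<^sup>+x. indicator S x \<partial>distr (leb d) borel (lincomb d ?g))" using S by simp
    also have "\<dots> = ?N S"
      using S by (subst nn_integral_distr[OF measurable_lincomb_leb]) auto
    also have "?N S = ennreal k * emeasure (vol E) S"
    proof -
      have "?N S * ennreal (2 ^ d) = (ennreal k * emeasure (vol E) S) * ennreal (2 ^ d)"
        using key[OF S] k by (simp add: kN c1 ennreal_mult mult_ac)
      then have "?N S * (ennreal (2 ^ d) * ennreal (1 / 2 ^ d)) =
          (ennreal k * emeasure (vol E) S) * (ennreal (2 ^ d) * ennreal (1 / 2 ^ d))"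
        by (simp only: mult.assoc[symmetric])
      moreover have "ennreal (2 ^ d) * ennreal (1 / 2 ^ d) = 1"
        by (subst ennreal_mult[symmetric]) simp_all
      ultimately show ?thesis by simp
    qed
    also have "\<dots> = emeasure (density (vol E) (\<lambda>_. ennreal k)) S"
      using S by (simp add: emeasure_density_const)
    finally show "emeasure (distr (leb d) borel (lincomb d ?g)) S =
      emeasure (density (vol E) (\<lambda>_. ennreal k)) S" .
  qed simp
  with k show ?thesis by (rule that)
qed

text \<open>\<^term>\<open>vol_factor A k\<close> says that \<open>k\<close> is the absolute value of the determinant of \<open>A\<close> on \<open>E\<close>.\<close>

definition vol_factor :: "('a \<Rightarrow> 'a) \<Rightarrow> real \<Rightarrow> bool"
  where "vol_factor A k \<longleftrightarrow> linear A \<and> bij_betw A E E \<and> k > 0 \<and>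
    (\<forall>(g::'a \<Rightarrow> real)\<in>borel_measurable borel. \<forall>v\<in>E.
      (\<integral>x. g x \<partial>vol E) = k * (\<integral>x. g (A (P x) + v) \<partial>vol E))"

text \<open>The constant of \<open>vol_linear\<close> is inverted, which turns it into the absolute
  determinant. The shift by \<open>v\<close> comes from translation invariance.\<close>

lemma vol_factor_exists:
  assumes A: "linear A" "bij_betw A E E"
  shows "\<exists>k. vol_factor A k"
proof -
  obtain k where k: "k > 0"
    "distr (leb d) borel (lincomb d (\<lambda>i. A (b i))) = density (vol E) (\<lambda>_. ennreal k)"
    using vol_linear[OF A] by metis
  have "(\<integral>x. g x \<partial>vol E) = (1 / k) * (\<integral>x. g (A (P x) + v) \<partial>vol E)"
    if g: "g \<in> borel_measurable borel" and v: "v \<in> E" for g :: "'a \<Rightarrow> real" and v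
  proof -
    have "(\<lambda>x. A (P x) + v) \<in> borel_measurable borel"
      by (intro borel_measurable_continuous_onI continuous_on_add continuous_on_linear_P[OF A(1)]
          continuous_on_const)
    from measurable_compose[OF this g]
    have g1: "(\<lambda>x. g (A (P x) + v)) \<in> borel_measurable borel" .
    have "(\<lambda>x. x + v) \<in> borel_measurable borel"
      by (intro borel_measurable_continuous_onI continuous_intros)
    from measurable_compose[OF this g]
    have g2: "(\<lambda>x. g (x + v)) \<in> borel_measurable borel" .
    have lc: "lincomb d (\<lambda>i. A (b i)) c = A (P (lincomb d b c))" for c
      by (simp add: P_id lincomb_in_E) (simp add: lincomb_def linear_sum[OF A(1)] linear_scale[OF A(1)])
    have "(\<integral>x. g (A (P x) + v) \<partial>vol E) = (\<integral>c. g (lincomb d (\<lambda>i. A (b i)) c + v) \<partial>leb d)"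
      by (simp add: integral_vol[OF g1] lc)
    also have "\<dots> = (\<integral>x. g (x + v) \<partial>distr (leb d) borel (lincomb d (\<lambda>i. A (b i))))"
      by (rule integral_distr[OF measurable_lincomb_leb g2, symmetric])
    also have "\<dots> = k * (\<integral>x. g (x + v) \<partial>vol E)"
      unfolding k(2) using k(1) g2 by (subst integral_density) auto
    also have "(\<integral>x. g (x + v) \<partial>vol E) = (\<integral>c. g (lincomb d b c + v) \<partial>leb d)"
      by (rule integral_vol[OF g2])
    also have "\<dots> = (\<integral>x. g x \<partial>vol E)"
      unfolding integral_vol[OF g] using v by (intro integral_lincomb_translate g) (simp add: span_b)
    finally show ?thesis using k(1) by simp
  qed
  with k(1) A show ?thesis unfolding vol_factor_def by (intro exI[of _ "1 / k"]) auto
qed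

lemma vol_factorD:
  fixes g :: "'a \<Rightarrow> real"
  assumes "vol_factor A k" "g \<in> borel_measurable borel" "v \<in> E"
  shows "(\<integral>x. g x \<partial>vol E) = k * (\<integral>x. g (A (P x) + v) \<partial>vol E)"
  using assms by (auto simp: vol_factor_def)

lemma vol_factorD0:
  fixes g :: "'a \<Rightarrow> real"
  assumes "vol_factor A k" "g \<in> borel_measurable borel"
  shows "(\<integral>x. g x \<partial>vol E) = k * (\<integral>x. g (A (P x)) \<partial>vol E)"
  using vol_factorD[OF assms subspace_0[OF subspace_E]] by simp

lemma linear_in_E: "bij_betw A E E \<Longrightarrow> x \<in> E \<Longrightarrow> A x \<in> E"
  by (auto simp: bij_betw_def)

section \<open>Integrals over bounded sets and over affine images\<close>

lemma set_integrable_bounded: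
  fixes f :: "'a \<Rightarrow> real"
  assumes "S \<in> sets borel" "emeasure (vol E) S < \<infinity>" "f \<in> borel_measurable borel"
    "\<And>x. x \<in> S \<Longrightarrow> \<bar>f x\<bar> \<le> C"
  shows "set_integrable (vol E) S f"
  unfolding set_integrable_def
  by (rule integrableI_bounded_set_indicator[where B = C]) (use assms in auto)

lemma set_integrable_compact:
  fixes f :: "'a \<Rightarrow> real"
  assumes K: "compact K" and f: "continuous_on UNIV f"
  shows "set_integrable (vol E) K f"
proof -
  have "compact (f ` K)" using K f by (intro compact_continuous_image) (auto intro: continuous_on_subset)
  then obtain C where "\<And>x. x \<in> K \<Longrightarrow> \<bar>f x\<bar> \<le> C"
    using compact_imp_bounded[of "f ` K"] by (auto simp: bounded_iff)
  with K f show ?thesis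
    by (intro set_integrable_bounded emeasure_compact_finite borel_measurable_continuous_onI
        borel_closed compact_imp_closed)
qed

lemma LINT_sum:
  fixes f :: "'i \<Rightarrow> 'a \<Rightarrow> real"
  assumes "\<And>i. i \<in> I \<Longrightarrow> set_integrable M S (f i)"
  shows "(LINT x:S|M. (\<Sum>i\<in>I. f i x)) = (\<Sum>i\<in>I. LINT x:S|M. f i x)"
  using assms unfolding set_lebesgue_integral_def set_integrable_def
  by (simp add: scaleR_sum_right Bochner_Integration.integral_sum del: real_scaleR_def)

lemma LINT_one: "S \<in> sets borel \<Longrightarrow> (LINT x:S|vol E. 1) = measure (vol E) S"
  by (simp add: set_lebesgue_integral_def)

lemma LINT_cong_E:
  fixes f g :: "'a \<Rightarrow> real"
  assumes "S \<in> sets borel" "f \<in> borel_measurable borel" "g \<in> borel_measurable borel"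
    "\<And>x. x \<in> E \<Longrightarrow> x \<in> S \<Longrightarrow> f x = g x"
  shows "(LINT x:S|vol E. f x) = (LINT x:S|vol E. g x)"
  unfolding set_lebesgue_integral_def
  using assms by (intro integral_vol_cong) (auto simp: indicator_def)

lemma LINT_mono_E:
  fixes f g :: "'a \<Rightarrow> real"
  assumes "set_integrable (vol E) S f" "set_integrable (vol E) T g"
    "\<And>x. x \<in> E \<Longrightarrow> indicator S x * f x \<le> indicator T x * g x"
  shows "(LINT x:S|vol E. f x) \<le> (LINT x:T|vol E. g x)"
  using assms AE_vol_E unfolding set_lebesgue_integral_def set_integrable_def
  by (intro integral_mono_AE) (auto elim: eventually_mono)

lemma borel_measurable_inner [measurable]: "(\<lambda>x::'a. x \<bullet> y) \<in> borel_measurable borel"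
  by (intro borel_measurable_continuous_onI continuous_intros)

lemma borel_measurable_linear_P:
  fixes A :: "'a \<Rightarrow> 'a"
  assumes "linear A" shows "(\<lambda>x. A (P x) + v) \<in> borel_measurable borel"
  by (intro borel_measurable_continuous_onI continuous_on_add continuous_on_linear_P[OF assms]
      continuous_on_const)

lemma compact_affine_image:
  fixes A :: "'a \<Rightarrow> 'a"
  assumes "linear A" "compact K" "K \<subseteq> E"
  shows "compact ((\<lambda>x. A x + v) ` K)"
proof -
  have "(\<lambda>x. A x + v) ` K = (\<lambda>x. A (P x) + v) ` K"
    using assms(3) P_id by (intro image_cong) auto
  moreover have "continuous_on K (\<lambda>x. A (P x) + v)"
    by (intro continuous_on_add continuous_on_linear_P[OF assms(1)] continuous_on_const)
  ultimately show ?thesis using compact_continuous_image assms(2) by metis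
qed

lemma LINT_affine_image:
  fixes f :: "'a \<Rightarrow> real"
  assumes A: "vol_factor A k" and v: "v \<in> E" and K: "compact K" "K \<subseteq> E"
    and f: "f \<in> borel_measurable borel"
  shows "(LINT x:(\<lambda>x. A x + v) ` K|vol E. f x) = k * (LINT x:K|vol E. f (A (P x) + v))"
proof -
  have lin: "linear A" and bij: "bij_betw A E E" using A by (auto simp: vol_factor_def)
  let ?K = "(\<lambda>x. A x + v) ` K"
  have Kb: "K \<in> sets borel" "?K \<in> sets borel"
    using K(1) compact_affine_image[OF lin K, of v] by (auto intro: compact_imp_closed borel_closed)
  note m = borel_measurable_linear_P[OF lin, of v]
  have ind: "indicator ?K (A (P x) + v) = (indicator K x :: real)" if "x \<in> E" for x
  proof -
    have "A x + v \<in> ?K \<longleftrightarrow> x \<in> K"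
      using inj_on_image_mem_iff[of A E x K] bij K(2) that by (auto simp: bij_betw_def)
    then show ?thesis using P_id[OF that] by (simp add: indicator_def)
  qed
  have g: "(\<lambda>x. indicator ?K x * f x) \<in> borel_measurable borel" using Kb f by simp
  have "(LINT x:?K|vol E. f x) = (\<integral>x. indicator ?K x * f x \<partial>vol E)"
    by (simp add: set_lebesgue_integral_def)
  also have "\<dots> = k * (\<integral>x. indicator ?K (A (P x) + v) * f (A (P x) + v) \<partial>vol E)"
    by (rule vol_factorD[OF A g v])
  also have "(\<integral>x. indicator ?K (A (P x) + v) * f (A (P x) + v) \<partial>vol E) =
      (\<integral>x. indicator K x * f (A (P x) + v) \<partial>vol E)"
    by (rule integral_vol_cong)
      (use measurable_compose[OF m g] measurable_compose[OF m f] Kb ind in auto)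
  finally show ?thesis by (simp add: set_lebesgue_integral_def)
qed

lemma measure_affine_image:
  assumes A: "vol_factor A k" and v: "v \<in> E" and K: "compact K" "K \<subseteq> E"
  shows "measure (vol E) ((\<lambda>x. A x + v) ` K) = k * measure (vol E) K"
proof -
  have "linear A" using A by (simp add: vol_factor_def)
  from compact_affine_image[OF this K, of v] show ?thesis
    using LINT_affine_image[OF assms, of "\<lambda>_. 1"] K(1)
    by (simp add: LINT_one compact_imp_closed borel_closed)
qed

text \<open>A volume factor can be read off from any single set of known volume; here the dilation
  carries \<open>cube 1\<close> to \<open>cube t\<close>.\<close>

lemma vol_factor_scaleR:
  assumes t: "t > 0" shows "vol_factor (\<lambda>x. t *\<^sub>R x) (t ^ d)"
proof -
  have lin: "linear (\<lambda>x::'a. t *\<^sub>R x)" by (rule linearI) (simp_all add: scaleR_add_right)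
  have "bij_betw (\<lambda>x. t *\<^sub>R x) E E"
    by (rule bij_betw_byWitness[of _ "\<lambda>x. (1 / t) *\<^sub>R x"])
      (use t subspace_E in \<open>auto simp: subspace_scale\<close>)
  from vol_factor_exists[OF lin this] obtain k where k: "vol_factor (\<lambda>x. t *\<^sub>R x) k" ..
  have *: "indicator (cube t) (t *\<^sub>R P x) = (indicator (cube 1) x :: real)" for x
  proof -
    have "t *\<^sub>R P x \<in> cube t \<longleftrightarrow> x \<in> cube 1"
      using t by (auto simp: cube_def inner_P_b abs_mult)
    then show ?thesis by (simp add: indicator_def)
  qed
  have "measure (vol E) (cube t) = k * measure (vol E) (cube 1)"
    using vol_factorD0[OF k, of "indicator (cube t)"] by (simp add: *)
  then have "t ^ d * 2 ^ d = k * 2 ^ d" using t by (simp add: measure_cube power_mult_distrib)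
  then show ?thesis using k by simp
qed

text \<open>Again a cylinder, this time over a ball of \<open>E\<close>, which every isometry of
  \<open>E\<close> preserves.\<close>

definition ballP :: "real \<Rightarrow> 'a set"
  where "ballP r = {x. norm (P x) \<le> r}"

lemma ballP_borel [measurable]: "ballP r \<in> sets borel"
  unfolding ballP_def by (intro borel_closed closed_Collect_le continuous_intros)

lemma ballP_subset_cube: "ballP r \<subseteq> cube r"
proof
  fix x assume x: "x \<in> ballP r"
  have "\<bar>x \<bullet> b i\<bar> \<le> r" if "i < d" for i
    using Cauchy_Schwarz_ineq2[of "P x" "b i"] x norm_b[OF that] inner_P_b[OF that, of x]
    by (simp add: ballP_def)
  then show "x \<in> cube r" by (simp add: cube_def)
qed

lemma norm_P_cube_le:
  assumes "x \<in> cube r" "r \<ge> 0" shows "norm (P x) \<le> sqrt d * r"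
proof -
  have "(norm (P x))\<^sup>2 = (\<Sum>i<d. (x \<bullet> b i)\<^sup>2)"
    by (simp add: parseval_norm[OF P_in_E] inner_P_b)
  also have "\<dots> \<le> (\<Sum>i<d. r\<^sup>2)"
    using assms by (intro sum_mono) (auto simp: cube_def abs_le_square_iff[symmetric])
  also have "\<dots> = (sqrt d * r)\<^sup>2" by (simp add: power_mult_distrib)
  finally show ?thesis by (rule power2_le_imp_le) (use assms in auto)
qed

lemma emeasure_ballP_finite: "emeasure (vol E) (ballP r) < \<infinity>"
  by (rule emeasure_subset_cube_finite[OF ballP_subset_cube])

text \<open>The unit ball is mapped onto itself, and its volume is finite and, because it contains a
  small cube, positive. This leaves 1 as the only possible factor.\<close>

lemma vol_factor_isometry:
  assumes Q: "linear Q" "bij_betw Q E E" "\<And>x. x \<in> E \<Longrightarrow> norm (Q x) = norm x"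
  shows "vol_factor Q 1"
proof -
  obtain k where k: "vol_factor Q k" using vol_factor_exists[OF Q(1,2)] ..
  have "P (Q (P x)) = Q (P x)" for x using P_id linear_in_E[OF Q(2) P_in_E] .
  then have *: "indicator (ballP 1) (Q (P x)) = (indicator (ballP 1) x :: real)" for x
    by (simp add: indicator_def ballP_def Q(3)[OF P_in_E])
  let ?r = "1 / sqrt d"
  have "cube ?r \<subseteq> ballP 1"
  proof
    fix x assume "x \<in> cube ?r"
    then have "norm (P x) \<le> sqrt d * ?r" by (rule norm_P_cube_le) simp
    also have "\<dots> \<le> 1" by simp
    finally show "x \<in> ballP 1" by (simp add: ballP_def)
  qed
  then have "measure (vol E) (cube ?r) \<le> measure (vol E) (ballP 1)"
    by (intro measure_mono_fmeasurable) (use emeasure_ballP_finite[of 1] in \<open>auto simp: fmeasurable_def\<close>)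
  moreover have "measure (vol E) (cube ?r) > 0"
    \<comment> \<open>For \<open>d = 0\<close> the radius is \<open>1 / 0 = 0\<close>, and the
      volume of the cube is the empty power 1.\<close>
    by (cases "d = 0") (simp_all add: measure_cube)
  ultimately have "measure (vol E) (ballP 1) > 0" by simp
  moreover have "measure (vol E) (ballP 1) = k * measure (vol E) (ballP 1)"
    using vol_factorD0[OF k, of "indicator (ballP 1)"] by (simp add: *)
  ultimately show ?thesis using k by simp
qed

lemma vol_factor_id: "vol_factor (\<lambda>x. x) 1"
  by (rule vol_factor_isometry) (auto intro: linearI simp: bij_betw_def)

lemma LINT_pos:
  fixes f :: "'a \<Rightarrow> real"
  assumes int: "set_integrable (vol E) S f" and nn: "\<And>x. x \<in> S \<Longrightarrow> f x \<ge> 0"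
    and p: "p \<in> E" and pos: "e > 0" "\<delta> > 0"
    and lb: "\<And>x. x \<in> E \<Longrightarrow> dist x p < e \<Longrightarrow> x \<in> S \<and> f x \<ge> \<delta>"
  shows "(LINT x:S|vol E. f x) > 0"
proof -
  \<comment> \<open>Half the side of a cube whose half diagonal \<open>sqrt d * r\<close> is
    strictly below \<open>e\<close>; the summand 1 also covers \<open>d = 0\<close>.\<close>
  define r where "r = e / (sqrt d + 1)"
  have sd: "sqrt d + 1 > 0" by (simp add: add_nonneg_pos)
  have r: "r > 0" "sqrt d * r < e"
    using pos sd by (auto simp: r_def field_simps)
  let ?T = "(\<lambda>x. x - p) -` cube r"
  have m: "(\<lambda>x. x - p) \<in> borel_measurable borel"
    by (intro borel_measurable_continuous_onI continuous_intros)
  have T: "?T \<in> sets borel" using measurable_sets[OF m cube_borel[of r]] by simp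
  have ind: "indicator ?T (P x + p) = (indicator (cube r) x :: real)" for x
    by (simp add: indicator_def cube_def inner_P_b)
  have mT: "measure (vol E) ?T = (2 * r) ^ d"
    using vol_factorD[OF vol_factor_id, of "indicator ?T" p] T p r
    by (simp add: ind measure_cube)
  have sub: "x \<in> S \<and> f x \<ge> \<delta>" if "x \<in> E" "x \<in> ?T" for x
  proof (rule lb)
    have "x - p \<in> E" using that p subspace_diff[OF subspace_E] by auto
    then have "norm (x - p) \<le> sqrt d * r"
      using norm_P_cube_le[of "x - p" r] that r P_id by simp
    with r show "dist x p < e" by (simp add: dist_norm)
  qed (use that in auto)
  have "?T \<inter> E \<subseteq> cube (sqrt d * r + norm p)"
  proof
    fix x assume x: "x \<in> ?T \<inter> E"
    then have "x - p \<in> E" using p subspace_diff[OF subspace_E] by auto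
    then have "norm (x - p) \<le> sqrt d * r"
      using norm_P_cube_le[of "x - p" r] x r P_id by simp
    then have "norm x \<le> sqrt d * r + norm p" using norm_triangle_sub[of x p] by simp
    moreover have "norm (P x) \<le> norm x" by (rule norm_P_le)
    ultimately have "x \<in> ballP (sqrt d * r + norm p)" by (simp add: ballP_def)
    then show "x \<in> cube (sqrt d * r + norm p)" using ballP_subset_cube by blast
  qed
  then have "emeasure (vol E) (?T \<inter> E) < \<infinity>" by (rule emeasure_subset_cube_finite)
  then have int2: "set_integrable (vol E) (?T \<inter> E) (\<lambda>_. \<delta>)"
    by (intro set_integrable_bounded[where C = \<delta>]) (use T closed_E pos in auto)
  have "measure (vol E) (?T \<inter> E) = measure (vol E) ?T"
    using AE_vol_E T closed_E by (intro measure_eq_AE) (auto elim: eventually_mono)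
  then have "0 < (LINT x:?T \<inter> E|vol E. \<delta>)"
    using mT r pos by (simp add: set_lebesgue_integral_def)
  also have "\<dots> \<le> (LINT x:S|vol E. f x)"
    by (rule LINT_mono_E[OF int2 int]) (use sub nn in \<open>auto simp: indicator_def\<close>)
  finally show ?thesis .
qed

section \<open>Volume of linear images\<close>

lemma linear_P_expand:
  fixes A :: "'a \<Rightarrow> 'a"
  assumes "linear A"
  shows "A (P x) = (\<Sum>i<d. (x \<bullet> b i) *\<^sub>R A (b i))"
  by (simp add: P_def linear_sum[OF assms] linear_scale[OF assms])

definition adj :: "('a \<Rightarrow> 'a) \<Rightarrow> 'a \<Rightarrow> 'a"
  where "adj A z = lincomb d b (\<lambda>i. A (b i) \<bullet> z)"

lemma adj_in_E: "adj A z \<in> E"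
  by (simp add: adj_def lincomb_in_E)

lemma inner_adj: "linear A \<Longrightarrow> A (P x) \<bullet> z = x \<bullet> adj A z"
  by (simp add: linear_P_expand adj_def lincomb_def inner_sum_left inner_sum_right mult.commute)

lemma norm_adj: "(norm (adj A z))\<^sup>2 = (\<Sum>i<d. (A (b i) \<bullet> z)\<^sup>2)"
  by (simp add: parseval_norm[OF adj_in_E]) (simp add: adj_def inner_lincomb)

text \<open>By Parseval, |A x|^2 is the sum of the squares of the inner products of x with the
  vectors \<open>adj A (b j)\<close>, and each of these has a known moment. A map and its adjoint
  have the same Hilbert-Schmidt norm, which yields the right-hand side.\<close>

lemma second_moment_linear:
  assumes A: "linear A" "\<And>x. x \<in> E \<Longrightarrow> A x \<in> E"
    and int: "\<And>\<theta>. \<theta> \<in> E \<Longrightarrow> set_integrable (vol E) S (\<lambda>x. (x \<bullet> \<theta>)\<^sup>2)"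
    and mom: "\<And>\<theta>. \<theta> \<in> E \<Longrightarrow> (LINT x:S|vol E. (x \<bullet> \<theta>)\<^sup>2) = m * (norm \<theta>)\<^sup>2"
  shows "(LINT x:S|vol E. (norm (A (P x)))\<^sup>2) = m * (\<Sum>i<d. (norm (A (b i)))\<^sup>2)"
proof -
  have *: "(norm (A (P x)))\<^sup>2 = (\<Sum>j<d. (x \<bullet> adj A (b j))\<^sup>2)" for x
    by (simp add: parseval_norm[OF A(2)[OF P_in_E]] inner_adj[OF A(1)])
  have "(LINT x:S|vol E. (norm (A (P x)))\<^sup>2) = (\<Sum>j<d. m * (norm (adj A (b j)))\<^sup>2)"
    unfolding * by (subst LINT_sum) (simp_all add: int mom adj_in_E)
  also have "\<dots> = m * (\<Sum>j<d. \<Sum>i<d. (A (b i) \<bullet> b j)\<^sup>2)"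
    by (simp add: norm_adj sum_distrib_left)
  also have "(\<Sum>j<d. \<Sum>i<d. (A (b i) \<bullet> b j)\<^sup>2) = (\<Sum>i<d. \<Sum>j<d. (A (b i) \<bullet> b j)\<^sup>2)"
    by (rule sum.swap)
  also have "\<dots> = (\<Sum>i<d. (norm (A (b i)))\<^sup>2)"
    by (intro sum.cong refl) (simp add: parseval_norm[OF A(2)[OF b_in_E]])
  finally show ?thesis .
qed

lemma set_integrable_ballP_inner:
  assumes "\<theta> \<in> E"
  shows "set_integrable (vol E) (ballP r) (\<lambda>x. (x \<bullet> \<theta>)\<^sup>2)"
proof (rule set_integrable_bounded[where C = "(r * norm \<theta>)\<^sup>2"])
  fix x assume x: "x \<in> ballP r"
  have "\<bar>x \<bullet> \<theta>\<bar> = \<bar>P x \<bullet> \<theta>\<bar>" by (simp add: inner_P[OF assms])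
  also have "\<dots> \<le> norm (P x) * norm \<theta>" by (rule Cauchy_Schwarz_ineq2)
  also have "\<dots> \<le> r * norm \<theta>" using x by (intro mult_right_mono) (auto simp: ballP_def)
  finally have "\<bar>x \<bullet> \<theta>\<bar>\<^sup>2 \<le> (r * norm \<theta>)\<^sup>2" by (intro power_mono) auto
  then show "\<bar>(x \<bullet> \<theta>)\<^sup>2\<bar> \<le> (r * norm \<theta>)\<^sup>2" by simp
qed (use emeasure_ballP_finite in auto)

lemma set_integrable_ballP_norm: "set_integrable (vol E) (ballP r) (\<lambda>x. (norm (P x))\<^sup>2)"
proof (rule set_integrable_bounded[where C = "r\<^sup>2"])
  fix x assume "x \<in> ballP r"
  then have "(norm (P x))\<^sup>2 \<le> r\<^sup>2" by (intro power_mono) (auto simp: ballP_def)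
  then show "\<bar>(norm (P x))\<^sup>2\<bar> \<le> r\<^sup>2" by simp
next
  show "(\<lambda>x. (norm (P x))\<^sup>2) \<in> borel_measurable borel"
    by (intro borel_measurable_continuous_onI continuous_intros)
qed (use emeasure_ballP_finite in auto)

text \<open>The reflection \<open>Q\<close> along \<theta> - \<eta> is an isometry of
  \<open>E\<close> that exchanges the two vectors and preserves the ball.\<close>

lemma ballP_moment_isometric:
  assumes E: "\<theta> \<in> E" "\<eta> \<in> E" and n: "norm \<theta> = norm \<eta>"
  shows "(LINT x:ballP 1|vol E. (x \<bullet> \<theta>)\<^sup>2) = (LINT x:ballP 1|vol E. (x \<bullet> \<eta>)\<^sup>2)"
proof (cases "\<theta> = \<eta>")
  case False
  define u where "u = \<theta> - \<eta>"
  define Q where "Q x = x - (2 * (x \<bullet> u) / (u \<bullet> u)) *\<^sub>R u" for x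
  have uE: "u \<in> E" using E by (simp add: u_def subspace_diff[OF subspace_E])
  have u: "u \<bullet> u > 0" using False by (simp add: u_def)
  have lin: "linear Q"
    by (rule linearI) (simp_all add: Q_def inner_add_left algebra_simps add_divide_distrib)
  have QE: "Q x \<in> E" if "x \<in> E" for x
    unfolding Q_def using that uE by (intro subspace_diff subspace_scale subspace_E)
  have Qu: "Q x \<bullet> u = - (x \<bullet> u)" for x
    using u by (simp add: Q_def inner_diff_left)
  have QQ: "Q (Q x) = x" for x
    unfolding Q_def[of "Q x"] Qu by (simp add: Q_def)
  have "Q x \<bullet> Q x = x \<bullet> x" for x
  proof -
    have "Q x \<bullet> Q x = Q x \<bullet> x - (2 * (x \<bullet> u) / (u \<bullet> u)) * (Q x \<bullet> u)"
      by (subst (2) Q_def) (simp add: inner_diff_right)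
    also have "\<dots> = x \<bullet> x - (2 * (x \<bullet> u) / (u \<bullet> u)) * (u \<bullet> x) + (2 * (x \<bullet> u) / (u \<bullet> u)) * (x \<bullet> u)"
      unfolding Qu by (simp add: Q_def inner_diff_left)
    finally show ?thesis by (simp add: inner_commute)
  qed
  then have Qn: "norm (Q x) = norm x" for x by (simp add: norm_eq_sqrt_inner)
  have bij: "bij_betw Q E E" by (rule bij_betw_byWitness[of _ Q]) (use QQ QE in auto)
  have Qeta: "Q x \<bullet> \<eta> = x \<bullet> \<theta>" for x
  proof -
    have "\<theta> \<bullet> \<theta> = \<eta> \<bullet> \<eta>" using n by (simp add: norm_eq_sqrt_inner)
    then have "u \<bullet> \<eta> = - (u \<bullet> u) / 2"
      by (simp add: u_def inner_diff_left inner_diff_right inner_commute)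
    then have "Q x \<bullet> \<eta> = x \<bullet> \<eta> + x \<bullet> u" using u by (simp add: Q_def inner_diff_left)
    then show ?thesis by (simp add: u_def inner_diff_right)
  qed
  have ind: "indicator (ballP 1) (Q (P x)) = (indicator (ballP 1) x :: real)" for x
    using P_id[OF QE[OF P_in_E]] by (simp add: indicator_def ballP_def Qn)
  have "(LINT x:ballP 1|vol E. (x \<bullet> \<eta>)\<^sup>2)
      = (\<integral>x. indicator (ballP 1) (Q (P x)) * (Q (P x) \<bullet> \<eta>)\<^sup>2 \<partial>vol E)"
    unfolding set_lebesgue_integral_def
    using vol_factorD0[OF vol_factor_isometry[OF lin bij Qn],
        of "\<lambda>x. indicator (ballP 1) x * (x \<bullet> \<eta>)\<^sup>2"] by simp
  also have "\<dots> = (LINT x:ballP 1|vol E. (x \<bullet> \<theta>)\<^sup>2)"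
    by (simp add: ind Qeta inner_P[OF E(1)] set_lebesgue_integral_def)
  finally show ?thesis by simp
qed simp

lemma ballP_second_moment:
  assumes d: "d > 0"
  shows "\<exists>m>0. \<forall>\<theta>\<in>E. (LINT x:ballP 1|vol E. (x \<bullet> \<theta>)\<^sup>2) = m * (norm \<theta>)\<^sup>2"
proof -
  let ?m = "LINT x:ballP 1|vol E. (x \<bullet> b 0)\<^sup>2"
  have "(LINT x:ballP 1|vol E. (x \<bullet> \<theta>)\<^sup>2) = ?m * (norm \<theta>)\<^sup>2" if "\<theta> \<in> E" for \<theta>
  proof -
    have "(LINT x:ballP 1|vol E. (x \<bullet> \<theta>)\<^sup>2) =
        (LINT x:ballP 1|vol E. (x \<bullet> (norm \<theta> *\<^sub>R b 0))\<^sup>2)"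
      using that b_in_E[OF d] norm_b[OF d]
      by (intro ballP_moment_isometric) (auto simp: subspace_scale[OF subspace_E])
    also have "\<dots> = (LINT x:ballP 1|vol E. (norm \<theta>)\<^sup>2 * (x \<bullet> b 0)\<^sup>2)"
      by (simp add: power_mult_distrib)
    finally show ?thesis by (simp add: mult.commute)
  qed
  moreover have "?m > 0"
  proof (rule LINT_pos)
    show "set_integrable (vol E) (ballP 1) (\<lambda>x. (x \<bullet> b 0)\<^sup>2)"
      by (rule set_integrable_ballP_inner[OF b_in_E[OF d]])
    \<comment> \<open>Within distance 1/4 of this point the norm is at most 3/4 and the inner
      product with \<open>b 0\<close> is at least 1/4.\<close>
    show "(1 / 2) *\<^sub>R b 0 \<in> E" by (rule subspace_scale[OF subspace_E b_in_E[OF d]])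
    fix x assume x: "x \<in> E" "dist x ((1 / 2) *\<^sub>R b 0) < 1 / 4"
    let ?y = "x - (1 / 2) *\<^sub>R b 0"
    have y: "norm ?y < 1 / 4" using x by (simp add: dist_norm)
    have "norm x \<le> norm ((1 / 2) *\<^sub>R b 0) + norm ?y"
      by (rule norm_triangle_sub)
    then have "norm (P x) \<le> 1" using y norm_P_le[of x] norm_b[OF d] by simp
    moreover have "\<bar>?y \<bullet> b 0\<bar> \<le> norm ?y"
      using Cauchy_Schwarz_ineq2[of ?y "b 0"] norm_b[OF d] by simp
    then have "x \<bullet> b 0 \<ge> 1 / 4"
      using y inner_b[OF d d] by (simp add: inner_diff_left)
    then have "(x \<bullet> b 0)\<^sup>2 \<ge> (1 / 4)\<^sup>2" by (intro power_mono) auto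
    ultimately show "x \<in> ballP 1 \<and> (1 / 4)\<^sup>2 \<le> (x \<bullet> b 0)\<^sup>2"
      by (simp add: ballP_def)
  qed auto
  ultimately show ?thesis by blast
qed

text \<open>
  A form of \<open>d (det A)\<^bsup>2/d\<^esup> \<le> \<parallel>A\<parallel>\<^bsub>HS\<^esub>\<^sup>2\<close>: among all sets of given volume the ball has the smallest
  second moment, and the second moment of the image of the ball is proportional to the
  Hilbert-Schmidt norm.
\<close>
lemma vol_factor_le:
  fixes \<rho> :: real
  assumes d: "d > 0" and A: "vol_factor A k" and \<rho>: "\<rho> > 0" "\<rho> ^ d \<le> k"
  shows "d * \<rho>\<^sup>2 \<le> (\<Sum>i<d. (norm (A (b i)))\<^sup>2)"
proof -
  have lin: "linear A" and bij: "bij_betw A E E" and k: "k > 0"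
    using A by (auto simp: vol_factor_def)
  obtain B where B: "continuous_on UNIV B" "\<And>x. x \<in> E \<Longrightarrow> B (A x) = x"
    using inverse_on_E[OF lin bij] by metis
  obtain m where m: "m > 0"
    "\<And>\<theta>. \<theta> \<in> E \<Longrightarrow> (LINT x:ballP 1|vol E. (x \<bullet> \<theta>)\<^sup>2) = m * (norm \<theta>)\<^sup>2"
    using ballP_second_moment[OF d] by blast
  define \<Sigma> where "\<Sigma> = (\<Sum>i<d. (norm (A (b i)))\<^sup>2)"
  \<comment> \<open>On \<open>E\<close> this is the ellipsoid \<open>A\<close> (unit ball), written
    with the inverse map so that it is visibly closed.\<close>
  define X where "X = {x. norm (P (B x)) \<le> 1}"
  define V where "V = measure (vol E) (ballP 1)"
  let ?Y = "ballP \<rho>"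
  have X: "X \<in> sets borel"
    unfolding X_def by (intro borel_closed closed_Collect_le continuous_intros B)
  have nP: "(\<lambda>x. (norm (P x))\<^sup>2) \<in> borel_measurable borel"
    by (intro borel_measurable_continuous_onI continuous_intros)
  have indX: "indicator X (A (P x)) = (indicator (ballP 1) x :: real)" for x
    by (simp add: X_def ballP_def indicator_def B(2) P_in_E P_id)
  have indY: "indicator ?Y (\<rho> *\<^sub>R P x) = (indicator (ballP 1) x :: real)" for x
    using \<rho> by (simp add: ballP_def indicator_def P_in_E P_id linear_scale[OF linear_P])
  have PA: "P (A (P x)) = A (P x)" for x using P_id linear_in_E[OF bij P_in_E] .
  have momA: "(\<integral>x. indicator (ballP 1) x * (norm (A (P x)))\<^sup>2 \<partial>vol E) = m * \<Sigma>"
    using second_moment_linear[of A "ballP 1" m, OF lin linear_in_E[OF bij]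
        set_integrable_ballP_inner m(2)]
    by (simp add: \<Sigma>_def set_lebesgue_integral_def)
  have mom1: "(\<integral>x. indicator (ballP 1) x * (norm (P x))\<^sup>2 \<partial>vol E) = m * d"
    using second_moment_linear[of "\<lambda>x. x" "ballP 1" m, OF linear_ident _
        set_integrable_ballP_inner m(2)]
    by (simp add: set_lebesgue_integral_def norm_b)
  have X0: "(\<integral>x. indicator X x \<partial>vol E) = k * V"
    using vol_factorD0[OF A, of "indicator X"] X by (simp add: indX V_def)
  have X2: "(\<integral>x. indicator X x * (norm (P x))\<^sup>2 \<partial>vol E) = k * (m * \<Sigma>)"
    using vol_factorD0[OF A, of "\<lambda>x. indicator X x * (norm (P x))\<^sup>2"] X nP
    by (simp add: indX PA momA)
  note S = vol_factor_scaleR[OF \<rho>(1)]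
  have Y0: "(\<integral>x. indicator ?Y x \<partial>vol E) = \<rho> ^ d * V"
    using vol_factorD0[OF S, of "indicator ?Y"] by (simp add: indY V_def)
  have Y2: "(\<integral>x. indicator ?Y x * (norm (P x))\<^sup>2 \<partial>vol E) = \<rho> ^ d * (\<rho>\<^sup>2 * (m * d))"
  proof -
    have "(\<integral>x. indicator ?Y x * (norm (P x))\<^sup>2 \<partial>vol E) =
        \<rho> ^ d * (\<integral>x. \<rho>\<^sup>2 * (indicator (ballP 1) x * (norm (P x))\<^sup>2) \<partial>vol E)"
      using vol_factorD0[OF S, of "\<lambda>x. indicator ?Y x * (norm (P x))\<^sup>2"] nP \<rho>
      by (simp add: indY linear_scale[OF linear_P] P_id P_in_E power_mult_distrib mult_ac)
    then show ?thesis by (simp add: mom1)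
  qed
  have int1: "integrable (vol E) (indicator ?Y :: 'a \<Rightarrow> real)"
    using emeasure_ballP_finite by (intro integrable_real_indicator) auto
  have int2: "integrable (vol E) (\<lambda>x. indicator ?Y x * (norm (P x))\<^sup>2)"
    using set_integrable_ballP_norm[of \<rho>] by (simp add: set_integrable_def)
  \<comment> \<open>|x|^2 is at most 1 on the unit ball. This comparison absorbs the difference
    between \<open>\<rho> ^ d\<close> and \<open>k\<close> at the end.\<close>
  have V: "m * d \<le> V"
  proof -
    have "(LINT x:ballP 1|vol E. (norm (P x))\<^sup>2) \<le> (LINT x:ballP 1|vol E. 1)"
    proof (rule LINT_mono_E)
      show "set_integrable (vol E) (ballP 1) (\<lambda>x. (norm (P x))\<^sup>2)"
        by (rule set_integrable_ballP_norm)
      show "set_integrable (vol E) (ballP 1) (\<lambda>x. 1 :: real)"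
        using emeasure_ballP_finite[of 1]
        by (intro set_integrable_bounded[where C = 1]) auto
    qed (auto simp: ballP_def indicator_def power_le_one)
    then show ?thesis using mom1 by (simp add: LINT_one V_def) (simp add: set_lebesgue_integral_def)
  qed
  have "norm (A (b 0)) > 0"
  proof -
    have "A (b 0) \<noteq> A 0"
      using bij b_in_E[OF d] subspace_0[OF subspace_E] norm_b[OF d]
      by (auto simp: bij_betw_def dest!: inj_onD)
    then show ?thesis using linear_0[OF lin] by simp
  qed
  then have "\<Sigma> > 0" unfolding \<Sigma>_def using d by (intro sum_pos2[of _ 0]) auto
  have md: "m * d > 0" using m d by simp
  \<comment> \<open>The integral of a nonintegrable function is 0 by convention, so a positive value
    of the integral already proves integrability.\<close>
  have int3: "integrable (vol E) (indicator X :: 'a \<Rightarrow> real)"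
    using X0 k md V not_integrable_integral_eq[of "vol E" "indicator X :: 'a \<Rightarrow> real"] by fastforce
  have int4: "integrable (vol E) (\<lambda>x. indicator X x * (norm (P x))\<^sup>2)"
    using X2 k m(1) \<open>\<Sigma> > 0\<close> not_integrable_integral_eq[of "vol E" "\<lambda>x. indicator X x * (norm (P x))\<^sup>2"]
    by fastforce
  \<comment> \<open>Bathtub comparison: |P x|^2 - \<rho>^2 is nonpositive exactly on
    \<open>?Y\<close>, hence \<open>?Y\<close> minimises its integral among all sets.\<close>
  have "(\<integral>x. indicator ?Y x * (norm (P x))\<^sup>2 - \<rho>\<^sup>2 * indicator ?Y x \<partial>vol E) \<le>
      (\<integral>x. indicator X x * (norm (P x))\<^sup>2 - \<rho>\<^sup>2 * indicator X x \<partial>vol E)"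
  proof (rule integral_mono)
    fix x
    show "indicator ?Y x * (norm (P x))\<^sup>2 - \<rho>\<^sup>2 * indicator ?Y x \<le>
      indicator X x * (norm (P x))\<^sup>2 - \<rho>\<^sup>2 * indicator X x"
    proof (cases "x \<in> ?Y")
      case True
      then have "(norm (P x))\<^sup>2 \<le> \<rho>\<^sup>2" by (intro power_mono) (auto simp: ballP_def)
      then show ?thesis using True by (simp add: indicator_def)
    next
      case False
      then have "\<rho>\<^sup>2 \<le> (norm (P x))\<^sup>2" using \<rho> by (intro power_mono) (auto simp: ballP_def)
      then show ?thesis using False by (simp add: indicator_def)
    qed
  qed (intro Bochner_Integration.integrable_diff integrable_mult_right int1 int2 int3 int4)+
  moreover have "measure (vol E) X = k * V" "measure (vol E) ?Y = \<rho> ^ d * V"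
    using X0 Y0 X by simp_all
  ultimately have "\<rho> ^ d * (\<rho>\<^sup>2 * (m * d)) - \<rho>\<^sup>2 * (\<rho> ^ d * V) \<le> k * (m * \<Sigma>) - \<rho>\<^sup>2 * (k * V)"
    using X by (simp add: int1 int2 int3 int4 X2 Y2)
  \<comment> \<open>The volumes of \<open>X\<close> and \<open>?Y\<close> need not agree. As
    \<open>V - m * d\<close> is nonnegative, replacing \<open>\<rho> ^ d\<close> by the larger
    \<open>k\<close> keeps the inequality, and then the terms with \<open>V\<close> cancel.\<close>
  moreover have "\<rho> ^ d * (\<rho>\<^sup>2 * (V - m * d)) \<le> k * (\<rho>\<^sup>2 * (V - m * d))"
    using \<rho> V by (intro mult_right_mono) auto
  ultimately have "k * (\<rho>\<^sup>2 * (m * d)) \<le> k * (m * \<Sigma>)"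
    by (simp add: algebra_simps)
  then have "\<rho>\<^sup>2 * (m * d) \<le> m * \<Sigma>" using k by simp
  then have "m * (d * \<rho>\<^sup>2) \<le> m * \<Sigma>" by (simp add: mult_ac)
  then show ?thesis using m(1) by (simp add: \<Sigma>_def)
qed

lemma isotropic_moment:
  assumes "isotropic E K L" "\<theta> \<in> E"
  shows "(LINT x:K|vol E. (x \<bullet> \<theta>)\<^sup>2) = L\<^sup>2 * (norm \<theta>)\<^sup>2"
proof (cases "\<theta> = 0")
  case False
  define u where "u = (1 / norm \<theta>) *\<^sub>R \<theta>"
  have u: "u \<in> E" "norm u = 1" "\<theta> = norm \<theta> *\<^sub>R u"
    using False assms(2) subspace_scale[OF subspace_E] by (auto simp: u_def)
  have "(LINT x:K|vol E. (x \<bullet> \<theta>)\<^sup>2) = (LINT x:K|vol E. (norm \<theta>)\<^sup>2 * (x \<bullet> u)\<^sup>2)"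
    by (subst u(3)) (simp add: power_mult_distrib)
  also have "\<dots> = (norm \<theta>)\<^sup>2 * L\<^sup>2"
    using assms(1) u by (simp add: isotropic_def)
  finally show ?thesis by (simp add: mult.commute)
qed (simp add: set_lebesgue_integral_def)

text \<open>Pull the integral back to \<open>K1\<close>. The barycenter at 0 removes the cross term,
  the square of the shift is nonnegative, and the remaining term is \<open>L\<^sup>2\<close> times
  the squared Hilbert-Schmidt norm of \<open>B\<close>, to which \<open>vol_factor_le\<close>
  applies. Since \<open>K1\<close> has volume 1, the factor \<open>k\<close> is the volume of
  \<open>K\<close>.\<close>

lemma isotropic_bound:
  fixes \<rho> L :: real
  assumes d: "d > 0" and K1: "isotropic E K1 L" and B: "vol_factor B k" and w: "w \<in> E"
    and K: "K = (\<lambda>x. B x + w) ` K1" and \<rho>: "\<rho> > 0" "\<rho> ^ d \<le> measure (vol E) K"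
  shows "d * \<rho>\<^sup>2 * L\<^sup>2 * measure (vol E) K \<le> (LINT x:K|vol E. (norm (x - p))\<^sup>2)"
proof -
  have lin: "linear B" and bij: "bij_betw B E E" and k: "k > 0"
    using B by (auto simp: vol_factor_def)
  have K1': "compact K1" "K1 \<subseteq> E" "measure (vol E) K1 = 1" "is_barycenter E K1 0"
    using K1 by (auto simp: isotropic_def convex_body_in_def)
  have mK: "measure (vol E) K = k"
    unfolding K by (simp add: measure_affine_image[OF B w K1'(1,2)] K1'(3))
  define z where "z = w - p"
  note cont = continuous_on_linear_P[OF lin] continuous_intros
  have "(LINT x:K1|vol E. B (P x) \<bullet> z) = 0"
    using K1'(3,4) adj_in_E[of B z] by (simp add: inner_adj[OF lin] is_barycenter_def)
  moreover have "(LINT x:K1|vol E. (norm (B (P x)))\<^sup>2) = L\<^sup>2 * (\<Sum>i<d. (norm (B (b i)))\<^sup>2)"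
    by (rule second_moment_linear[OF lin linear_in_E[OF bij]])
      (auto intro!: set_integrable_compact K1' continuous_intros isotropic_moment[OF K1])
  moreover have "(LINT x:K1|vol E. (norm (B (P x) + z))\<^sup>2) =
      (LINT x:K1|vol E. (norm (B (P x)))\<^sup>2) + 2 * (LINT x:K1|vol E. B (P x) \<bullet> z)
        + (LINT x:K1|vol E. (norm z)\<^sup>2)"
  proof -
    have "(norm (B (P x) + z))\<^sup>2 = (norm (B (P x)))\<^sup>2 + 2 * (B (P x) \<bullet> z) + (norm z)\<^sup>2" for x
      by (simp add: power2_norm_eq_inner inner_add_left inner_add_right inner_commute)
    moreover have "set_integrable (vol E) K1 (\<lambda>x. (norm (B (P x)))\<^sup>2)"
      "set_integrable (vol E) K1 (\<lambda>x. 2 * (B (P x) \<bullet> z))"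
      "set_integrable (vol E) K1 (\<lambda>x. (norm z)\<^sup>2)"
      by (intro set_integrable_compact K1' cont)+
    ultimately show ?thesis by simp
  qed
  moreover have "(LINT x:K1|vol E. (norm z)\<^sup>2) = (norm z)\<^sup>2"
    using K1'(3) by (simp add: set_lebesgue_integral_def)
  ultimately have "L\<^sup>2 * (\<Sum>i<d. (norm (B (b i)))\<^sup>2) \<le> (LINT x:K1|vol E. (norm (B (P x) + z))\<^sup>2)"
    by simp
  moreover have "L\<^sup>2 * (d * \<rho>\<^sup>2) \<le> L\<^sup>2 * (\<Sum>i<d. (norm (B (b i)))\<^sup>2)"
    using vol_factor_le[OF d B \<rho>(1)] \<rho>(2) mK by (intro mult_left_mono) auto
  ultimately have "k * (L\<^sup>2 * (d * \<rho>\<^sup>2)) \<le> k * (LINT x:K1|vol E. (norm (B (P x) + z))\<^sup>2)"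
    using k by (intro mult_left_mono) auto
  also have "\<dots> = (LINT x:K|vol E. (norm (x - p))\<^sup>2)"
    unfolding K by (subst LINT_affine_image[OF B w K1'(1,2)])
      (auto simp: z_def algebra_simps intro!: borel_measurable_continuous_onI continuous_intros)
  finally show ?thesis by (simp add: mK mult_ac)
qed

section \<open>Isotropic position\<close>

lemma affine_images_sym:
  assumes "K \<subseteq> E" "K1 \<in> affine_images E K"
  shows "K \<in> affine_images E K1"
proof -
  obtain A v where A: "linear A" "bij_betw A E E" "v \<in> E" "K1 = (\<lambda>x. A x + v) ` K"
    using assms(2) by (auto simp: affine_images_def)
  obtain B where B: "linear B" "bij_betw B E E" "\<And>x. x \<in> E \<Longrightarrow> B (A x) = x"
    using inverse_on_E[OF A(1,2)] by metis
  have "(\<lambda>x. B x + - B v) ` K1 = (\<lambda>x. x) ` K"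
    unfolding A(4) image_image using assms(1) B(3)
    by (intro image_cong) (auto simp: linear_add[OF B(1)])
  moreover have "- B v \<in> E"
    using linear_in_E[OF B(2) A(3)] subspace_neg[OF subspace_E] by blast
  ultimately show ?thesis
    unfolding affine_images_def using B by (intro CollectI exI[of _ B] exI[of _ "- B v"]) simp
qed

lemma affine_images_trans:
  assumes "K1 \<in> affine_images E K" "K2 \<in> affine_images E K1"
  shows "K2 \<in> affine_images E K"
proof -
  obtain A v where A: "linear A" "bij_betw A E E" "v \<in> E" "K1 = (\<lambda>x. A x + v) ` K"
    using assms(1) by (auto simp: affine_images_def)
  obtain B w where B: "linear B" "bij_betw B E E" "w \<in> E" "K2 = (\<lambda>x. B x + w) ` K1"
    using assms(2) by (auto simp: affine_images_def)
  have "K2 = (\<lambda>x. (B \<circ> A) x + (B v + w)) ` K"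
    unfolding B(4) A(4) image_image by (simp add: linear_add[OF B(1)] add.assoc)
  moreover have "B v + w \<in> E"
    using linear_in_E[OF B(2) A(3)] B(3) subspace_add[OF subspace_E] by blast
  ultimately show ?thesis
    unfolding affine_images_def
    using linear_compose[OF A(1) B(1)] bij_betw_trans[OF A(2) B(2)] by blast
qed

lemma isotropic_affine_bound:
  fixes \<rho> L :: real
  assumes d: "d > 0" and K1: "isotropic E K1 L" "K \<in> affine_images E K1"
    and \<rho>: "\<rho> > 0" "\<rho> ^ d \<le> measure (vol E) K"
  shows "d * \<rho>\<^sup>2 * L\<^sup>2 * measure (vol E) K \<le> (LINT x:K|vol E. (norm (x - p))\<^sup>2)"
proof -
  obtain A v where A: "linear A" "bij_betw A E E" "v \<in> E" "K = (\<lambda>x. A x + v) ` K1"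
    using K1(2) by (auto simp: affine_images_def)
  obtain k where "vol_factor A k" using vol_factor_exists[OF A(1,2)] ..
  then show ?thesis using isotropic_bound[OF d K1(1) _ A(3,4) \<rho>] by blast
qed

text \<open>Case \<open>\<rho> = 1\<close>, \<open>p = 0\<close> of the moment bound: the second
  moment of the isotropic body \<open>K2\<close> is \<open>d * L2\<^sup>2\<close>. Used in both
  directions it gives uniqueness of the isotropy constant.\<close>

lemma isotropic_le:
  assumes d: "d > 0" and K1: "isotropic E K1 L1" and K2: "isotropic E K2 L2"
    and img: "K2 \<in> affine_images E K1"
  shows "L1 \<le> L2"
proof -
  have K: "compact K2" "K2 \<subseteq> E" "measure (vol E) K2 = 1" "L2 > 0"
    using K2 by (auto simp: isotropic_def convex_body_in_def)
  have "(LINT x:K2|vol E. (norm (x - 0))\<^sup>2) = (LINT x:K2|vol E. (norm (P x))\<^sup>2)"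
    using K P_id by (intro LINT_cong_E borel_closed compact_imp_closed
        borel_measurable_continuous_onI continuous_intros) auto
  also have "\<dots> = L2\<^sup>2 * d"
    using second_moment_linear[OF linear_ident, of K2 "L2\<^sup>2"] isotropic_moment[OF K2] norm_b
    by (simp add: set_integrable_compact K continuous_intros)
  finally have "d * L1\<^sup>2 \<le> d * L2\<^sup>2"
    using isotropic_affine_bound[OF d K1 img, of 1 0] K(3) by (simp add: mult.commute)
  then have "L1\<^sup>2 \<le> L2\<^sup>2" using d by simp
  then show ?thesis by (rule power2_le_imp_le) (use K(4) in simp)
qed

section \<open>Convex bodies under affine maps, and nondegeneracy of their moments\<close>

lemma convex_body_in_ball:
  assumes "convex_body_in E K"
  obtains p e where "p \<in> E" "e > 0" "\<And>x. x \<in> E \<Longrightarrow> dist x p < e \<Longrightarrow> x \<in> K"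
proof -
  obtain p where p: "p \<in> (top_of_set E) interior_of K"
    using assms by (auto simp: convex_body_in_def)
  have op: "openin (top_of_set E) ((top_of_set E) interior_of K)" by simp
  then have "p \<in> E" using p openin_imp_subset by blast
  moreover obtain e where "e > 0" "\<And>x. x \<in> E \<Longrightarrow> dist x p < e \<Longrightarrow> x \<in> (top_of_set E) interior_of K"
    using op[unfolded openin_euclidean_subtopology_iff] p by blast
  moreover have "(top_of_set E) interior_of K \<subseteq> K" by (rule interior_of_subset)
  ultimately show ?thesis using that[of p e] by (meson subsetD)
qed

lemma convex_body_inI:
  assumes "K \<subseteq> E" "compact K" "convex K" and U: "open U" "E \<inter> U \<subseteq> K" "p \<in> E \<inter> U"
  shows "convex_body_in E K"
proof -
  have "openin (top_of_set E) (E \<inter> U)" using U(1) by (rule openin_open_Int)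
  then have "E \<inter> U \<subseteq> (top_of_set E) interior_of K" using U(2) by (rule interior_of_maximal[rotated])
  then show ?thesis using assms by (auto simp: convex_body_in_def)
qed

lemma convex_body_in_affine:
  assumes K: "convex_body_in E K" and A: "linear A" "bij_betw A E E" and v: "v \<in> E"
  shows "convex_body_in E ((\<lambda>x. A x + v) ` K)"
proof -
  have K': "compact K" "K \<subseteq> E" "convex K" using K by (auto simp: convex_body_in_def)
  obtain p e where p: "p \<in> E" "e > 0" "\<And>x. x \<in> E \<Longrightarrow> dist x p < e \<Longrightarrow> x \<in> K"
    using convex_body_in_ball[OF K] by metis
  obtain B where B: "continuous_on UNIV B" "bij_betw B E E"
    "\<And>x. x \<in> E \<Longrightarrow> B (A x) = x" "\<And>x. x \<in> E \<Longrightarrow> A (B x) = x"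
    using inverse_on_E[OF A] by metis
  let ?U = "{y. dist (B (y - v)) p < e}"
  show ?thesis
  proof (rule convex_body_inI)
    show "(\<lambda>x. A x + v) ` K \<subseteq> E"
      using K'(2) linear_in_E[OF A(2)] v subspace_add[OF subspace_E] by auto
    show "compact ((\<lambda>x. A x + v) ` K)" by (rule compact_affine_image[OF A(1) K'(1,2)])
    have "(\<lambda>x. A x + v) ` K = (\<lambda>x. v + x) ` (A ` K)" by (simp add: image_image add.commute)
    then show "convex ((\<lambda>x. A x + v) ` K)"
      using convex_translation[OF convex_linear_image[OF A(1) K'(3)], of v] by simp
    have "continuous_on UNIV (\<lambda>y. B (y - v))"
      by (rule continuous_on_compose2[OF B(1)]) (auto intro: continuous_intros)
    then show "open ?U" by (intro open_Collect_less continuous_intros)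
    show "E \<inter> ?U \<subseteq> (\<lambda>x. A x + v) ` K"
    proof
      fix y assume y: "y \<in> E \<inter> ?U"
      then have yv: "y - v \<in> E" using v subspace_diff[OF subspace_E] by auto
      have "B (y - v) \<in> K" using y linear_in_E[OF B(2) yv] p(3) by auto
      moreover have "y = A (B (y - v)) + v" using B(4)[OF yv] by simp
      ultimately show "y \<in> (\<lambda>x. A x + v) ` K" by blast
    qed
    show "A p + v \<in> E \<inter> ?U"
      using linear_in_E[OF A(2) p(1)] v subspace_add[OF subspace_E] p B(3) by auto
  qed
qed

lemma measure_convex_body_pos:
  assumes K: "convex_body_in E K" shows "measure (vol E) K > 0"
proof -
  obtain p e where p: "p \<in> E" "e > 0" "\<And>x. x \<in> E \<Longrightarrow> dist x p < e \<Longrightarrow> x \<in> K"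
    using convex_body_in_ball[OF K] by metis
  have "compact K" using K by (simp add: convex_body_in_def)
  then have "set_integrable (vol E) K (\<lambda>_. 1 :: real)" and "K \<in> sets borel"
    by (auto intro: set_integrable_compact borel_closed compact_imp_closed)
  moreover from this have "(LINT x:K|vol E. (1::real)) > 0"
    using p by (intro LINT_pos[of K "\<lambda>_. 1" p e 1]) auto
  ultimately show ?thesis by (simp add: LINT_one)
qed

lemma second_moment_pos:
  assumes K: "convex_body_in E K" and \<theta>: "\<theta> \<in> E" "\<theta> \<noteq> 0"
  shows "(LINT x:K|vol E. ((x - c) \<bullet> \<theta>)\<^sup>2) > 0"
proof -
  obtain p e where p: "p \<in> E" "e > 0" "\<And>x. x \<in> E \<Longrightarrow> dist x p < e \<Longrightarrow> x \<in> K"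
    using convex_body_in_ball[OF K] by metis
  have n: "norm \<theta> > 0" using \<theta> by simp
  \<comment> \<open>A point off the hyperplane where the integrand vanishes: if \<open>p\<close>
    lies on that hyperplane, move by \<open>e / 2\<close> along \<theta>, which stays inside the
    ball around \<open>p\<close>.\<close>
  define p' where "p' = (if (p - c) \<bullet> \<theta> \<noteq> 0 then p else p + (e / (2 * norm \<theta>)) *\<^sub>R \<theta>)"
  have p': "p' \<in> E" "dist p' p \<le> e / 2"
    using p \<theta> n subspace_add[OF subspace_E] subspace_scale[OF subspace_E]
    by (auto simp: p'_def dist_norm)
  define s where "s = \<bar>(p' - c) \<bullet> \<theta>\<bar>"
  have s: "s > 0"
    using n p(2) \<theta> by (auto simp: s_def p'_def inner_diff_left inner_add_left)
  define e' where "e' = min (e / 2) (s / (2 * norm \<theta>))"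
  show ?thesis
  proof (rule LINT_pos)
    show "set_integrable (vol E) K (\<lambda>x. ((x - c) \<bullet> \<theta>)\<^sup>2)"
      using K by (intro set_integrable_compact continuous_intros) (simp add: convex_body_in_def)
    show "e' > 0" using p(2) s n by (simp add: e'_def)
    show "(s / 2)\<^sup>2 > 0" using s by simp
    fix x assume x: "x \<in> E" "dist x p' < e'"
    then have "dist x p < e" using dist_triangle[of x p p'] p'(2) by (simp add: e'_def)
    moreover have "\<bar>(x - p') \<bullet> \<theta>\<bar> \<le> s / 2"
    proof -
      have "\<bar>(x - p') \<bullet> \<theta>\<bar> \<le> norm (x - p') * norm \<theta>" by (rule Cauchy_Schwarz_ineq2)
      also have "\<dots> \<le> (s / (2 * norm \<theta>)) * norm \<theta>"
        using x by (intro mult_right_mono) (auto simp: e'_def dist_norm)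
      finally show ?thesis using n by simp
    qed
    then have "\<bar>(x - c) \<bullet> \<theta>\<bar> \<ge> s / 2"
    proof -
      have "(x - c) \<bullet> \<theta> = (x - p') \<bullet> \<theta> + (p' - c) \<bullet> \<theta>" by (simp add: inner_diff_left)
      with \<open>\<bar>(x - p') \<bullet> \<theta>\<bar> \<le> s / 2\<close> show ?thesis unfolding s_def by linarith
    qed
    then have "\<bar>(x - c) \<bullet> \<theta>\<bar>\<^sup>2 \<ge> (s / 2)\<^sup>2" using s by (intro power_mono) auto
    ultimately show "x \<in> K \<and> (s / 2)\<^sup>2 \<le> ((x - c) \<bullet> \<theta>)\<^sup>2" using p(3) x by simp
  qed (use p' in auto)
qed

text \<open>Whitening: centre the body, take a basis \<open>t\<close> orthonormal for its covariance
  form \<open>q\<close>, and let \<open>A\<close> send x to the point with coordinates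
  \<open>x \<bullet> t i\<close>. The covariance form of the image is then the inner product of
  \<open>E\<close>, and a dilation normalises the volume.\<close>

lemma isotropic_exists:
  assumes d: "d > 0" and K: "convex_body_in E K"
  shows "\<exists>K1\<in>affine_images E K. \<exists>L. isotropic E K1 L"
proof -
  have K': "compact K" "K \<subseteq> E" using K by (auto simp: convex_body_in_def)
  define V where "V = measure (vol E) K"
  have V: "V > 0" using measure_convex_body_pos[OF K] by (simp add: V_def)
  define c where "c = lincomb d b (\<lambda>i. (LINT x:K|vol E. x \<bullet> b i) / V)"
  have cE: "c \<in> E" by (simp add: c_def lincomb_in_E)
  note int = set_integrable_compact[OF K'(1)]
  have cent: "(LINT x:K|vol E. (x - c) \<bullet> \<theta>) = 0" if "\<theta> \<in> E" for \<theta>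
  proof -
    have "x \<bullet> \<theta> = (\<Sum>i<d. (\<theta> \<bullet> b i) * (x \<bullet> b i))" for x
      using parseval[OF that, of x] by (simp add: inner_commute)
    then have "(LINT x:K|vol E. x \<bullet> \<theta>) = (LINT x:K|vol E. \<Sum>i<d. (\<theta> \<bullet> b i) * (x \<bullet> b i))"
      by simp
    also have "\<dots> = (\<Sum>i<d. (\<theta> \<bullet> b i) * (LINT x:K|vol E. x \<bullet> b i))"
      by (subst LINT_sum) (auto intro!: int continuous_intros)
    also have "\<dots> = V * (c \<bullet> \<theta>)"
      using V by (simp add: c_def lincomb_def inner_sum_left inner_sum_right sum_distrib_left
          inner_commute mult.commute)
    finally have 1: "(LINT x:K|vol E. x \<bullet> \<theta>) = V * (c \<bullet> \<theta>)" .
    have "(LINT x:K|vol E. (x - c) \<bullet> \<theta>) = (LINT x:K|vol E. x \<bullet> \<theta>) - (LINT x:K|vol E. c \<bullet> \<theta>)"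
      unfolding inner_diff_left by (intro set_integral_diff int continuous_intros)
    also have "(LINT x:K|vol E. c \<bullet> \<theta>) = V * (c \<bullet> \<theta>)"
      using K'(1) by (simp add: set_lebesgue_integral_def V_def compact_imp_closed borel_closed)
    finally show ?thesis using 1 by simp
  qed
  define q where "q \<theta> \<eta> = (LINT x:K|vol E. ((x - c) \<bullet> \<theta>) * ((x - c) \<bullet> \<eta>))" for \<theta> \<eta>
  have q_sym: "q \<theta> \<eta> = q \<eta> \<theta>" for \<theta> \<eta> by (simp add: q_def mult.commute)
  have q_lin: "linear (\<lambda>\<theta>. q \<theta> \<eta>)" for \<eta>
  proof (rule linearI)
    fix x y show "q (x + y) \<eta> = q x \<eta> + q y \<eta>"
      unfolding q_def inner_add_right distrib_right
      by (intro set_integral_add int continuous_intros)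
  next
    fix r x show "q (r *\<^sub>R x) \<eta> = r *\<^sub>R q x \<eta>"
      unfolding q_def by (simp add: mult.assoc)
  qed
  have q_pos: "q \<theta> \<theta> > 0" if "\<theta> \<in> E" "\<theta> \<noteq> 0" for \<theta>
    using second_moment_pos[OF K that, of c] by (simp add: q_def power2_eq_square)
  have "\<exists>t. (\<forall>i<d. \<forall>j<d. q (t i) (t j) = (if i = j then 1 else 0)) \<and> span (t ` {..<d}) = E"
    by (rule gram_schmidt[OF subspace_E _ _ q_sym q_lin q_pos, of "b ` {..<d}"])
      (simp_all add: span_b)
  then obtain t where t0: "\<forall>i<d. \<forall>j<d. q (t i) (t j) = (if i = j then 1 else 0)"
    "span (t ` {..<d}) = E" by blast
  note t = t0(1)[rule_format] t0(2)
  have tE: "t i \<in> E" if "i < d" for i using t(2) span_base[of "t i" "t ` {..<d}"] that by auto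
  define A where "A x = lincomb d b (\<lambda>i. x \<bullet> t i)" for x
  have lin: "linear A"
    by (rule linearI) (simp_all add: A_def lincomb_def inner_add_left scaleR_add_left sum.distrib
      scaleR_sum_right)
  have AE: "A x \<in> E" for x by (simp add: A_def lincomb_in_E)
  have "inj_on A E"
  proof (rule inj_onI)
    fix x y assume xy: "x \<in> E" "y \<in> E" "A x = A y"
    let ?z = "x - y"
    have "A ?z = 0" using xy by (simp add: linear_diff[OF lin])
    then have z: "?z \<bullet> t i = 0" if "i < d" for i
      using inner_lincomb[OF that, of "\<lambda>i. ?z \<bullet> t i"] by (simp add: A_def)
    have "?z \<in> span (t ` {..<d})" using xy subspace_diff[OF subspace_E] t(2) by auto
    then obtain a where a: "?z = lincomb d t a" by (auto simp: span_eq_lincomb)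
    have "?z \<bullet> ?z = ?z \<bullet> lincomb d t a" using a by simp
    also have "\<dots> = 0" using z by (simp add: lincomb_def inner_sum_right)
    finally show "x = y" by simp
  qed
  moreover have "E \<subseteq> A ` E"
  proof
    fix z assume z: "z \<in> E"
    \<comment> \<open>\<open>y j\<close> represents the functional \<open>q (t j)\<close> on
      \<open>E\<close>. These vectors are dual to the \<open>t i\<close>, and so provide preimages
      under \<open>A\<close>.\<close>
    define y where "y j = lincomb d b (\<lambda>i. q (t j) (b i))" for j
    have y: "y j \<bullet> \<eta> = q (t j) \<eta>" if "\<eta> \<in> E" for j \<eta>
    proof -
      have "q (t j) \<eta> = q (P \<eta>) (t j)" using P_id[OF that] by (simp add: q_sym)
      also have "\<dots> = (\<Sum>i<d. (\<eta> \<bullet> b i) * q (b i) (t j))"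
        by (simp add: P_def linear_sum[OF q_lin] linear_scale[OF q_lin])
      finally show ?thesis
        by (simp add: y_def lincomb_def inner_sum_left inner_sum_right inner_commute q_sym
            mult.commute)
    qed
    define x where "x = (\<Sum>j<d. (z \<bullet> b j) *\<^sub>R y j)"
    have "x \<bullet> t i = z \<bullet> b i" if "i < d" for i
    proof -
      have "x \<bullet> t i = (\<Sum>j<d. (z \<bullet> b j) * q (t j) (t i))"
        by (simp add: x_def inner_sum_left y[OF tE[OF that]])
      also have "\<dots> = (\<Sum>j<d. if j = i then z \<bullet> b j else 0)"
        by (rule sum.cong) (use t(1) that in auto)
      finally show ?thesis using that by simp
    qed
    then have "A x = P z" by (simp add: A_def P_eq_lincomb lincomb_def)
    moreover have "x \<in> E" unfolding x_def y_def
      by (intro subspace_sum subspace_scale subspace_E lincomb_in_E)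
    ultimately show "z \<in> A ` E" using P_id[OF z] by force
  qed
  ultimately have bij: "bij_betw A E E" using AE by (auto simp: bij_betw_def)
  obtain k where k: "vol_factor A k" using vol_factor_exists[OF lin bij] ..
  then have k0: "k > 0" by (simp add: vol_factor_def)
  \<comment> \<open>The image under \<open>A\<close> has volume \<open>k * V\<close>, and dilation
    by \<open>s\<close> makes it 1.\<close>
  define s where "s = root d (1 / (k * V))"
  have s: "s > 0" "s ^ d = 1 / (k * V)" using d k0 V by (simp_all add: s_def)
  let ?w = "- A c"
  have wE: "?w \<in> E" using AE subspace_neg[OF subspace_E] by blast
  define K0 where "K0 = (\<lambda>x. A x + ?w) ` K"
  define K1 where "K1 = (\<lambda>x. s *\<^sub>R x + 0) ` K0"
  note S = vol_factor_scaleR[OF s(1)]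
  have Slin: "linear (\<lambda>x. s *\<^sub>R x)" "bij_betw (\<lambda>x. s *\<^sub>R x) E E"
    using S by (auto simp: vol_factor_def)
  have cb0: "convex_body_in E K0" unfolding K0_def by (rule convex_body_in_affine[OF K lin bij wE])
  then have K0: "compact K0" "K0 \<subseteq> E" by (auto simp: convex_body_in_def)
  have cb1: "convex_body_in E K1"
    unfolding K1_def by (rule convex_body_in_affine[OF cb0 Slin subspace_0[OF subspace_E]])
  have img: "K1 \<in> affine_images E K"
  proof (rule affine_images_trans)
    show "K0 \<in> affine_images E K" unfolding affine_images_def K0_def using lin bij wE by blast
    show "K1 \<in> affine_images E K0" unfolding affine_images_def K1_def
      using Slin subspace_0[OF subspace_E] by blast
  qed
  have "measure (vol E) K1 = s ^ d * (k * V)"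
    unfolding K1_def measure_affine_image[OF S subspace_0[OF subspace_E] K0]
    unfolding K0_def measure_affine_image[OF k wE K'] V_def ..
  then have m1: "measure (vol E) K1 = 1" using s k0 V by simp
  \<comment> \<open>The adjoint of \<open>A\<close>; it moves test vectors from the image back to
    \<open>K\<close>.\<close>
  define \<tau> where "\<tau> \<eta> = (\<Sum>i<d. (b i \<bullet> \<eta>) *\<^sub>R t i)" for \<eta>
  have \<tau>E: "\<tau> \<eta> \<in> E" for \<eta>
    unfolding \<tau>_def using tE by (intro subspace_sum subspace_scale subspace_E) auto
  have inner: "(s *\<^sub>R P (A (P x) + ?w) + 0) \<bullet> \<eta> = s * ((x - c) \<bullet> \<tau> \<eta>)" for x \<eta>
  proof -
    have "A (P x) + ?w = A (P x - c)" by (simp add: linear_diff[OF lin])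
    then have "P (A (P x) + ?w) = A (P x - c)" using P_id[OF AE] by simp
    moreover have "(P x - c) \<bullet> t i = (x - c) \<bullet> t i" if "i < d" for i
      using inner_P[OF tE[OF that]] by (simp add: inner_diff_left)
    then have "A (P x - c) \<bullet> \<eta> = (x - c) \<bullet> \<tau> \<eta>"
      by (simp add: A_def lincomb_def \<tau>_def inner_sum_left inner_sum_right mult.commute)
    ultimately show ?thesis by simp
  qed
  have LINT1: "(LINT x:K1|vol E. f x) =
      1 / V * (LINT x:K|vol E. f (s *\<^sub>R P (A (P x) + ?w) + 0))"
    if f: "f \<in> borel_measurable borel" for f :: "'a \<Rightarrow> real"
  proof -
    have "(\<lambda>x. f (s *\<^sub>R P x + 0)) \<in> borel_measurable borel"
      using measurable_compose[OF borel_measurable_linear_P[OF Slin(1), of 0] f] .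
    then have "(LINT x:K1|vol E. f x) = s ^ d * (k *
        (LINT x:K|vol E. f (s *\<^sub>R P (A (P x) + ?w) + 0)))"
      unfolding K1_def LINT_affine_image[OF S subspace_0[OF subspace_E] K0 f]
      unfolding K0_def by (subst LINT_affine_image[OF k wE K']) auto
    also have "s ^ d * (k * (LINT x:K|vol E. f (s *\<^sub>R P (A (P x) + ?w) + 0))) =
        (s ^ d * k) * (LINT x:K|vol E. f (s *\<^sub>R P (A (P x) + ?w) + 0))" by simp
    also have "s ^ d * k = 1 / V" using s k0 V by simp
    finally show ?thesis .
  qed
  have "is_barycenter E K1 0"
    unfolding is_barycenter_def
  proof (intro conjI ballI subspace_0[OF subspace_E])
    fix \<theta> assume "\<theta> \<in> E"
    have "(LINT x:K1|vol E. x \<bullet> \<theta>) = 1 / V * (LINT x:K|vol E. s * ((x - c) \<bullet> \<tau> \<theta>))"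
      by (subst LINT1) (simp_all only: inner borel_measurable_inner)
    then show "0 \<bullet> \<theta> = (LINT x:K1|vol E. x \<bullet> \<theta>) / measure (vol E) K1"
      using cent[OF \<tau>E] by simp
  qed
  \<comment> \<open>\<open>\<tau> \<theta>\<close> is a unit vector for \<open>q\<close>, because
    its coordinates in the \<open>q\<close>-orthonormal basis \<open>t\<close> are those of \<theta>
    in \<open>b\<close>. The factor 1/V appears because \<open>q\<close> is an integral over
    \<open>K\<close> that is not normalised by volume.\<close>
  moreover have "(LINT x:K1|vol E. (x \<bullet> \<theta>)\<^sup>2) = (s / sqrt V)\<^sup>2" if \<theta>: "\<theta> \<in> E" "norm \<theta> = 1" for \<theta>
  proof -
    have qt: "q (\<tau> \<theta>) \<eta> = (\<Sum>j<d. (b j \<bullet> \<theta>) * q (t j) \<eta>)" for \<eta>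
      by (simp add: \<tau>_def linear_sum[OF q_lin] linear_scale[OF q_lin])
    have "(LINT x:K1|vol E. (x \<bullet> \<theta>)\<^sup>2) = 1 / V * (LINT x:K|vol E. (s * ((x - c) \<bullet> \<tau> \<theta>))\<^sup>2)"
      by (subst LINT1) (simp_all only: inner borel_measurable_inner borel_measurable_power)
    also have "\<dots> = s\<^sup>2 / V * q (\<tau> \<theta>) (\<tau> \<theta>)"
      by (simp add: q_def power_mult_distrib) (simp add: power2_eq_square)
    also have "q (\<tau> \<theta>) (\<tau> \<theta>) = (\<Sum>i<d. (b i \<bullet> \<theta>) * q (\<tau> \<theta>) (t i))"
      unfolding qt[of "\<tau> \<theta>"]
      by (intro sum.cong refl arg_cong2[of _ _ _ _ times] q_sym)
    also have "\<dots> = (\<Sum>i<d. (b i \<bullet> \<theta>)\<^sup>2)"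
    proof (rule sum.cong)
      fix i assume i: "i \<in> {..<d}"
      have "q (\<tau> \<theta>) (t i) = (\<Sum>j<d. (b j \<bullet> \<theta>) * q (t j) (t i))"
        by (rule qt)
      also have "\<dots> = (\<Sum>j<d. if j = i then b j \<bullet> \<theta> else 0)"
        by (rule sum.cong) (use t(1) i in auto)
      finally show "(b i \<bullet> \<theta>) * q (\<tau> \<theta>) (t i) = (b i \<bullet> \<theta>)\<^sup>2"
        using i by (simp add: power2_eq_square)
    qed simp
    also have "\<dots> = 1" using parseval_norm[OF \<theta>(1)] \<theta>(2) by (simp add: inner_commute)
    finally show ?thesis using V by (simp add: power_divide)
  qed
  ultimately have "isotropic E K1 (s / sqrt V)"
    using cb1 m1 s V by (simp add: isotropic_def)
  with img show ?thesis by blast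
qed

text \<open>The form in which the moment inequality is used: \<rho> is any lower bound for the
  \<open>d\<close>-th root of the volume, and the point \<open>p\<close> is free, so the barycenter
  of \<open>K\<close> need not be computed.\<close>

lemma isotropy_const_le:
  fixes \<rho> c :: real
  assumes d: "d > 0" and K: "convex_body_in E K" and c: "c \<ge> 0"
    and \<rho>: "\<rho> > 0" "\<rho> ^ d \<le> measure (vol E) K"
    and le: "(LINT x:K|vol E. (norm (x - p))\<^sup>2) \<le> d * \<rho>\<^sup>2 * c\<^sup>2 * measure (vol E) K"
  shows "isotropy_const E K \<le> c"
proof -
  have KE: "K \<subseteq> E" using K by (simp add: convex_body_in_def)
  obtain K1 L where K1: "K1 \<in> affine_images E K" "isotropic E K1 L"
    using isotropic_exists[OF d K] by blast
  have K1E: "K1 \<subseteq> E" using K1(2) by (simp add: isotropic_def convex_body_in_def)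
  have "isotropy_const E K = L"
    unfolding isotropy_const_def
  proof (rule the_equality)
    fix L' assume "\<exists>K1\<in>affine_images E K. isotropic E K1 L'"
    then obtain K2 where K2: "K2 \<in> affine_images E K" "isotropic E K2 L'" by blast
    have "K2 \<in> affine_images E K1"
      using affine_images_trans[OF affine_images_sym[OF KE K1(1)] K2(1)] .
    from isotropic_le[OF d K1(2) K2(2) this] isotropic_le[OF d K2(2) K1(2)
        affine_images_sym[OF K1E this]]
    show "L' = L" by simp
  qed (use K1 in blast)
  moreover have "d * \<rho>\<^sup>2 * L\<^sup>2 * measure (vol E) K \<le> d * \<rho>\<^sup>2 * c\<^sup>2 * measure (vol E) K"
    using isotropic_affine_bound[OF d K1(2) affine_images_sym[OF KE K1(1)] \<rho>, of p] le by simp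
  then have "L\<^sup>2 \<le> c\<^sup>2"
    using d \<rho>(1) measure_convex_body_pos[OF K] by simp
  then have "L \<le> c" using c by (rule power2_le_imp_le)
  ultimately show ?thesis by simp
qed

end

section \<open>Barycentric coordinates of polytopes\<close>

text \<open>Weights are functions on all of \<nat> that vanish from \<open>N\<close> on. This makes
  them unique as functions and the simplex compact in the product topology.\<close>

definition std_simplex :: "nat \<Rightarrow> (nat \<Rightarrow> real) set"
  where "std_simplex N = {c. (\<forall>i. 0 \<le> c i) \<and> (\<forall>i\<ge>N. c i = 0) \<and> (\<Sum>i<N. c i) = 1}"

lemma std_simplex_le_1: "c \<in> std_simplex N \<Longrightarrow> c i \<le> 1"
proof (cases "i < N")
  case True
  assume "c \<in> std_simplex N"
  then show ?thesis
    using member_le_sum[of i "{..<N}" c] True by (auto simp: std_simplex_def)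
qed (simp add: std_simplex_def)

lemma closed_coord_le: "closed {c :: nat \<Rightarrow> real. r \<le> c i}"
  by (intro closed_Collect_le continuous_on_const continuous_on_product_coordinates)

lemma closed_coord_eq: "closed {c :: nat \<Rightarrow> real. c i = r}"
  by (intro closed_Collect_eq continuous_on_const continuous_on_product_coordinates)

lemma compact_std_simplex: "compact (std_simplex N)"
proof -
  let ?B = "PiE UNIV (\<lambda>i. if i < N then {0..1} else {0 :: real})"
  have "compactin (product_topology (\<lambda>_. euclidean) UNIV) ?B"
    by (subst compactin_PiE) auto
  then have "compact ?B" by (simp add: euclidean_product_topology)
  moreover have "closed {c :: nat \<Rightarrow> real. (\<Sum>i<N. c i) = 1}"
    by (intro closed_Collect_eq continuous_on_sum continuous_on_const
        continuous_on_product_coordinates)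
  ultimately have "compact (?B \<inter> {c. (\<Sum>i<N. c i) = 1})" by (rule compact_Int_closed)
  moreover have "?B \<inter> {c. (\<Sum>i<N. c i) = 1} = std_simplex N"
  proof (intro set_eqI iffI)
    fix c assume c: "c \<in> ?B \<inter> {c. (\<Sum>i<N. c i) = 1}"
    then have ci: "c i \<in> (if i < N then {0..1} else {0})" for i
      by (simp only: PiE_iff Int_iff) blast
    have "0 \<le> c i" for i using ci[of i] by (simp split: if_splits)
    moreover have "c i = 0" if "i \<ge> N" for i using ci[of i] that by simp
    ultimately show "c \<in> std_simplex N" using c by (simp add: std_simplex_def)
  next
    fix c assume c: "c \<in> std_simplex N"
    then have "c i \<in> (if i < N then {0..1} else {0})" for i
      using std_simplex_le_1[OF c, of i] by (auto simp: std_simplex_def)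
    then show "c \<in> ?B \<inter> {c. (\<Sum>i<N. c i) = 1}" using c by (auto simp: std_simplex_def)
  qed
  ultimately show ?thesis by simp
qed

lemma continuous_on_lincomb:
  fixes u :: "nat \<Rightarrow> 'a::real_normed_vector"
  shows "continuous_on S (lincomb N u)"
proof -
  have "continuous_on UNIV (lincomb N u)"
    unfolding lincomb_def[abs_def]
    by (intro continuous_on_sum continuous_on_scaleR continuous_on_const
        continuous_on_product_coordinates)
  then show ?thesis by (rule continuous_on_subset) simp
qed

text \<open>Maximise one coordinate at a time, each time on the compact slice where the earlier
  coordinates already have their chosen values.\<close>

lemma lex_max_exists:
  fixes F :: "(nat \<Rightarrow> real) set"
  assumes F: "compact F" "F \<noteq> {}"
  shows "\<exists>c\<in>F. \<forall>c'\<in>F. \<forall>k<N. (\<forall>i<k. c' i = c i) \<longrightarrow> c' k \<le> c k"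
proof (induction N)
  case 0
  then show ?case using F by auto
next
  case (Suc N)
  then obtain c where c: "c \<in> F"
    "\<And>c' k. c' \<in> F \<Longrightarrow> k < N \<Longrightarrow> (\<forall>i<k. c' i = c i) \<Longrightarrow> c' k \<le> c k" by blast
  let ?G = "F \<inter> (\<Inter>i\<in>{..<N}. {c'. c' i = c i})"
  have "compact ?G"
    by (intro compact_Int_closed F closed_INT ballI closed_coord_eq)
  moreover have "?G \<noteq> {}" using c by blast
  moreover have "continuous_on ?G (\<lambda>c'. c' N)"
    by (rule continuous_on_subset[OF continuous_on_product_coordinates]) simp
  ultimately obtain a where a: "a \<in> ?G" "\<And>c'. c' \<in> ?G \<Longrightarrow> c' N \<le> a N"
    using continuous_attains_sup[of ?G "\<lambda>c'. c' N"] by blast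
  have "c' k \<le> a k" if "c' \<in> F" "k < Suc N" and eq: "\<forall>i<k. c' i = a i" for c' k
  proof (cases "k = N")
    case True
    then show ?thesis using a that by auto
  next
    case False
    then have "k < N" using that by simp
    moreover have "\<forall>i<k. c' i = c i" using a(1) eq calculation by auto
    ultimately show ?thesis using c(2)[OF that(1)] a(1) by force
  qed
  then show ?case using a(1) by blast
qed

definition polytope_of :: "nat \<Rightarrow> (nat \<Rightarrow> 'a::real_vector) \<Rightarrow> 'a set"
  where "polytope_of N u = lincomb N u ` std_simplex N"

text \<open>
  The lexicographically largest convex combination representing a given point. It plays the role of
  the barycentric coordinates in a triangulation that uses no new vertices: by
  \<open>lex_coords_support\<close> below, being lexicographically largest depends on the support only.
\<close>

definition lex_coords :: "nat \<Rightarrow> (nat \<Rightarrow> 'a::real_vector) \<Rightarrow> (nat \<Rightarrow> real) \<Rightarrow> bool"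
  where "lex_coords N u c \<longleftrightarrow> c \<in> std_simplex N \<and>
    (\<forall>c'\<in>std_simplex N. lincomb N u c' = lincomb N u c \<longrightarrow>
      (\<forall>k<N. (\<forall>i<k. c' i = c i) \<longrightarrow> c' k \<le> c k))"

lemma lex_coords_exists:
  fixes u :: "nat \<Rightarrow> 'a::real_normed_vector"
  assumes "x \<in> polytope_of N u"
  shows "\<exists>c. lex_coords N u c \<and> lincomb N u c = x"
proof -
  let ?F = "std_simplex N \<inter> {c. lincomb N u c = x}"
  have "compact ?F"
    by (intro compact_Int_closed compact_std_simplex closed_Collect_eq continuous_on_lincomb
        continuous_on_const)
  moreover have "?F \<noteq> {}" using assms by (auto simp: polytope_of_def)
  ultimately obtain c where "c \<in> ?F"
    "\<forall>c'\<in>?F. \<forall>k<N. (\<forall>i<k. c' i = c i) \<longrightarrow> c' k \<le> c k"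
    using lex_max_exists[of ?F N] by blast
  then show ?thesis by (intro exI[of _ c]) (auto simp: lex_coords_def)
qed

lemma lex_coords_unique:
  assumes "lex_coords N u c" "lex_coords N u c'" "lincomb N u c = lincomb N u c'"
  shows "c = c'"
proof
  fix i
  show "c i = c' i"
  proof (cases "i < N")
    case True
    then show ?thesis
    proof (induction i rule: less_induct)
      case (less i)
      then have "\<forall>j<i. c j = c' j" by simp
      then have "c i \<le> c' i" "c' i \<le> c i"
        using assms less.prems by (simp_all add: lex_coords_def)
      then show ?case by simp
    qed
  next
    case False
    then show ?thesis using assms by (simp add: lex_coords_def std_simplex_def)
  qed
qed

text \<open>If some \<open>a\<close> represents the same point as \<open>c'\<close> and beats it
  lexicographically, then \<open>c + e (a - c')\<close> represents the same point as
  \<open>c\<close> and beats \<open>c\<close>. For small \<open>e\<close> its weights stay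
  nonnegative, because \<open>c'\<close> is positive only where \<open>c\<close> is.\<close>

lemma lex_coords_support:
  assumes c: "lex_coords N u c" and c': "c' \<in> std_simplex N" and supp: "\<And>i. c i = 0 \<Longrightarrow> c' i = 0"
  shows "lex_coords N u c'"
  unfolding lex_coords_def
proof (intro conjI c' ballI impI allI)
  fix a k assume a: "a \<in> std_simplex N" "lincomb N u a = lincomb N u c'"
    and k: "k < N" and eq: "\<forall>i<k. a i = c' i"
  show "a k \<le> c' k"
  proof (rule ccontr)
    assume gt: "\<not> a k \<le> c' k"
    have cN: "c \<in> std_simplex N" using c by (simp add: lex_coords_def)
    let ?S = "{i. i < N \<and> c i > 0}"
    \<comment> \<open>At most every positive weight of \<open>c\<close>, so that subtracting
      \<open>e * c' i \<le> e\<close> leaves such a weight nonnegative.\<close>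
    define e where "e = Min (insert 1 (c ` ?S))"
    have fin: "finite (insert 1 (c ` ?S))" by simp
    have e: "e > 0" unfolding e_def using fin by (subst Min_gr_iff) auto
    have ec: "e \<le> c i" if "c i > 0" for i
    proof -
      have "i < N" using that cN by (cases "i < N") (auto simp: std_simplex_def)
      then show ?thesis unfolding e_def using fin that by (intro Min_le) auto
    qed
    define a' where "a' i = c i + e * (a i - c' i)" for i
    have "a' \<in> std_simplex N"
      unfolding std_simplex_def
    proof (intro CollectI conjI allI impI)
      fix i
      show "0 \<le> a' i"
      proof (cases "c i = 0")
        case True
        then show ?thesis using supp[of i] e a(1) by (simp add: a'_def std_simplex_def)
      next
        case False
        moreover have "0 \<le> c i" using cN by (simp add: std_simplex_def)
        ultimately have "c i > 0" by simp
        moreover have "e * c' i \<le> e * 1" using std_simplex_le_1[OF c', of i] e by (intro mult_left_mono) auto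
        moreover have "0 \<le> e * a i" using e a(1) by (simp add: std_simplex_def)
        ultimately show ?thesis using ec[of i] by (simp add: a'_def right_diff_distrib)
      qed
      show "a' i = 0" if "i \<ge> N"
        using that a(1) c' cN by (simp add: a'_def std_simplex_def)
    next
      have "(\<Sum>i<N. a' i) = (\<Sum>i<N. c i) + e * ((\<Sum>i<N. a i) - (\<Sum>i<N. c' i))"
        by (simp add: a'_def sum.distrib sum_distrib_left[symmetric] sum_subtractf)
      then show "(\<Sum>i<N. a' i) = 1" using a(1) c' cN by (simp add: std_simplex_def)
    qed
    moreover have "lincomb N u a' = lincomb N u c + e *\<^sub>R (lincomb N u a - lincomb N u c')"
      by (simp add: a'_def lincomb_def scaleR_add_left scaleR_diff_left sum.distrib sum_subtractf
          scaleR_sum_right scaleR_diff_right right_diff_distrib)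
    then have "lincomb N u a' = lincomb N u c" using a(2) by simp
    moreover have "\<forall>i<k. a' i = c i" using eq by (simp add: a'_def)
    ultimately have "a' k \<le> c k" using c k by (simp add: lex_coords_def)
    then show False using gt e by (simp add: a'_def mult_le_0_iff)
  qed
qed

definition bary :: "nat \<Rightarrow> (nat \<Rightarrow> 'a::real_vector) \<Rightarrow> nat \<Rightarrow> 'a \<Rightarrow> real"
  where "bary N u j x =
    (if x \<in> polytope_of N u then (THE c. lex_coords N u c \<and> lincomb N u c = x) j else 0)"

lemma bary_lincomb:
  assumes "lex_coords N u c"
  shows "bary N u j (lincomb N u c) = c j"
proof -
  have "(THE c'. lex_coords N u c' \<and> lincomb N u c' = lincomb N u c) = c"
    using assms lex_coords_unique by (intro the_equality) auto
  moreover have "lincomb N u c \<in> polytope_of N u"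
    using assms by (auto simp: polytope_of_def lex_coords_def)
  ultimately show ?thesis by (simp add: bary_def)
qed

lemma bary_props:
  fixes u :: "nat \<Rightarrow> 'a::real_normed_vector"
  assumes "x \<in> polytope_of N u"
  shows "lex_coords N u (\<lambda>j. bary N u j x)" "lincomb N u (\<lambda>j. bary N u j x) = x"
proof -
  obtain c where c: "lex_coords N u c" "lincomb N u c = x" using lex_coords_exists[OF assms] by blast
  then have "(\<lambda>j. bary N u j x) = c" using bary_lincomb[OF c(1)] by auto
  with c show "lex_coords N u (\<lambda>j. bary N u j x)" "lincomb N u (\<lambda>j. bary N u j x) = x" by simp_all
qed

lemma bary_in_simplex:
  fixes u :: "nat \<Rightarrow> 'a::real_normed_vector"
  shows "x \<in> polytope_of N u \<Longrightarrow> (\<lambda>j. bary N u j x) \<in> std_simplex N"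
  using bary_props by (auto simp: lex_coords_def)

lemma bary_bounds:
  fixes u :: "nat \<Rightarrow> 'a::real_normed_vector"
  shows "0 \<le> bary N u j x" "bary N u j x \<le> 1"
proof -
  have "0 \<le> bary N u j x \<and> bary N u j x \<le> 1"
  proof (cases "x \<in> polytope_of N u")
    case True
    note S = bary_in_simplex[OF True]
    show ?thesis using S std_simplex_le_1[OF S, of j] by (simp add: std_simplex_def)
  qed (simp add: bary_def)
  then show "0 \<le> bary N u j x" "bary N u j x \<le> 1" by simp_all
qed

lemma compact_polytope_of:
  fixes u :: "nat \<Rightarrow> 'a::real_normed_vector"
  shows "compact (polytope_of N u)"
  unfolding polytope_of_def
  by (intro compact_continuous_image continuous_on_lincomb compact_std_simplex)

text \<open>For \<open>r > 0\<close> the set where the coordinate is at least \<open>r\<close> is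
  closed. It is a finite union, over the supports \<open>J\<close> of lexicographic representations,
  of images of the compact sets of weights vanishing off \<open>J\<close>; by
  \<open>lex_coords_support\<close> all those weights are lexicographically largest too.\<close>

lemma bary_measurable:
  fixes u :: "nat \<Rightarrow> 'a::real_normed_vector"
  shows "bary N u j \<in> borel_measurable borel"
  unfolding borel_measurable_iff_ge
proof
  fix r :: real
  show "{x \<in> space borel. r \<le> bary N u j x} \<in> sets borel"
  proof (cases "r \<le> 0")
    case True
    then have "{x \<in> space borel. r \<le> bary N u j x} = UNIV"
      using bary_bounds(1)[of N u j] by (auto intro: order_trans)
    then show ?thesis by simp
  next
    case False
    define \<J> where "\<J> = {J. J \<subseteq> {..<N} \<and> (\<exists>c. lex_coords N u c \<and> {i. c i \<noteq> 0} = J)}"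
    define F where "F J = std_simplex N \<inter> (\<Inter>i\<in>-J. {c. c i = 0}) \<inter> {c. r \<le> c j}" for J
    have "{x. r \<le> bary N u j x} = (\<Union>J\<in>\<J>. lincomb N u ` F J)"
    proof (intro set_eqI iffI)
      fix x assume x: "x \<in> {x. r \<le> bary N u j x}"
      then have P: "x \<in> polytope_of N u" using False by (auto simp: bary_def split: if_splits)
      let ?c = "\<lambda>j. bary N u j x" and ?J = "{i. bary N u i x \<noteq> 0}"
      have "?J \<subseteq> {..<N}" using bary_in_simplex[OF P] by (auto simp: std_simplex_def not_le[symmetric])
      then have "?J \<in> \<J>" unfolding \<J>_def using bary_props(1)[OF P] by blast
      moreover have "?c \<in> F ?J" using bary_in_simplex[OF P] x by (simp add: F_def)
      moreover have "x = lincomb N u ?c" using bary_props(2)[OF P] by simp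
      ultimately show "x \<in> (\<Union>J\<in>\<J>. lincomb N u ` F J)" by blast
    next
      fix x assume "x \<in> (\<Union>J\<in>\<J>. lincomb N u ` F J)"
      then obtain J c c0 where c: "c \<in> F J" "x = lincomb N u c"
        and c0: "lex_coords N u c0" "{i. c0 i \<noteq> 0} = J" by (auto simp: \<J>_def)
      have "lex_coords N u c"
        by (rule lex_coords_support[OF c0(1)]) (use c(1) c0(2) in \<open>auto simp: F_def\<close>)
      then show "x \<in> {x. r \<le> bary N u j x}" using c by (simp add: bary_lincomb F_def)
    qed
    also have "closed \<dots>"
    proof (rule closed_UN)
      show "finite \<J>" by (rule finite_subset[of _ "Pow {..<N}"]) (auto simp: \<J>_def)
      show "\<forall>J\<in>\<J>. closed (lincomb N u ` F J)"
      proof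
        fix J
        have "compact (F J)" unfolding F_def
          by (intro compact_Int_closed compact_std_simplex closed_INT ballI closed_coord_eq closed_coord_le)
        then show "closed (lincomb N u ` F J)"
          by (intro compact_imp_closed compact_continuous_image continuous_on_lincomb)
      qed
    qed
    finally show ?thesis by simp
  qed
qed

text \<open>On the star of \<^term>\<open>u j\<close> the function \<^term>\<open>bary N u j\<close> is affine along rays from
  \<^term>\<open>u j\<close>, as it would be for a triangulation.\<close>

lemma bary_homothety:
  fixes u :: "nat \<Rightarrow> 'a::real_normed_vector"
  assumes \<tau>: "0 \<le> \<tau>" "\<tau> < 1" and j: "j < N"
    and x: "(1 - \<tau>) *\<^sub>R y + \<tau> *\<^sub>R u j \<in> polytope_of N u"
    and gt: "\<tau> < bary N u j ((1 - \<tau>) *\<^sub>R y + \<tau> *\<^sub>R u j)"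
  shows "y \<in> polytope_of N u"
    and "bary N u j ((1 - \<tau>) *\<^sub>R y + \<tau> *\<^sub>R u j) = \<tau> + (1 - \<tau>) * bary N u j y"
proof -
  let ?x = "(1 - \<tau>) *\<^sub>R y + \<tau> *\<^sub>R u j"
  define c where "c i = bary N u i ?x" for i
  have c: "lex_coords N u c" "lincomb N u c = ?x" "c \<in> std_simplex N" "\<tau> < c j"
    using bary_props[OF x] bary_in_simplex[OF x] gt by (simp_all add: c_def[abs_def])
  \<comment> \<open>Remove the share \<tau> of the vertex \<open>u j\<close> and rescale the rest to
    total 1. Since \<open>c j > \<tau> \<ge> 0\<close>, no index outside the support of
    \<open>c\<close> is added.\<close>
  define c' where "c' i = (c i - (if i = j then \<tau> else 0)) / (1 - \<tau>)" for i
  have "(\<Sum>i<N. c' i) = (\<Sum>i<N. c i - (if i = j then \<tau> else 0)) / (1 - \<tau>)"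
    by (simp add: c'_def sum_divide_distrib)
  also have "\<dots> = 1" using c(3) j \<tau> by (simp add: sum_subtractf std_simplex_def)
  finally have c'S: "c' \<in> std_simplex N"
    using c(3,4) \<tau> j by (auto simp: std_simplex_def c'_def)
  have lex: "lex_coords N u c'"
    by (rule lex_coords_support[OF c(1) c'S]) (use c(4) \<tau> in \<open>auto simp: c'_def\<close>)
  have "(1 - \<tau>) *\<^sub>R lincomb N u c' = (\<Sum>i<N. ((1 - \<tau>) * c' i) *\<^sub>R u i)"
    by (simp add: lincomb_def scaleR_sum_right)
  also have "\<dots> = (\<Sum>i<N. c i *\<^sub>R u i - (if i = j then \<tau> *\<^sub>R u j else 0))"
    using \<tau> by (intro sum.cong) (auto simp: c'_def scaleR_diff_left)
  also have "\<dots> = ?x - \<tau> *\<^sub>R u j"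
    using c(2) j by (simp add: sum_subtractf lincomb_def)
  finally have y: "lincomb N u c' = y" using \<tau> by simp
  show "y \<in> polytope_of N u" using c'S y by (auto simp: polytope_of_def)
  have "bary N u j y = c' j" using bary_lincomb[OF lex, of j] y by simp
  then show "bary N u j ?x = \<tau> + (1 - \<tau>) * bary N u j y"
    using \<tau> by (simp add: c'_def c_def)
qed

lemma one_minus_inverse_power_le_half:
  assumes "m > 0" shows "(1 - 1 / real m) ^ m \<le> 1 / 2"
proof -
  have "1 - 1 / real m \<le> exp (- (1 / real m))" using exp_ge_add_one_self[of "- (1 / real m)"] by simp
  then have "(1 - 1 / real m) ^ m \<le> exp (- (1 / real m)) ^ m"
    using assms by (intro power_mono) auto
  also have "\<dots> = exp (-1)" using assms by (simp add: exp_of_nat_mult[symmetric])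
  also have "\<dots> \<le> 1 / 2"
    using exp_ge_add_one_self[of 1] by (simp add: exp_minus field_simps)
  finally show ?thesis .
qed

section \<open>Second moment and volume of a polytope\<close>

context euclid
begin

lemma set_integrable_bary:
  "set_integrable (vol E) (polytope_of N u) (\<lambda>x. bary N u j x)"
  "set_integrable (vol E) (polytope_of N u) (\<lambda>x. (bary N u j x)\<^sup>2)"
proof -
  have "emeasure (vol E) (polytope_of N u) < \<infinity>"
    by (rule emeasure_compact_finite[OF compact_polytope_of])
  moreover have "polytope_of N u \<in> sets borel"
    by (intro borel_closed compact_imp_closed compact_polytope_of)
  ultimately show "set_integrable (vol E) (polytope_of N u) (\<lambda>x. bary N u j x)"
    "set_integrable (vol E) (polytope_of N u) (\<lambda>x. (bary N u j x)\<^sup>2)"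
    using bary_bounds[of N u j] bary_measurable[of N u j]
    by (auto intro!: set_integrable_bounded[where C = 1] borel_measurable_power
        simp: power_le_one)
qed

text \<open>Let f be the coordinate and I2, I1 the integrals of f^2 and f. Pointwise f^2 - 2 \<tau>
  f is at most the square of the positive part of f - \<tau>. By the homothety about
  \<open>u j\<close> the integral of the latter is at most \<open>(1 - \<tau>) ^ (d + 2)\<close> I2,
  hence at most I2 / 2, and so I2 \<le> 4 \<tau> I1. On a simplex the exact ratio is 2 / (d + 2), so
  only a factor 2 is lost.\<close>

lemma LINT_bary_square:
  assumes u: "\<And>i. i < N \<Longrightarrow> u i \<in> E" and j: "j < N"
  shows "(LINT x:polytope_of N u|vol E. (bary N u j x)\<^sup>2) \<le>
    4 / real (d + 2) * (LINT x:polytope_of N u|vol E. bary N u j x)"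
proof -
  let ?K = "polytope_of N u" and ?f = "bary N u j"
  \<comment> \<open>The exponent \<open>d + 2\<close> consists of \<open>d\<close> from the volume
    factor of the homothety and 2 from the square.\<close>
  define \<tau> where "\<tau> = 1 / real (d + 2)"
  have \<tau>: "0 \<le> \<tau>" "\<tau> < 1" by (simp_all add: \<tau>_def)
  note [measurable] = bary_measurable[of N u j]
  have Kb [measurable]: "?K \<in> sets borel"
    by (intro borel_closed compact_imp_closed compact_polytope_of)
  define g where "g x = indicator ?K x * (max 0 (?f x - \<tau>))\<^sup>2" for x
  have g: "g \<in> borel_measurable borel" unfolding g_def by measurable
  let ?I1 = "LINT x:?K|vol E. ?f x" and ?I2 = "LINT x:?K|vol E. (?f x)\<^sup>2"
  note int = set_integrable_bary[of N u j]
  have "set_integrable (vol E) ?K (\<lambda>x. (max 0 (?f x - \<tau>))\<^sup>2)"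
  proof (rule set_integrable_bounded[where C = 1])
    show "emeasure (vol E) ?K < \<infinity>" by (rule emeasure_compact_finite[OF compact_polytope_of])
    fix x
    have "max 0 (?f x - \<tau>) \<le> 1" using bary_bounds(2)[of N u j x] \<tau> by simp
    then show "\<bar>(max 0 (?f x - \<tau>))\<^sup>2\<bar> \<le> 1" by (simp add: power_le_one)
  qed auto
  then have "integrable (vol E) g" by (simp add: set_integrable_def g_def[abs_def])
  have lower: "?I2 - 2 * \<tau> * ?I1 \<le> (\<integral>x. g x \<partial>vol E)"
  proof -
    have "?I2 - 2 * \<tau> * ?I1 = (LINT x:?K|vol E. (?f x)\<^sup>2 - 2 * \<tau> * ?f x)"
      using int by simp
    also have "\<dots> \<le> (LINT x:?K|vol E. (max 0 (?f x - \<tau>))\<^sup>2)"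
    proof (rule LINT_mono_E)
      show "set_integrable (vol E) ?K (\<lambda>x. (?f x)\<^sup>2 - 2 * \<tau> * ?f x)" using int by simp
      fix x
      have "(?f x)\<^sup>2 - 2 * \<tau> * ?f x \<le> (max 0 (?f x - \<tau>))\<^sup>2"
      proof (cases "?f x \<ge> \<tau>")
        case True
        then show ?thesis by (simp add: power2_diff)
      next
        case False
        then have "?f x * (?f x - 2 * \<tau>) \<le> 0"
          using bary_bounds(1)[of N u j x] \<tau> by (intro mult_nonneg_nonpos) auto
        then show ?thesis using False by (simp add: power2_eq_square algebra_simps)
      qed
      then show "indicator ?K x * ((?f x)\<^sup>2 - 2 * \<tau> * ?f x) \<le>
          indicator ?K x * (max 0 (?f x - \<tau>))\<^sup>2" by (simp add: indicator_def)
    qed fact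
    finally show ?thesis by (simp add: set_lebesgue_integral_def g_def)
  qed
  have "vol_factor (\<lambda>x. (1 - \<tau>) *\<^sub>R x) ((1 - \<tau>) ^ d)"
    using \<tau> by (intro vol_factor_scaleR) simp
  from vol_factorD[OF this g subspace_scale[OF subspace_E u[OF j]], of \<tau>]
  have "(\<integral>x. g x \<partial>vol E) = (1 - \<tau>) ^ d * (\<integral>x. g ((1 - \<tau>) *\<^sub>R P x + \<tau> *\<^sub>R u j) \<partial>vol E)" .
  also have "\<dots> \<le> (1 - \<tau>) ^ d * ((1 - \<tau>)\<^sup>2 * ?I2)"
  proof (rule mult_left_mono)
    \<comment> \<open>Either \<open>g\<close> vanishes at the homothetic point, or
      \<open>bary_homothety\<close> puts \<open>y\<close> into the polytope and turns the coordinate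
      minus \<tau> into \<open>(1 - \<tau>) * ?f y\<close>.\<close>
    have le: "g ((1 - \<tau>) *\<^sub>R y + \<tau> *\<^sub>R u j) \<le> (1 - \<tau>)\<^sup>2 * (indicator ?K y * (?f y)\<^sup>2)" for y
    proof (cases "(1 - \<tau>) *\<^sub>R y + \<tau> *\<^sub>R u j \<in> ?K \<and> ?f ((1 - \<tau>) *\<^sub>R y + \<tau> *\<^sub>R u j) > \<tau>")
      case True
      then show ?thesis
        using bary_homothety[OF \<tau> j, of y u] \<tau> bary_bounds(1)[of N u j y]
        by (simp add: g_def power_mult_distrib)
    next
      case False
      then have "g ((1 - \<tau>) *\<^sub>R y + \<tau> *\<^sub>R u j) = 0" by (auto simp: g_def)
      then show ?thesis by (simp add: indicator_def)
    qed
    have int2: "integrable (vol E) (\<lambda>y. indicator ?K y * (?f y)\<^sup>2)"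
      using int(2) by (simp add: set_integrable_def)
    have "(\<integral>x. g ((1 - \<tau>) *\<^sub>R P x + \<tau> *\<^sub>R u j) \<partial>vol E) \<le>
        (\<integral>y. (1 - \<tau>)\<^sup>2 * (indicator ?K y * (?f y)\<^sup>2) \<partial>vol E)"
    proof (rule integral_mono_AE')
      show "integrable (vol E) (\<lambda>y. (1 - \<tau>)\<^sup>2 * (indicator ?K y * (?f y)\<^sup>2))"
        using int2 by simp
      show "AE x in vol E. g ((1 - \<tau>) *\<^sub>R P x + \<tau> *\<^sub>R u j) \<le>
          (1 - \<tau>)\<^sup>2 * (indicator ?K x * (?f x)\<^sup>2)"
        using AE_vol_E by eventually_elim (use le P_id in simp)
      show "AE x in vol E. 0 \<le> (1 - \<tau>)\<^sup>2 * (indicator ?K x * (?f x)\<^sup>2)" by simp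
    qed
    then show "(\<integral>x. g ((1 - \<tau>) *\<^sub>R P x + \<tau> *\<^sub>R u j) \<partial>vol E) \<le> (1 - \<tau>)\<^sup>2 * ?I2"
      using int2 by (simp add: set_lebesgue_integral_def)
  qed (use \<tau> in simp)
  also have "\<dots> = (1 - \<tau>) ^ (d + 2) * ?I2" by (simp add: power_add power2_eq_square)
  also have "\<dots> \<le> 1 / 2 * ?I2"
  proof (rule mult_right_mono)
    show "(1 - \<tau>) ^ (d + 2) \<le> 1 / 2"
      unfolding \<tau>_def by (rule one_minus_inverse_power_le_half) simp
    show "0 \<le> ?I2" unfolding set_lebesgue_integral_def by (rule integral_nonneg_AE) simp
  qed
  finally have "?I2 \<le> 4 * \<tau> * ?I1" using lower by simp
  then show ?thesis by (simp add: \<tau>_def)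
qed

text \<open>Since the coordinates sum to 1 on the polytope, summing \<open>LINT_bary_square\<close>
  over the vertices leaves just the volume, with no dependence on \<open>N\<close>.\<close>

lemma polytope_of_second_moment_le:
  assumes u: "\<And>i. i < N \<Longrightarrow> u i \<in> E"
    and K: "\<And>x. x \<in> polytope_of N u \<Longrightarrow> (norm (x - p))\<^sup>2 \<le> R * (\<Sum>j<N. (bary N u j x)\<^sup>2)"
    and R: "R \<ge> 0"
  shows "(LINT x:polytope_of N u|vol E. (norm (x - p))\<^sup>2) \<le>
    4 * R / real (d + 2) * measure (vol E) (polytope_of N u)"
proof -
  let ?K = "polytope_of N u"
  have Kb: "?K \<in> sets borel"
    by (intro borel_closed compact_imp_closed compact_polytope_of)
  note int = set_integrable_bary[of N u]
  have "(LINT x:?K|vol E. (norm (x - p))\<^sup>2) \<le> (LINT x:?K|vol E. \<Sum>j<N. R * (bary N u j x)\<^sup>2)"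
  proof (rule LINT_mono_E)
    show "set_integrable (vol E) ?K (\<lambda>x. (norm (x - p))\<^sup>2)"
      by (intro set_integrable_compact compact_polytope_of continuous_intros)
    show "set_integrable (vol E) ?K (\<lambda>x. \<Sum>j<N. R * (bary N u j x)\<^sup>2)"
      unfolding set_integrable_def scaleR_sum_right
      by (intro Bochner_Integration.integrable_sum)
        (use int(2) in \<open>simp add: set_integrable_def mult.left_commute\<close>)
  qed (use K in \<open>simp add: indicator_def sum_distrib_left\<close>)
  also have "\<dots> = (\<Sum>j<N. R * (LINT x:?K|vol E. (bary N u j x)\<^sup>2))"
    by (subst LINT_sum) (use int(2) in auto)
  also have "\<dots> \<le> (\<Sum>j<N. R * (4 / real (d + 2) * (LINT x:?K|vol E. bary N u j x)))"
    by (intro sum_mono mult_left_mono LINT_bary_square u R) auto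
  also have "\<dots> = 4 * R / real (d + 2) * (LINT x:?K|vol E. \<Sum>j<N. bary N u j x)"
    by (subst LINT_sum) (use int(1) in \<open>auto simp: sum_distrib_left intro!: sum.cong\<close>)
  also have "(LINT x:?K|vol E. \<Sum>j<N. bary N u j x) = (LINT x:?K|vol E. 1)"
    using bary_in_simplex[of _ N u] Kb bary_measurable[of N u]
    by (intro LINT_cong_E borel_measurable_sum) (auto simp: std_simplex_def)
  finally show ?thesis using Kb by (simp add: LINT_one)
qed

text \<open>
  The Rogers-Shephard inequality with constant \<open>4\<^sup>d\<close>, for a cube inside the difference body:
  for \<open>x = (p - q) / 2\<close> with \<open>p, q \<in> K\<close> the set \<open>K \<inter> (x + K)\<close> contains \<open>(K + p) / 2\<close>, and
  integrating its volume over all \<open>x\<close> yields the square of the volume of \<open>K\<close>.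
\<close>
lemma measure_ge_cube_difference_body:
  assumes K: "convex_body_in E K" and r: "r \<ge> 0"
    and diff: "\<And>x. x \<in> E \<Longrightarrow> x \<in> cube r \<Longrightarrow> \<exists>p\<in>K. \<exists>q\<in>K. x = p - q"
  shows "(r / 2) ^ d \<le> measure (vol E) K"
proof -
  have K': "compact K" "K \<subseteq> E" "convex K" using K by (auto simp: convex_body_in_def)
  have Kb [measurable]: "K \<in> sets borel" using K'(1) by (intro borel_closed compact_imp_closed)
  interpret pair_sigma_finite "leb d" "leb d" by (rule pair_sigma_finite_leb)
  let ?\<phi> = "lincomb d b"
  note [measurable] = measurable_lincomb_leb[of d b]
  define V where "V = measure (vol E) K"
  have V: "V > 0" using measure_convex_body_pos[OF K] by (simp add: V_def)
  have eV: "emeasure (vol E) K = ennreal V"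
    using emeasure_compact_finite[OF K'(1)] by (simp add: V_def emeasure_eq_ennreal_measure less_top)
  have eV_neg: "(\<integral>\<^sup>+x. indicator K (- ?\<phi> x) \<partial>leb d) = ennreal V"
  proof -
    have m: "uminus \<in> borel_measurable (borel :: 'a measure)"
      by (intro borel_measurable_continuous_onI continuous_intros)
    have nb: "uminus -` K \<in> sets borel" using measurable_sets[OF m Kb] by simp
    have img: "uminus -` K = (\<lambda>x. - x + 0) ` K" by force
    have "vol_factor (\<lambda>x. - x) 1"
      by (rule vol_factor_isometry)
        (auto intro!: linearI bij_betw_byWitness[of _ uminus] simp: subspace_neg[OF subspace_E])
    then have "measure (vol E) (uminus -` K) = V"
      unfolding img by (subst measure_affine_image[OF _ subspace_0[OF subspace_E] K'(1,2)])
        (auto simp: V_def)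
    moreover have "emeasure (vol E) (uminus -` K) < \<infinity>"
      unfolding img using K'(1) by (intro emeasure_compact_finite compact_continuous_image
          continuous_intros)
    ultimately have "emeasure (vol E) (uminus -` K) = ennreal V"
      by (simp add: emeasure_eq_ennreal_measure less_top)
    then show ?thesis using nb by (simp add: emeasure_vol indicator_vimage)
  qed
  have m: "(\<lambda>(x, y). indicator K (?\<phi> y) * indicator K (?\<phi> y - ?\<phi> x) :: ennreal)
      \<in> borel_measurable (leb d \<Otimes>\<^sub>M leb d)"
    using measurable_lincomb_pair[of K 0 d b 1 b] measurable_lincomb_pair[of K "-1" d b 1 b]
    by (simp add: case_prod_beta')
  have half: "ennreal ((1 / 2) ^ d * V) \<le>
      (\<integral>\<^sup>+y. indicator K (?\<phi> y) * indicator K (?\<phi> y - ?\<phi> x) \<partial>leb d)"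
    if x: "?\<phi> x \<in> cube (r / 2)" for x
  proof -
    have "2 *\<^sub>R ?\<phi> x \<in> E" "2 *\<^sub>R ?\<phi> x \<in> cube r"
      using x subspace_scale[OF subspace_E lincomb_in_E] by (auto simp: cube_def abs_mult)
    from diff[OF this] obtain p q where pq: "p \<in> K" "q \<in> K" "2 *\<^sub>R ?\<phi> x = p - q" by blast
    have x_eq: "?\<phi> x = (1 / 2) *\<^sub>R p - (1 / 2) *\<^sub>R q"
    proof -
      have "?\<phi> x = (1 / 2) *\<^sub>R (2 *\<^sub>R ?\<phi> x)" by simp
      then show ?thesis unfolding pq(3) by (simp add: scaleR_diff_right)
    qed
    let ?H = "(\<lambda>y. (1 / 2) *\<^sub>R y + (1 / 2) *\<^sub>R p) ` K"
    have pE: "(1 / 2) *\<^sub>R p \<in> E" using pq(1) K'(2) by (intro subspace_scale subspace_E) auto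
    have S: "vol_factor (\<lambda>y. (1 / 2) *\<^sub>R y) ((1 / 2) ^ d)" by (rule vol_factor_scaleR) simp
    have Hc: "compact ?H"
      by (intro compact_continuous_image K' continuous_intros)
    have "measure (vol E) ?H = (1 / 2) ^ d * V"
      unfolding measure_affine_image[OF S pE K'(1,2)] V_def ..
    then have "ennreal ((1 / 2) ^ d * V) = emeasure (vol E) ?H"
      using emeasure_compact_finite[OF Hc] by (simp add: emeasure_eq_ennreal_measure less_top)
    also have "\<dots> = (\<integral>\<^sup>+y. indicator ?H (?\<phi> y) \<partial>leb d)"
      by (rule emeasure_vol) (intro borel_closed compact_imp_closed Hc)
    also have "\<dots> \<le> (\<integral>\<^sup>+y. indicator K (?\<phi> y) * indicator K (?\<phi> y - ?\<phi> x) \<partial>leb d)"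
    proof (rule nn_integral_mono)
      fix y
      have "?\<phi> y \<in> K \<and> ?\<phi> y - ?\<phi> x \<in> K" if "?\<phi> y \<in> ?H"
      proof -
        obtain z where z: "z \<in> K" "?\<phi> y = (1 / 2) *\<^sub>R z + (1 / 2) *\<^sub>R p" using \<open>?\<phi> y \<in> ?H\<close> by blast
        have eq: "?\<phi> y - ?\<phi> x = (1 / 2) *\<^sub>R z + (1 / 2) *\<^sub>R q" using z x_eq by simp
        have "?\<phi> y \<in> K" unfolding z(2) by (rule convexD[OF K'(3) z(1) pq(1)]) auto
        moreover have "?\<phi> y - ?\<phi> x \<in> K" unfolding eq by (rule convexD[OF K'(3) z(1) pq(2)]) auto
        ultimately show ?thesis ..
      qed
      then show "indicator ?H (?\<phi> y) \<le>
          (indicator K (?\<phi> y) * indicator K (?\<phi> y - ?\<phi> x) :: ennreal)"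
        by (auto simp: indicator_def)
    qed
    finally show ?thesis .
  qed
  \<comment> \<open>Integrate the bound \<open>half\<close> over \<open>cube (r / 2)\<close>, the
    set of x with 2 x in \<open>cube r\<close>, of volume \<open>r ^ d\<close>. The double integral
    equals \<open>V * V\<close>, so one factor \<open>V\<close> cancels.\<close>
  have "ennreal (r ^ d * ((1 / 2) ^ d * V)) = (\<integral>\<^sup>+x. ennreal ((1 / 2) ^ d * V) * indicator (cube (r / 2)) (?\<phi> x) \<partial>leb d)"
    using emeasure_cube[of "r / 2"] r V
    by (subst nn_integral_cmult) (simp_all add: emeasure_vol ennreal_mult[symmetric] mult_ac)
  also have "\<dots> \<le> (\<integral>\<^sup>+x. (\<integral>\<^sup>+y. indicator K (?\<phi> y) * indicator K (?\<phi> y - ?\<phi> x) \<partial>leb d) \<partial>leb d)"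
    by (intro nn_integral_mono) (use half in \<open>auto simp: indicator_def\<close>)
  also have "\<dots> = (\<integral>\<^sup>+y. (\<integral>\<^sup>+x. indicator K (?\<phi> y) * indicator K (?\<phi> y - ?\<phi> x) \<partial>leb d) \<partial>leb d)"
    by (rule Fubini'[OF m, symmetric])
  also have "\<dots> = (\<integral>\<^sup>+y. indicator K (?\<phi> y) * ennreal V \<partial>leb d)"
  proof (rule nn_integral_cong)
    fix y
    have "(\<lambda>z::'a. - z) \<in> borel_measurable borel"
      by (intro borel_measurable_continuous_onI continuous_intros)
    from measurable_compose[OF this borel_measurable_indicator[OF Kb]]
    have h: "(\<lambda>z. indicator K (- z) :: ennreal) \<in> borel_measurable borel" .
    have "- ?\<phi> y \<in> span (b ` {..<d})"
      using subspace_neg[OF subspace_E lincomb_in_E] by (simp add: span_b)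
    from nn_integral_lincomb_translate[OF this h]
    have "(\<integral>\<^sup>+x. indicator K (?\<phi> y - ?\<phi> x) \<partial>leb d) = ennreal V" using eV_neg by simp
    then show "(\<integral>\<^sup>+x. indicator K (?\<phi> y) * indicator K (?\<phi> y - ?\<phi> x) \<partial>leb d) =
        indicator K (?\<phi> y) * ennreal V"
      by (cases "?\<phi> y \<in> K") auto
  qed
  also have "\<dots> = ennreal (V * V)"
    using V eV by (subst nn_integral_multc) (simp_all add: emeasure_vol[symmetric] ennreal_mult)
  finally have "r ^ d * ((1 / 2) ^ d * V) \<le> V * V" using V by simp
  then have "r ^ d * (1 / 2) ^ d \<le> V" using V by (simp flip: mult.assoc)
  then show ?thesis by (simp add: V_def power_divide)
qed

end

section \<open>Projections of the cross-polytope and the simplex\<close>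

lemma lincomb_polytope_of:
  assumes "\<And>i. i < N \<Longrightarrow> 0 \<le> c i" "(\<Sum>i<N. c i) = 1"
  shows "lincomb N u c \<in> polytope_of N u"
proof -
  have "(\<lambda>i. if i < N then c i else 0) \<in> std_simplex N"
    using assms by (simp add: std_simplex_def)
  moreover have "lincomb N u c = lincomb N u (\<lambda>i. if i < N then c i else 0)"
    by (simp add: lincomb_def)
  ultimately show ?thesis by (auto simp: polytope_of_def)
qed

lemma convex_polytope_of: "convex (polytope_of N u)"
proof (rule convexI)
  fix x y s t assume "x \<in> polytope_of N u" "y \<in> polytope_of N u"
    and st: "0 \<le> s" "0 \<le> t" "s + t = (1 :: real)"
  then obtain c a where c: "c \<in> std_simplex N" "x = lincomb N u c"
    and a: "a \<in> std_simplex N" "y = lincomb N u a" by (auto simp: polytope_of_def)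
  have "lincomb N u (\<lambda>i. s * c i + t * a i) \<in> polytope_of N u"
  proof (rule lincomb_polytope_of)
    show "(\<Sum>i<N. s * c i + t * a i) = 1"
      using c(1) a(1) st by (simp add: sum.distrib sum_distrib_left[symmetric] std_simplex_def)
  qed (use c(1) a(1) st in \<open>auto simp: std_simplex_def\<close>)
  then show "s *\<^sub>R x + t *\<^sub>R y \<in> polytope_of N u"
    by (simp add: c(2) a(2) lincomb_def scaleR_add_left sum.distrib scaleR_sum_right)
qed

lemma linear_lincomb: "linear f \<Longrightarrow> f (lincomb N u c) = lincomb N (\<lambda>i. f (u i)) c"
  by (simp add: lincomb_def linear_sum linear_scale)

lemma polytope_of_linear_image:
  assumes "linear f" shows "f ` polytope_of N u = polytope_of N (\<lambda>i. f (u i))"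
  by (simp add: polytope_of_def image_image linear_lincomb[OF assms])

lemma lincomb_translate:
  assumes "(\<Sum>i<N. c i) = 1"
  shows "lincomb N (\<lambda>i. u i + g) c = lincomb N u c + g"
proof -
  have "lincomb N (\<lambda>i. u i + g) c = lincomb N u c + (\<Sum>i<N. c i) *\<^sub>R g"
    by (simp add: lincomb_def scaleR_add_right sum.distrib scaleR_sum_left)
  then show ?thesis using assms by simp
qed

section \<open>Projections of a tight frame\<close>

context euclid
begin

text \<open>Common abstraction of the two polytopes. The frame constant is the one dictated by
  traces in dimension \<open>n\<close>: \<open>N\<close> vectors of total squared norm
  \<open>N * R\<^sup>2\<close>, spread evenly over \<open>n\<close> directions. The vector
  \<open>g\<close> absorbs the position of the polytope.\<close>

lemma isotropy_const_frame_le: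
  fixes w :: "nat \<Rightarrow> 'a" and n N :: nat and R :: real
  assumes d: "d > 0" and n: "n > 0" and N: "N > 0" and R: "R > 0" and g: "g \<in> E"
    and orth: "\<And>i j. i < N \<Longrightarrow> j < N \<Longrightarrow> i \<noteq> j \<Longrightarrow> w i \<bullet> w j \<le> 0"
    and nrm: "\<And>i. i < N \<Longrightarrow> norm (w i) = R"
    and sum0: "(\<Sum>i<N. w i) = 0"
    and frame: "\<And>y. y \<in> E \<Longrightarrow> (\<Sum>j<N. (w j \<bullet> y) *\<^sub>R w j) = (N * R\<^sup>2 / n) *\<^sub>R y"
  shows "isotropy_const E (polytope_of N (\<lambda>j. P (w j) + g)) \<le> 4 * sqrt (n / d)"
proof -
  define u where "u j = P (w j) + g" for j
  let ?K = "polytope_of N u"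
  \<comment> \<open>Coefficients of the frame expansion of \<open>y\<close>. Their sum is 0, so they
    can be added to any convex weights.\<close>
  define a where "a y j = (w j \<bullet> y) * (n / (N * R\<^sup>2))" for y j
  have uE: "u j \<in> E" for j by (simp add: u_def subspace_add[OF subspace_E] P_in_E g)
  have u_eq: "lincomb N u c = P (lincomb N w c) + g" if "(\<Sum>i<N. c i) = 1" for c
    using that unfolding u_def by (simp add: lincomb_translate linear_lincomb[OF linear_P])
  have in_K: "P (lincomb N w c) + g \<in> ?K" if "\<And>j. j < N \<Longrightarrow> c j \<ge> 0" "(\<Sum>j<N. c j) = 1" for c
    using lincomb_polytope_of[of N c u] that u_eq by simp
  have a_sum: "(\<Sum>j<N. a y j) = 0" for y
  proof -
    have "(\<Sum>j<N. a y j) = ((\<Sum>j<N. w j) \<bullet> y) * (n / (N * R\<^sup>2))"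
      unfolding a_def inner_sum_left sum_distrib_right ..
    then show ?thesis by (simp add: sum0)
  qed
  have a_lincomb: "lincomb N w (a y) = y" if "y \<in> E" for y
  proof -
    have "lincomb N w (a y) = (n / (N * R\<^sup>2)) *\<^sub>R (\<Sum>j<N. (w j \<bullet> y) *\<^sub>R w j)"
      by (simp add: lincomb_def a_def scaleR_sum_right mult.commute)
    then show ?thesis using frame[OF that] n N R by simp
  qed
  have KE: "?K \<subseteq> E"
    unfolding polytope_of_def lincomb_def using uE
    by (auto intro!: subspace_sum subspace_scale subspace_E)
  have body: "convex_body_in E ?K"
  proof (rule convex_body_inI[OF KE compact_polytope_of convex_polytope_of open_ball])
    show "g \<in> E \<inter> ball g (R / n)" using g R n by simp
    \<comment> \<open>For |y| < R / n each frame coefficient is at most 1 / N in absolute value, so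
      perturbing the uniform weights keeps them nonnegative; uniform weights themselves represent
      0.\<close>
    show "E \<inter> ball g (R / n) \<subseteq> ?K"
    proof
      fix x assume x: "x \<in> E \<inter> ball g (R / n)"
      define y where "y = x - g"
      have y: "y \<in> E" "norm y < R / n"
        using x g subspace_diff[OF subspace_E] by (auto simp: y_def dist_norm norm_minus_commute)
      have "\<bar>a y j\<bar> \<le> 1 / N" if "j < N" for j
      proof -
        have "\<bar>a y j\<bar> = \<bar>w j \<bullet> y\<bar> * (n / (N * R\<^sup>2))" by (simp add: a_def abs_mult)
        also have "\<dots> \<le> (R * (R / n)) * (n / (N * R\<^sup>2))"
        proof (rule mult_right_mono)
          have "\<bar>w j \<bullet> y\<bar> \<le> norm (w j) * norm y" by (rule Cauchy_Schwarz_ineq2)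
          also have "\<dots> \<le> R * (R / n)"
            unfolding nrm[OF that] using y(2) R by (intro mult_left_mono) auto
          finally show "\<bar>w j \<bullet> y\<bar> \<le> R * (R / n)" .
        qed simp
        also have "\<dots> = 1 / N" using n R N by (simp add: power2_eq_square)
        finally show ?thesis .
      qed
      then have "P (lincomb N w (\<lambda>j. 1 / N + a y j)) + g \<in> ?K"
        using N a_sum[of y] by (intro in_K) (fastforce simp: abs_le_iff sum.distrib)+
      moreover have "lincomb N w (\<lambda>j. 1 / N + a y j) = y"
      proof -
        have "lincomb N w (\<lambda>_. 1 / N) = (1 / N) *\<^sub>R (\<Sum>j<N. w j)"
          by (simp add: lincomb_def scaleR_sum_right)
        then show ?thesis by (simp only: lincomb_add a_lincomb[OF y(1)] sum0) simp
      qed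
      ultimately show "x \<in> ?K" using P_id[OF y(1)] by (simp add: y_def)
    qed
  qed
  have moment: "(LINT x:?K|vol E. (norm (x - g))\<^sup>2) \<le>
      4 * R\<^sup>2 / real (d + 2) * measure (vol E) ?K"
  proof (rule polytope_of_second_moment_le)
    fix x assume x: "x \<in> ?K"
    define c where "c j = bary N u j x" for j
    have c: "c \<in> std_simplex N" "lincomb N u c = x"
      using bary_in_simplex[OF x] bary_props(2)[OF x] by (simp_all add: c_def[abs_def])
    then have c': "(\<Sum>i<N. c i) = 1" "\<And>i. c i \<ge> 0" by (simp_all add: std_simplex_def)
    have "x - g = P (lincomb N w c)" using u_eq[OF c'(1)] c(2) by simp
    then have "(norm (x - g))\<^sup>2 \<le> (norm (lincomb N w c))\<^sup>2"
      using norm_P_le by (intro power_mono) auto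
    also have "\<dots> = (\<Sum>i<N. \<Sum>j<N. c i * c j * (w i \<bullet> w j))"
      unfolding power2_norm_eq_inner lincomb_def inner_sum_left inner_sum_right
      by (subst sum.swap) (simp add: mult_ac)
    also have "\<dots> \<le> (\<Sum>i<N. \<Sum>j<N. if j = i then R\<^sup>2 * (c i)\<^sup>2 else 0)"
    proof (intro sum_mono)
      fix i j assume ij: "i \<in> {..<N}" "j \<in> {..<N}"
      show "c i * c j * (w i \<bullet> w j) \<le> (if j = i then R\<^sup>2 * (c i)\<^sup>2 else 0)"
      proof (cases "j = i")
        case True
        then show ?thesis using nrm[of i] ij
          by (simp add: power2_norm_eq_inner[symmetric]) (simp add: power2_eq_square)
      next
        case False
        then show ?thesis using orth[of i j] ij c'(2)
          by (auto intro!: mult_nonneg_nonpos)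
      qed
    qed
    also have "\<dots> = R\<^sup>2 * (\<Sum>j<N. (bary N u j x)\<^sup>2)"
      by (simp add: c_def sum_distrib_left)
    finally show "(norm (x - g))\<^sup>2 \<le> R\<^sup>2 * (\<Sum>j<N. (bary N u j x)\<^sup>2)" .
  qed (use uE in auto)
  \<comment> \<open>Chosen so that the part of \<open>cube r\<close> in \<open>E\<close> lies in the
    ball of radius \<open>R / sqrt n\<close>.\<close>
  define r where "r = R / sqrt (n * d)"
  have r: "r > 0" using R n d by (simp add: r_def)
  have vol: "(r / 2) ^ d \<le> measure (vol E) ?K"
  proof (rule measure_ge_cube_difference_body[OF body])
    fix x assume x: "x \<in> E" "x \<in> cube r"
    have "norm x \<le> sqrt d * r" using norm_P_cube_le[OF x(2)] r P_id[OF x(1)] by simp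
    also have "\<dots> = R / sqrt n" using d by (simp add: r_def real_sqrt_mult)
    finally have nx: "(norm x)\<^sup>2 \<le> R\<^sup>2 / n"
      using power_mono[of "norm x" "R / sqrt n" 2] by (simp add: power_divide)
    have sq: "(\<Sum>j<N. (w j \<bullet> x)\<^sup>2) = N * R\<^sup>2 / n * (norm x)\<^sup>2"
    proof -
      have "(\<Sum>j<N. (w j \<bullet> x)\<^sup>2) = (\<Sum>j<N. (w j \<bullet> x) *\<^sub>R w j) \<bullet> x"
        by (simp add: inner_sum_left power2_eq_square)
      then show ?thesis using frame[OF x(1)] by (simp add: power2_norm_eq_inner)
    qed
    \<comment> \<open>Cauchy-Schwarz passes to the sum of squares, which the frame identity
      evaluates; the factors \<open>N\<close> cancel, and the radius \<open>R / sqrt n\<close> is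
      what makes the result at most 1.\<close>
    have "(\<Sum>j<N. \<bar>a x j\<bar>)\<^sup>2 \<le> (\<Sum>j<N. \<bar>a x j\<bar>\<^sup>2) * N"
      using sum_squared_le_sum_of_squares[of "\<lambda>j. \<bar>a x j\<bar>" "{..<N}"] by simp
    also have "(\<Sum>j<N. \<bar>a x j\<bar>\<^sup>2) = (\<Sum>j<N. (w j \<bullet> x)\<^sup>2) * (n / (N * R\<^sup>2))\<^sup>2"
      unfolding power2_abs a_def power_mult_distrib sum_distrib_right ..
    also have "\<dots> * N = n * (norm x)\<^sup>2 / R\<^sup>2"
      unfolding sq using n N R by (simp add: power2_eq_square)
    also have "\<dots> \<le> n * (R\<^sup>2 / n) / R\<^sup>2"
      using nx R by (intro divide_right_mono mult_left_mono) auto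
    also have "\<dots> = 1\<^sup>2" using n R by simp
    finally have l1: "(\<Sum>j<N. \<bar>a x j\<bar>) \<le> 1" by (rule power2_le_imp_le) simp
    \<comment> \<open>Weights of total at most 1 are completed by equal shares for all vertices.
      Since the \<open>w j\<close> sum to 0, the completion does not move the point, and the
      positive and negative parts of \<open>a x\<close> give two points of the polytope with
      difference \<open>x\<close>.\<close>
    define q where "q f = P (lincomb N w (\<lambda>j. (1 - (\<Sum>j<N. f j)) / N + f j)) + g" for f
    have q_in: "q f \<in> ?K" if f: "\<And>j. 0 \<le> f j" "\<And>j. f j \<le> \<bar>a x j\<bar>" for f
      unfolding q_def
    proof (rule in_K)
      have "(\<Sum>j<N. f j) \<le> 1" using sum_mono[of "{..<N}" f "\<lambda>j. \<bar>a x j\<bar>"] f(2) l1 by simp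
      then show "0 \<le> (1 - (\<Sum>j<N. f j)) / N + f j" for j using f(1) by simp
      show "(\<Sum>j<N. (1 - (\<Sum>j<N. f j)) / N + f j) = 1" using N by (simp add: sum.distrib)
    qed
    have q_eq: "q f = P (lincomb N w f) + g" for f
    proof -
      have "lincomb N w (\<lambda>_. s) = s *\<^sub>R (\<Sum>j<N. w j)" for s
        by (simp add: lincomb_def scaleR_sum_right)
      then show ?thesis by (simp add: q_def lincomb_add sum0)
    qed
    let ?p = "\<lambda>j. max 0 (a x j)" and ?m = "\<lambda>j. max 0 (- a x j)"
    have "q ?p - q ?m = P (lincomb N w ?p - lincomb N w ?m)"
      by (simp add: q_eq linear_diff[OF linear_P])
    also have "lincomb N w ?p - lincomb N w ?m = lincomb N w (a x)"
      by (simp add: lincomb_def sum_subtractf[symmetric] scaleR_diff_left[symmetric])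
        (intro sum.cong, auto simp: max_def)
    finally have "x = q ?p - q ?m" using a_lincomb[OF x(1)] P_id[OF x(1)] by simp
    moreover have "q ?p \<in> ?K" "q ?m \<in> ?K" by (auto intro!: q_in)
    ultimately show "\<exists>p\<in>?K. \<exists>q\<in>?K. x = p - q" by blast
  qed (use r in simp)
  have "isotropy_const E ?K \<le> 4 * sqrt (n / d)"
  proof (rule isotropy_const_le[OF d body _ _ vol])
    have "(LINT x:?K|vol E. (norm (x - g))\<^sup>2) \<le> 4 * R\<^sup>2 / d * measure (vol E) ?K"
    proof (rule order_trans[OF moment mult_right_mono])
      show "4 * R\<^sup>2 / real (d + 2) \<le> 4 * R\<^sup>2 / d" using d by (intro divide_left_mono) auto
    qed simp
    also have "4 * R\<^sup>2 / d = d * (r / 2)\<^sup>2 * (4 * sqrt (n / d))\<^sup>2"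
      using n d by (simp add: r_def power_divide power_mult_distrib power2_eq_square)
    finally show "(LINT x:?K|vol E. (norm (x - g))\<^sup>2) \<le>
        d * (r / 2)\<^sup>2 * (4 * sqrt (n / d))\<^sup>2 * measure (vol E) ?K" .
  qed (use r in auto)
  then show ?thesis by (simp add: u_def[abs_def])
qed

end

text \<open>Otherwise the family could be extended, giving \<open>k + 1\<close> independent vectors
  in the span of at most \<open>k\<close>.\<close>

lemma orthonormal_family_spans:
  fixes q :: "'a::real_vector \<Rightarrow> 'a \<Rightarrow> real"
  assumes E: "subspace E" and T: "finite T" "E \<subseteq> span T" "card T \<le> k"
    and sym: "\<And>x y. q x y = q y x"
    and lin: "\<And>z. linear (\<lambda>x. q x z)"
    and pos: "\<And>x. x \<in> E \<Longrightarrow> x \<noteq> 0 \<Longrightarrow> q x x > 0"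
    and b: "\<And>i. i < k \<Longrightarrow> b i \<in> E"
    and ortho: "\<And>i j. i < k \<Longrightarrow> j < k \<Longrightarrow> q (b i) (b j) = (if i = j then 1 else 0)"
  shows "span (b ` {..<k}) = E"
proof (rule ccontr)
  assume "span (b ` {..<k}) \<noteq> E"
  from orthonormal_family_extend[OF E sym lin pos b ortho this] obtain b' where b':
    "\<forall>i<Suc k. b' i \<in> E" "\<forall>i<Suc k. \<forall>j<Suc k. q (b' i) (b' j) = (if i = j then 1 else 0)"
    by blast
  have "independent (b' ` {..<Suc k})" "card (b' ` {..<Suc k}) = Suc k"
    using orthonormal_family_independent[of q "Suc k" b', OF lin] b'(2) by blast+
  moreover have "b' ` {..<Suc k} \<subseteq> span T" using b'(1) T(2) by auto
  ultimately show False using independent_span_bound[OF T(1), of "b' ` {..<Suc k}"] T(3) by simp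
qed

section \<open>Coordinates in the space of finitely supported sequences\<close>

lemma linear_inner_left: "linear (\<lambda>x::'a::real_inner. x \<bullet> z)"
  by (rule linearI) (simp_all add: inner_add_left)

lift_definition unit_fseq :: "nat \<Rightarrow> fseq" is "\<lambda>i j. if j = i then 1 else 0" by simp

lemma coord_unit: "coord (unit_fseq i) j = (if j = i then 1 else 0)"
  by transfer simp

lemma inner_unit: "unit_fseq i \<bullet> x = coord x i" "x \<bullet> unit_fseq i = coord x i"
proof -
  have "unit_fseq i \<bullet> x = (\<Sum>j\<in>{i}. coord (unit_fseq i) j * coord x j)"
    by (rule inner_fseq_superset) (auto simp: coord_unit)
  then show "unit_fseq i \<bullet> x = coord x i" by (simp add: coord_unit)
  then show "x \<bullet> unit_fseq i = coord x i" by (simp add: inner_commute)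
qed

lemma coord_lincomb: "coord (lincomb k u c) j = (\<Sum>i<k. c i * coord (u i) j)"
  by (simp add: inner_unit(2)[symmetric] lincomb_def inner_sum_left)

lemma Rn_eq_lincomb: "x \<in> Rn n \<Longrightarrow> x = lincomb n unit_fseq (coord x)"
proof -
  assume x: "x \<in> Rn n"
  have "coord x j = coord (lincomb n unit_fseq (coord x)) j" for j
    using x by (cases "j < n") (auto simp: coord_lincomb coord_unit Rn_def if_distrib cong: if_cong)
  then show ?thesis by (simp add: coord_inject[symmetric] fun_eq_iff)
qed

lemma subspace_Rn: "subspace (Rn n)"
  by (auto simp: subspace_def Rn_def)

lemma Rn_subset_span: "Rn n \<subseteq> span (unit_fseq ` {..<n})"
  using Rn_eq_lincomb by (auto simp: span_eq_lincomb)

lemma euclid_subspace_Rn: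
  assumes "subspace E" "E \<subseteq> Rn n"
  shows "euclid E (SOME b. orthonormal_basis E b)"
proof -
  have "\<exists>b. orthonormal_basis E b"
    unfolding orthonormal_basis_def
    by (rule gram_schmidt[OF assms(1) _ _ inner_commute linear_inner_left, of "unit_fseq ` {..<n}"])
      (use assms(2) Rn_subset_span[of n] in auto)
  then have "orthonormal_basis E (SOME b. orthonormal_basis E b)" by (rule someI_ex)
  then show ?thesis by (intro euclid.intro) auto
qed

section \<open>The cross-polytope\<close>

definition cross :: "nat \<Rightarrow> nat \<Rightarrow> fseq"
  where "cross n j = (if j < n then unit_fseq j else - unit_fseq (j - n))"

lemma B1_eq_polytope_of:
  assumes n: "n > 0" shows "B1 n = polytope_of (2 * n) (cross n)"
proof (intro set_eqI iffI)
  have co: "coord (lincomb (2 * n) (cross n) c) i = (if i < n then c i - c (i + n) else 0)" for c i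
    by (simp add: coord_lincomb sum_lessThan_double cross_def coord_unit if_distrib
        sum.distrib sum_negf cong: if_cong)
  fix x
  {
    assume x: "x \<in> B1 n"
    \<comment> \<open>The mass missing to total weight 1, shared equally among the
      \<open>2 * n\<close> vertices; it cancels between opposite vertices, which have indices
      \<open>j\<close> and \<open>j + n\<close>.\<close>
    define s where "s = (1 - (\<Sum>i<n. \<bar>coord x i\<bar>)) / (2 * n)"
    have s: "s \<ge> 0" using x by (simp add: s_def B1_def)
    define c where "c j = (if j < n then max 0 (coord x j) else max 0 (- coord x (j - n))) + s" for j
    have "lincomb (2 * n) (cross n) c \<in> polytope_of (2 * n) (cross n)"
    proof (rule lincomb_polytope_of)
      show "c j \<ge> 0" for j using s by (simp add: c_def)
      have "(\<Sum>j<2 * n. c j) = (\<Sum>i<n. \<bar>coord x i\<bar> + 2 * s)"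
        unfolding sum_lessThan_double by (rule sum.cong) (auto simp: c_def)
      also have "\<dots> = 1" using n by (simp add: sum.distrib s_def) (simp add: field_simps)
      finally show "(\<Sum>j<2 * n. c j) = 1" .
    qed
    moreover have "x = lincomb (2 * n) (cross n) c"
    proof -
      have "coord x i = coord (lincomb (2 * n) (cross n) c) i" for i
        using x by (auto simp: co c_def B1_def Rn_def)
      then show ?thesis by (simp add: coord_inject[symmetric] fun_eq_iff)
    qed
    ultimately show "x \<in> polytope_of (2 * n) (cross n)" by simp
  next
    assume "x \<in> polytope_of (2 * n) (cross n)"
    then obtain c where c: "c \<in> std_simplex (2 * n)" "x = lincomb (2 * n) (cross n) c"
      by (auto simp: polytope_of_def)
    have "(\<Sum>i<n. \<bar>coord x i\<bar>) \<le> (\<Sum>i<n. c i + c (i + n))"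
    proof (rule sum_mono)
      fix i assume "i \<in> {..<n}"
      moreover have "c i \<ge> 0" "c (i + n) \<ge> 0" using c(1) by (auto simp: std_simplex_def)
      ultimately show "\<bar>coord x i\<bar> \<le> c i + c (i + n)" by (simp add: c(2) co)
    qed
    also have "\<dots> = 1" using c(1) by (simp add: std_simplex_def sum_lessThan_double)
    finally show "x \<in> B1 n" by (simp add: B1_def Rn_def c(2) co)
  }
qed

lemma isotropy_const_B1_le:
  assumes E: "subspace E" "E \<subseteq> Rn n" and d: "dim E > 0" and n: "n > 0"
  shows "isotropy_const E (orth_proj E ` B1 n) \<le> 4 * sqrt (n / dim E)"
proof -
  interpret euclid E "SOME b. orthonormal_basis E b" by (rule euclid_subspace_Rn[OF E])
  have img: "orth_proj E ` B1 n = polytope_of (2 * n) (\<lambda>j. P (cross n j) + 0)"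
    by (simp add: orth_proj_eq_P[abs_def] B1_eq_polytope_of[OF n] polytope_of_linear_image[OF linear_P])
  show ?thesis unfolding img
  \<comment> \<open>Each coordinate direction occurs with both signs, so the frame constant is 2,
    which agrees with \<open>N * R\<^sup>2 / n\<close> for \<open>N = 2 * n\<close>.\<close>
  proof (rule isotropy_const_frame_le[where R = 1])
    show "(\<Sum>i<2 * n. cross n i) = 0" by (simp add: sum_lessThan_double cross_def)
    show "cross n i \<bullet> cross n j \<le> 0" if "i < 2 * n" "j < 2 * n" "i \<noteq> j" for i j
      using that by (auto simp: cross_def inner_unit coord_unit)
    show "norm (cross n i) = 1" for i
      by (simp add: cross_def norm_eq_sqrt_inner inner_unit coord_unit)
    fix y assume "y \<in> E"
    then have y: "y = lincomb n unit_fseq (coord y)" using E(2) Rn_eq_lincomb by blast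
    have "(\<Sum>j<2 * n. (cross n j \<bullet> y) *\<^sub>R cross n j) = (\<Sum>i<n. 2 *\<^sub>R (coord y i *\<^sub>R unit_fseq i))"
      unfolding sum_lessThan_double by (rule sum.cong) (simp_all add: cross_def inner_unit scaleR_add_left[symmetric])
    also have "\<dots> = 2 *\<^sub>R y" by (subst (2) y) (simp add: lincomb_def scaleR_sum_right)
    finally show "(\<Sum>j<2 * n. (cross n j \<bullet> y) *\<^sub>R cross n j) = (real (2 * n) * 1\<^sup>2 / n) *\<^sub>R y"
      using n by simp
  qed (use d n subspace_0[OF E(1)] in auto)
qed

section \<open>The regular simplex\<close>

lemma convex_hull_eq_polytope_of:
  assumes v: "bij_betw v {..<N} V"
  shows "convex hull V = polytope_of N v"
proof -
  have V: "V = v ` {..<N}" "inj_on v {..<N}" using v by (auto simp: bij_betw_def)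
  have fin: "finite V" using V by simp
  have re: "(\<Sum>x\<in>V. h x) = (\<Sum>i<N. h (v i))" for h :: "_ \<Rightarrow> 'b::comm_monoid_add"
    unfolding V(1) by (simp add: sum.reindex[OF V(2)])
  show ?thesis
  proof (intro set_eqI iffI)
    fix x assume "x \<in> convex hull V"
    then obtain c where c: "\<forall>y\<in>V. 0 \<le> c y" "sum c V = 1" "(\<Sum>y\<in>V. c y *\<^sub>R y) = x"
      unfolding convex_hull_finite[OF fin] by blast
    have "sum c V = (\<Sum>i<N. c (v i))" "(\<Sum>y\<in>V. c y *\<^sub>R y) = (\<Sum>i<N. c (v i) *\<^sub>R v i)"
      unfolding V(1) by (simp_all add: sum.reindex[OF V(2)])
    then have "(\<Sum>i<N. c (v i)) = 1" "lincomb N v (\<lambda>i. c (v i)) = x"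
      using c by (simp_all add: lincomb_def)
    moreover have "0 \<le> c (v i)" if "i < N" for i using c(1) V(1) that by auto
    ultimately show "x \<in> polytope_of N v" using lincomb_polytope_of[of N "\<lambda>i. c (v i)" v] by simp
  next
    fix x assume "x \<in> polytope_of N v"
    then obtain c where c: "c \<in> std_simplex N" "x = lincomb N v c" by (auto simp: polytope_of_def)
    have "v i \<in> convex hull V" if "i < N" for i
      using V(1) that by (intro hull_inc) auto
    then show "x \<in> convex hull V"
      unfolding c(2) lincomb_def using c(1)
      by (intro convex_sum) (auto simp: std_simplex_def)
  qed
qed

text \<open>
  Summing the squared distances to a fixed vertex determines the norm of that vertex.
\<close>
lemma simplex_gram:
  fixes w :: "nat \<Rightarrow> 'a::real_inner"
  assumes dist: "\<And>i j. i < N \<Longrightarrow> j < N \<Longrightarrow> i \<noteq> j \<Longrightarrow> dist (w i) (w j) = a"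
    and sum0: "(\<Sum>i<N. w i) = 0" and ij: "i < N" "j < N"
  shows "w i \<bullet> w j = (if i = j then a\<^sup>2 / 2 else 0) - a\<^sup>2 / (2 * N)"
proof -
  have N: "N > 0" using ij by simp
  have dist2: "w i \<bullet> w i + w j \<bullet> w j - 2 * (w i \<bullet> w j) = (if j = i then 0 else a\<^sup>2)"
    if "i < N" "j < N" for i j
  proof -
    have "(dist (w i) (w j))\<^sup>2 = w i \<bullet> w i + w j \<bullet> w j - 2 * (w i \<bullet> w j)"
      by (simp add: dist_norm power2_norm_eq_inner inner_diff_left inner_diff_right inner_commute)
    then show ?thesis using dist[OF that] by (cases "j = i") auto
  qed
  define T where "T = (\<Sum>j<N. w j \<bullet> w j)"
  have row: "N * (w i \<bullet> w i) + T = (real N - 1) * a\<^sup>2" if "i < N" for i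
  proof -
    have "(\<Sum>j<N. w i \<bullet> w i + w j \<bullet> w j - 2 * (w i \<bullet> w j)) =
        N * (w i \<bullet> w i) + T - 2 * (w i \<bullet> (\<Sum>j<N. w j))"
      by (simp add: sum.distrib sum_subtractf T_def inner_sum_right sum_distrib_left)
    moreover have "(\<Sum>j<N. w i \<bullet> w i + w j \<bullet> w j - 2 * (w i \<bullet> w j)) =
        (\<Sum>j<N. a\<^sup>2 - (if j = i then a\<^sup>2 else 0))"
      by (rule sum.cong) (use dist2 that in auto)
    moreover have "\<dots> = (real N - 1) * a\<^sup>2" using that by (simp add: sum_subtractf left_diff_distrib)
    ultimately show ?thesis by (simp add: sum0)
  qed
  have "(\<Sum>i<N. N * (w i \<bullet> w i) + T) = (\<Sum>i<N. (real N - 1) * a\<^sup>2)"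
    by (rule sum.cong) (use row in auto)
  then have "N * (2 * T) = N * ((real N - 1) * a\<^sup>2)"
    by (simp add: sum.distrib sum_distrib_left[symmetric] T_def[symmetric])
  then have "2 * T = (real N - 1) * a\<^sup>2" using N by simp
  then have norms: "w i \<bullet> w i = (real N - 1) * a\<^sup>2 / (2 * N)" if "i < N" for i
    using row[OF that] N by (simp add: field_simps)
  show ?thesis
  proof -
    have "(real N - 1) * a\<^sup>2 / (2 * N) = a\<^sup>2 / 2 - a\<^sup>2 / (2 * N)" using N by (simp add: field_simps)
    then show ?thesis
      using dist2[OF ij] norms[OF ij(1)] norms[OF ij(2)] by (cases "i = j") auto
  qed
qed

text \<open>
  Adding a suitable multiple of a new basis vector to the vertices makes them orthogonal, so that the
  frame identity becomes an expansion in an orthonormal basis.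
\<close>
lemma simplex_frame:
  fixes w :: "nat \<Rightarrow> fseq"
  assumes w: "\<And>i. i < Suc n \<Longrightarrow> w i \<in> Rn n" and a: "a > 0"
    and gram: "\<And>i j. i < Suc n \<Longrightarrow> j < Suc n \<Longrightarrow>
      w i \<bullet> w j = (if i = j then a\<^sup>2 / 2 else 0) - a\<^sup>2 / (2 * Suc n)"
    and sum0: "(\<Sum>i<Suc n. w i) = 0" and y: "y \<in> Rn n"
  shows "(\<Sum>j<Suc n. (w j \<bullet> y) *\<^sub>R w j) = (a\<^sup>2 / 2) *\<^sub>R y"
proof -
  \<comment> \<open>\<open>t * t\<close> cancels the common off-diagonal entry of the Gram matrix,
    and \<open>s\<close> normalises the remaining diagonal \<open>a\<^sup>2 / 2\<close>. The
    direction \<open>unit_fseq n\<close> is the first one orthogonal to \<open>Rn n\<close>.\<close>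
  define t where "t = sqrt (a\<^sup>2 / (2 * Suc n))"
  define s where "s = sqrt (a\<^sup>2 / 2)"
  have s: "s > 0" "s * s = a\<^sup>2 / 2" using a by (simp_all add: s_def)
  have t: "t * t = a\<^sup>2 / (2 * Suc n)" by (simp add: t_def)
  define z where "z j = (1 / s) *\<^sub>R (w j + t *\<^sub>R unit_fseq n)" for j
  have wn: "w j \<bullet> unit_fseq n = 0" "unit_fseq n \<bullet> w j = 0" if "j < Suc n" for j
    using w[OF that] by (simp_all add: inner_unit Rn_def)
  have ortho: "z i \<bullet> z j = (if i = j then 1 else 0)" if "i < Suc n" "j < Suc n" for i j
  proof -
    have "z i \<bullet> z j = (w i \<bullet> w j + t * t) / (s * s)"
      using that wn by (simp add: z_def inner_add_left inner_add_right inner_unit coord_unit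
          add_divide_distrib)
    then show ?thesis using gram[OF that] s a by (simp add: t)
  qed
  have sub: "Rn n \<subseteq> Rn (Suc n)" by (auto simp: Rn_def)
  have "span (z ` {..<Suc n}) = Rn (Suc n)"
  \<comment> \<open>A count: \<open>n + 1\<close> orthonormal vectors inside
    \<open>Rn (Suc n)\<close> must span it, so \<open>y\<close> expands in the
    \<open>z j\<close>.\<close>
  proof (rule orthonormal_family_spans[OF _ _ _ _ inner_commute linear_inner_left])
    show "card (unit_fseq ` {..<Suc n}) \<le> Suc n" using card_image_le[of "{..<Suc n}"] by simp
    show "z i \<in> Rn (Suc n)" if "i < Suc n" for i
      unfolding z_def using w[OF that] sub
      by (intro subspace_scale subspace_add subspace_Rn) (auto simp: Rn_def coord_unit)
  qed (use ortho in \<open>auto simp: subspace_Rn Rn_subset_span\<close>)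
  then obtain c where c: "y = lincomb (Suc n) z c" using y sub by (auto simp: span_eq_lincomb)
  have "y \<bullet> z j = c j" if j: "j < Suc n" for j
  proof -
    have "y \<bullet> z j = (\<Sum>i<Suc n. c i * (z i \<bullet> z j))"
      unfolding c lincomb_def by (simp only: inner_sum_left inner_scaleR_left)
    also have "\<dots> = (\<Sum>i<Suc n. if i = j then c i else 0)"
      by (rule sum.cong) (use ortho j in auto)
    finally show ?thesis using j by simp
  qed
  moreover have "y \<bullet> z j = (w j \<bullet> y) / s" for j
    using y by (simp add: z_def inner_add_right inner_unit Rn_def inner_commute)
  ultimately have cj: "c j = (w j \<bullet> y) / s" if "j < Suc n" for j using that by simp
  have "y = (\<Sum>j<Suc n. c j *\<^sub>R z j)" using c unfolding lincomb_def .
  also have "\<dots> = (\<Sum>j<Suc n. (1 / (s * s)) *\<^sub>R ((w j \<bullet> y) *\<^sub>R w j) + (w j \<bullet> y) *\<^sub>R ((t / (s * s)) *\<^sub>R unit_fseq n))"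
    by (rule sum.cong) (simp_all add: cj z_def scaleR_add_right)
  \<comment> \<open>The component along the additional direction is a multiple of the inner product
    of \<open>y\<close> with the sum of the \<open>w j\<close>, and so vanishes.\<close>
  also have "\<dots> = (1 / (s * s)) *\<^sub>R (\<Sum>j<Suc n. (w j \<bullet> y) *\<^sub>R w j)
      + ((\<Sum>j<Suc n. w j) \<bullet> y) *\<^sub>R ((t / (s * s)) *\<^sub>R unit_fseq n)"
    by (simp only: sum.distrib scaleR_sum_right inner_sum_left scaleR_sum_left)
  finally have "y = (1 / (s * s)) *\<^sub>R (\<Sum>j<Suc n. (w j \<bullet> y) *\<^sub>R w j)"
    by (simp only: sum0 inner_zero_left scaleR_zero_left add_0_right)
  then have "(s * s) *\<^sub>R y = (\<Sum>j<Suc n. (w j \<bullet> y) *\<^sub>R w j)"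
    using s(1) by (metis (no_types, lifting) divide_self_if mult_pos_pos order_less_irrefl
        scaleR_one scaleR_scaleR times_divide_eq_right mult.right_neutral)
  then show ?thesis using s(2) by simp
qed

lemma isotropy_const_simplex_le:
  assumes E: "subspace E" "E \<subseteq> Rn n" and d: "dim E > 0" and n: "n > 0"
    and S: "centered_regular_simplex n S"
  shows "isotropy_const E (orth_proj E ` S) \<le> 4 * sqrt (n / dim E)"
proof -
  interpret euclid E "SOME b. orthonormal_basis E b" by (rule euclid_subspace_Rn[OF E])
  obtain V a where V: "V \<subseteq> Rn n" "finite V" "card V = Suc n" "a > 0"
    "\<And>v w. v \<in> V \<Longrightarrow> w \<in> V \<Longrightarrow> v \<noteq> w \<Longrightarrow> dist v w = a" "S = convex hull V"
    using S by (auto simp: centered_regular_simplex_def)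
  obtain v where v: "bij_betw v {..<Suc n} V"
    using ex_bij_betw_nat_finite[OF V(2)] V(3) by (auto simp: atLeast0LessThan)
  have vV: "v i \<in> V" if "i < Suc n" for i using v that by (auto simp: bij_betw_def)
  \<comment> \<open>The average of the vertices. It makes the \<open>w i\<close> sum to 0, and its
    projection becomes the translation in the frame bound.\<close>
  define g where "g = (1 / Suc n) *\<^sub>R (\<Sum>i<Suc n. v i)"
  define w where "w i = v i - g" for i
  have gR: "g \<in> Rn n"
    unfolding g_def using vV V(1) by (intro subspace_scale subspace_sum subspace_Rn) auto
  have wR: "w i \<in> Rn n" if "i < Suc n" for i
    unfolding w_def using vV[OF that] V(1) gR by (intro subspace_diff subspace_Rn) auto
  have sum0: "(\<Sum>i<Suc n. w i) = 0"
  proof -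
    have "(\<Sum>i<Suc n. w i) = (\<Sum>i<Suc n. v i) - real (Suc n) *\<^sub>R g"
      by (simp only: w_def sum_subtractf sum_constant_scaleR card_lessThan)
    then show ?thesis by (simp add: g_def del: sum.lessThan_Suc of_nat_Suc)
  qed
  have dist: "dist (w i) (w j) = a" if "i < Suc n" "j < Suc n" "i \<noteq> j" for i j
  proof -
    have "v i \<noteq> v j" using v that by (auto simp: bij_betw_def dest: inj_onD)
    then have "dist (v i) (v j) = a" using V(5) vV that by blast
    then show ?thesis by (simp add: w_def dist_norm)
  qed
  have gram: "w i \<bullet> w j = (if i = j then a\<^sup>2 / 2 else 0) - a\<^sup>2 / (2 * Suc n)"
    if "i < Suc n" "j < Suc n" for i j
    by (rule simplex_gram[OF dist sum0 that])
  \<comment> \<open>The common norm given by the diagonal of the Gram matrix,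
    \<open>a\<^sup>2 / 2 - a\<^sup>2 / (2 * Suc n)\<close>. With \<open>N = n + 1\<close> the frame
    constant \<open>N * R\<^sup>2 / n\<close> becomes \<open>a\<^sup>2 / 2\<close>, as in
    \<open>simplex_frame\<close>.\<close>
  define R where "R = sqrt (n * a\<^sup>2 / (2 * real (Suc n)))"
  have R: "R > 0" "R\<^sup>2 = n * a\<^sup>2 / (2 * real (Suc n))" using n V(4) by (simp_all add: R_def)
  have img: "orth_proj E ` S = polytope_of (Suc n) (\<lambda>j. P (w j) + P g)"
    by (simp add: orth_proj_eq_P[abs_def] V(6) convex_hull_eq_polytope_of[OF v]
        polytope_of_linear_image[OF linear_P] w_def linear_diff[OF linear_P])
  show ?thesis unfolding img
  proof (rule isotropy_const_frame_le[where R = R])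
    show "w i \<bullet> w j \<le> 0" if "i < Suc n" "j < Suc n" "i \<noteq> j" for i j
      using gram[OF that(1,2)] that(3) by simp
    show "norm (w i) = R" if "i < Suc n" for i
    proof -
      have "w i \<bullet> w i = a\<^sup>2 / 2 - a\<^sup>2 / (2 * Suc n)" using gram[OF that that] by simp
      also have "\<dots> = R\<^sup>2" by (simp add: R(2) field_simps)
      finally show ?thesis using R(1) by (simp add: norm_eq_sqrt_inner)
    qed
    fix y assume "y \<in> E"
    then have "y \<in> Rn n" using E(2) by blast
    from simplex_frame[OF wR V(4) gram sum0 this]
    have "(\<Sum>j<Suc n. (w j \<bullet> y) *\<^sub>R w j) = (a\<^sup>2 / 2) *\<^sub>R y" .
    also have "a\<^sup>2 / 2 = real (Suc n) * R\<^sup>2 / n" using n by (simp add: R(2) del: of_nat_Suc)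
    finally show "(\<Sum>j<Suc n. (w j \<bullet> y) *\<^sub>R w j) = (real (Suc n) * R\<^sup>2 / n) *\<^sub>R y" .
  qed (use d n R(1) sum0 P_in_E in auto)
qed

theorem theorem3p4:
  shows "\<exists>C::real. C > 0 \<and>
    (\<forall>(n::nat) (d::nat) (E::fseq set).
       1 \<le> d \<longrightarrow> d \<le> n - 1 \<longrightarrow> subspace E \<longrightarrow> E \<subseteq> Rn n \<longrightarrow> dim E = d \<longrightarrow>
         isotropy_const E (orth_proj E ` B1 n) \<le> C * sqrt (real n / real d) \<and>
         (\<forall>S. centered_regular_simplex n S \<longrightarrow>
            isotropy_const E (orth_proj E ` S) \<le> C * sqrt (real n / real d)))"
proof (intro exI[of _ 4] conjI allI impI)
  fix n d and E S :: "fseq set"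
  assume *: "1 \<le> d" "d \<le> n - 1" "subspace E" "E \<subseteq> Rn n" "dim E = d"
  then have pos: "dim E > 0" "n > 0" by auto
  show "isotropy_const E (orth_proj E ` B1 n) \<le> 4 * sqrt (real n / real d)"
    using isotropy_const_B1_le[OF *(3,4) pos] *(5) by simp
  show "isotropy_const E (orth_proj E ` S) \<le> 4 * sqrt (real n / real d)"
    if "centered_regular_simplex n S"
    using isotropy_const_simplex_le[OF *(3,4) pos that] *(5) by simp
qed simp

end
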